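(* Let $H$ be a co-semisimple Hopf algebra over an algebraically closed field $\mathbb{K}$ of characteristic zero, and let $\check H$ be the vector space $H$ equipped with the convolution product. Let $\{V_\lambda\}_{\lambda\in\Lambda}$ be a set of representatives of the isomorphism classes of simple $H$-comodules. Then there is an isomorphism of algebras $$\check H\cong\bigoplus_{\lambda\in\Lambda}\operatorname{End}_{\mathbb{K}}(V_\lambda),$$ i.e. $\check H$ is isomorphic to the direct sum of the full endomorphism rings of the simple $H$-comodules.
   Context: A Hopf algebra is co-semisimple if every finite-dimensional comodule over it is a direct sum of simple comodules; equivalently, it has an integral whose value at $1_H$ is nonzero, and then left and right integrals coincide. A left integral is a nonzero linear functional $\int:H\to\mathbb{K}$ with $x_1\int(x_2)=\int(x)1_H$ for all $x\in H$ (Sweedler's notation $\Delta(x)=x_1\otimes x_2$); one such is fixed. With $S$ the antipode, the convolution product on $H$ is $g*f:=\int(fS(g_1))\,g_2$; it is associative but in general has no unit. The right-hand side is the direct sum of algebras with componentwise product. *)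

theory Defs
  imports
    "HOL-Library.FuncSet"
    "HOL-Library.Poly_Mapping"
    "HOL-Computational_Algebra.Polynomial"
begin

section \<open>Tensor products\<close>

text \<open>
  The type \<^typ>\<open>'a \<Rightarrow>\<^sub>0 'k\<close> is the free vector space over \<^typ>\<open>'k\<close> with basis \<^typ>\<open>'a\<close>; its
  elements are the finite formal linear combinations of elements of \<^typ>\<open>'a\<close>.
\<close>

abbreviation basis_elt :: "'a \<Rightarrow> ('a \<Rightarrow>\<^sub>0 'k::field)" where
  "basis_elt p \<equiv> Poly_Mapping.single p 1"

definition fs_scale :: "'k::field \<Rightarrow> ('a \<Rightarrow>\<^sub>0 'k) \<Rightarrow> ('a \<Rightarrow>\<^sub>0 'k)" where
  "fs_scale c = Poly_Mapping.map ((*) c)"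

lemma lookup_fs_scale [simp]:
  "Poly_Mapping.lookup (fs_scale c t) p = c * Poly_Mapping.lookup t p"
  unfolding fs_scale_def by transfer (simp add: when_def)

interpretation fs: vector_space "fs_scale :: 'k::field \<Rightarrow> ('a \<Rightarrow>\<^sub>0 'k) \<Rightarrow> ('a \<Rightarrow>\<^sub>0 'k)"
  by unfold_locales (auto intro!: poly_mapping_eqI simp: lookup_add algebra_simps)

definition linear_ext ::
    "('k::field \<Rightarrow> 'w \<Rightarrow> 'w) \<Rightarrow> ('a \<Rightarrow> 'w::ab_group_add) \<Rightarrow> ('a \<Rightarrow>\<^sub>0 'k) \<Rightarrow> 'w" where
  "linear_ext s f t = (\<Sum>p\<in>Poly_Mapping.keys t. s (Poly_Mapping.lookup t p) (f p))"

text \<open>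
  The tensor product of vector spaces \<open>A\<close>, \<open>B\<close> is the free vector space on \<open>A \<times> B\<close> modulo the
  subspace spanned by the relations making \<open>(a, b)\<close> linear in each entry. An element of it is
  represented here by a formal combination of pairs (a choice of Sweedler summands), and equality
  in the tensor product is the congruence \<open>tensor_eq\<close>. The factors are subsets of types because
  comodules will be carried by subspaces. In \<open>slot_relations s A j\<close> the map \<open>j\<close> inserts an element
  of the factor \<open>A\<close> into one slot of a tuple whose other entries are fixed.
\<close>

definition slot_relations ::
    "('k::field \<Rightarrow> 'a \<Rightarrow> 'a) \<Rightarrow> 'a::ab_group_add set \<Rightarrow> ('a \<Rightarrow> 'p) \<Rightarrow> ('p \<Rightarrow>\<^sub>0 'k) set" where
  "slot_relations s A j =
     {basis_elt (j (a + a')) - basis_elt (j a) - basis_elt (j a') | a a'. a \<in> A \<and> a' \<in> A} \<union>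
     {basis_elt (j (s c a)) - fs_scale c (basis_elt (j a)) | c a. a \<in> A}"

definition tensor_eq ::
    "('k::field \<Rightarrow> 'a \<Rightarrow> 'a) \<Rightarrow> 'a::ab_group_add set \<Rightarrow> ('k \<Rightarrow> 'b \<Rightarrow> 'b) \<Rightarrow> 'b::ab_group_add set \<Rightarrow>
     ('a \<times> 'b \<Rightarrow>\<^sub>0 'k) \<Rightarrow> ('a \<times> 'b \<Rightarrow>\<^sub>0 'k) \<Rightarrow> bool" where
  "tensor_eq sa A sb B t u \<longleftrightarrow>
     t - u \<in> fs.span ((\<Union>b\<in>B. slot_relations sa A (\<lambda>a. (a, b))) \<union>
                      (\<Union>a\<in>A. slot_relations sb B (\<lambda>b. (a, b))))"

definition tensor3_eq ::
    "('k::field \<Rightarrow> 'a \<Rightarrow> 'a) \<Rightarrow> 'a::ab_group_add set \<Rightarrow> ('k \<Rightarrow> 'b \<Rightarrow> 'b) \<Rightarrow> 'b::ab_group_add set \<Rightarrow>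
     ('k \<Rightarrow> 'c \<Rightarrow> 'c) \<Rightarrow> 'c::ab_group_add set \<Rightarrow>
     ('a \<times> 'b \<times> 'c \<Rightarrow>\<^sub>0 'k) \<Rightarrow> ('a \<times> 'b \<times> 'c \<Rightarrow>\<^sub>0 'k) \<Rightarrow> bool" where
  "tensor3_eq sa A sb B sc C t u \<longleftrightarrow>
     t - u \<in> fs.span ((\<Union>b\<in>B. \<Union>c\<in>C. slot_relations sa A (\<lambda>a. (a, b, c))) \<union>
                      (\<Union>a\<in>A. \<Union>c\<in>C. slot_relations sb B (\<lambda>b. (a, b, c))) \<union>
                      (\<Union>a\<in>A. \<Union>b\<in>B. slot_relations sc C (\<lambda>c. (a, b, c))))"


section \<open>Hopf algebras and integrals\<close>

text \<open>
  The ring structure of the Hopf algebra comes from the type class of \<^typ>\<open>'h\<close>; \<open>comult x\<close> is a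
  representative of \<open>\<Delta>(x)\<close>.
\<close>

record (overloaded) ('k::zero, 'h) hopf =
  hscale :: "'k \<Rightarrow> 'h \<Rightarrow> 'h"
  comult :: "'h \<Rightarrow> ('h \<times> 'h \<Rightarrow>\<^sub>0 'k)"
  counit :: "'h \<Rightarrow> 'k"
  antipode :: "'h \<Rightarrow> 'h"

abbreviation HH_eq ::
    "('k::field, 'h::ab_group_add) hopf \<Rightarrow> ('h \<times> 'h \<Rightarrow>\<^sub>0 'k) \<Rightarrow> ('h \<times> 'h \<Rightarrow>\<^sub>0 'k) \<Rightarrow> bool" where
  "HH_eq H \<equiv> tensor_eq (hscale H) UNIV (hscale H) UNIV"

abbreviation HHH_eq ::
    "('k::field, 'h::ab_group_add) hopf \<Rightarrow>
     ('h \<times> 'h \<times> 'h \<Rightarrow>\<^sub>0 'k) \<Rightarrow> ('h \<times> 'h \<times> 'h \<Rightarrow>\<^sub>0 'k) \<Rightarrow> bool" where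
  "HHH_eq H \<equiv> tensor3_eq (hscale H) UNIV (hscale H) UNIV (hscale H) UNIV"

locale hopf_algebra =
  fixes H :: "('k::field, 'h::ring_1) hopf"
  assumes vector_space: "vector_space (hscale H)"
    and scale_mult_left: "hscale H c (x * y) = hscale H c x * y"
    and scale_mult_right: "hscale H c (x * y) = x * hscale H c y"
    and comult_add: "HH_eq H (comult H (x + y)) (comult H x + comult H y)"
    and comult_scale: "HH_eq H (comult H (hscale H c x)) (fs_scale c (comult H x))"
    and counit_linear: "Vector_Spaces.linear (hscale H) (*) (counit H)"
    and coassoc:
      "HHH_eq H
         (linear_ext fs_scale
            (\<lambda>(a, b). linear_ext fs_scale (\<lambda>(a1, a2). basis_elt (a1, a2, b)) (comult H a))
            (comult H x))
         (linear_ext fs_scale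
            (\<lambda>(a, b). linear_ext fs_scale (\<lambda>(b1, b2). basis_elt (a, b1, b2)) (comult H b))
            (comult H x))"
    and counit_left: "linear_ext (hscale H) (\<lambda>(a, b). hscale H (counit H a) b) (comult H x) = x"
    and counit_right: "linear_ext (hscale H) (\<lambda>(a, b). hscale H (counit H b) a) (comult H x) = x"
    and comult_one: "HH_eq H (comult H 1) (basis_elt (1, 1))"
    and comult_mult:
      "HH_eq H (comult H (x * y))
         (linear_ext fs_scale
            (\<lambda>(a, b). linear_ext fs_scale (\<lambda>(c, d). basis_elt (a * c, b * d)) (comult H y))
            (comult H x))"
    and counit_one: "counit H 1 = 1"
    and counit_mult: "counit H (x * y) = counit H x * counit H y"
    and antipode_linear: "Vector_Spaces.linear (hscale H) (hscale H) (antipode H)"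
    and antipode_left:
      "linear_ext (hscale H) (\<lambda>(a, b). antipode H a * b) (comult H x) = hscale H (counit H x) 1"
    and antipode_right:
      "linear_ext (hscale H) (\<lambda>(a, b). a * antipode H b) (comult H x) = hscale H (counit H x) 1"

definition left_integral :: "('k::field, 'h::ring_1) hopf \<Rightarrow> ('h \<Rightarrow> 'k) \<Rightarrow> bool" where
  "left_integral H I \<longleftrightarrow>
     Vector_Spaces.linear (hscale H) (*) I \<and> (\<exists>x. I x \<noteq> 0) \<and>
     (\<forall>x. linear_ext (hscale H) (\<lambda>(x1, x2). hscale H (I x2) x1) (comult H x) = hscale H (I x) 1)"

definition convolution ::
    "('k::field, 'h::ring_1) hopf \<Rightarrow> ('h \<Rightarrow> 'k) \<Rightarrow> 'h \<Rightarrow> 'h \<Rightarrow> 'h" where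
  "convolution H I g f =
     linear_ext (hscale H) (\<lambda>(g1, g2). hscale H (I (f * antipode H g1)) g2) (comult H g)"


section \<open>Comodules\<close>

text \<open>
  Comodules are right comodules. The underlying vector space is a subspace \<open>space V\<close> of a vector
  space with underlying type \<^typ>\<open>'v\<close>; this loses no generality and permits families of comodules of
  different dimensions in one type. The values of \<open>coact V\<close> represent elements of
  \<open>space V \<otimes> H\<close>.
\<close>

record (overloaded) ('k::zero, 'h, 'v) comodule =
  space :: "'v set"
  vscale :: "'k \<Rightarrow> 'v \<Rightarrow> 'v"
  coact :: "'v \<Rightarrow> ('v \<times> 'h \<Rightarrow>\<^sub>0 'k)"

abbreviation VH_eq ::
    "('k::field, 'h::ring_1) hopf \<Rightarrow> ('k, 'h, 'v::ab_group_add) comodule \<Rightarrow>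
     ('v \<times> 'h \<Rightarrow>\<^sub>0 'k) \<Rightarrow> ('v \<times> 'h \<Rightarrow>\<^sub>0 'k) \<Rightarrow> bool" where
  "VH_eq H V \<equiv> tensor_eq (vscale V) (space V) (hscale H) UNIV"

abbreviation VHH_eq ::
    "('k::field, 'h::ring_1) hopf \<Rightarrow> ('k, 'h, 'v::ab_group_add) comodule \<Rightarrow>
     ('v \<times> 'h \<times> 'h \<Rightarrow>\<^sub>0 'k) \<Rightarrow> ('v \<times> 'h \<times> 'h \<Rightarrow>\<^sub>0 'k) \<Rightarrow> bool" where
  "VHH_eq H V \<equiv> tensor3_eq (vscale V) (space V) (hscale H) UNIV (hscale H) UNIV"

locale right_comodule =
  fixes H :: "('k::field, 'h::ring_1) hopf" and V :: "('k, 'h, 'v::ab_group_add) comodule"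
  assumes vector_space: "vector_space (vscale V)"
    and subspace: "module.subspace (vscale V) (space V)"
    and coact_closed: "v \<in> space V \<Longrightarrow> Poly_Mapping.keys (coact V v) \<subseteq> space V \<times> UNIV"
    and coact_add:
      "\<lbrakk>v \<in> space V; w \<in> space V\<rbrakk> \<Longrightarrow> VH_eq H V (coact V (v + w)) (coact V v + coact V w)"
    and coact_scale:
      "v \<in> space V \<Longrightarrow> VH_eq H V (coact V (vscale V c v)) (fs_scale c (coact V v))"
    and coact_coassoc:
      "v \<in> space V \<Longrightarrow>
       VHH_eq H V
         (linear_ext fs_scale
            (\<lambda>(w, a). linear_ext fs_scale (\<lambda>(u, b). basis_elt (u, b, a)) (coact V w))
            (coact V v))
         (linear_ext fs_scale
            (\<lambda>(w, a). linear_ext fs_scale (\<lambda>(a1, a2). basis_elt (w, a1, a2)) (comult H a))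
            (coact V v))"
    and coact_counit:
      "v \<in> space V \<Longrightarrow>
       linear_ext (vscale V) (\<lambda>(w, a). vscale V (counit H a) w) (coact V v) = v"

definition finite_dimensional_comodule :: "('k::field, 'h, 'v::ab_group_add) comodule \<Rightarrow> bool" where
  "finite_dimensional_comodule V \<longleftrightarrow> (\<exists>B. finite B \<and> module.span (vscale V) B = space V)"

text \<open>\<open>subcomodule H V W\<close> says that the coaction maps \<open>W\<close> into the image of \<open>W \<otimes> H\<close> in \<open>V \<otimes> H\<close>.\<close>

definition subcomodule ::
    "('k::field, 'h::ring_1) hopf \<Rightarrow> ('k, 'h, 'v::ab_group_add) comodule \<Rightarrow> 'v set \<Rightarrow> bool" where
  "subcomodule H V W \<longleftrightarrow>
     module.subspace (vscale V) W \<and> W \<subseteq> space V \<and>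
     (\<forall>w\<in>W. \<exists>t. Poly_Mapping.keys t \<subseteq> W \<times> UNIV \<and> VH_eq H V (coact V w) t)"

definition simple_subcomodule ::
    "('k::field, 'h::ring_1) hopf \<Rightarrow> ('k, 'h, 'v::ab_group_add) comodule \<Rightarrow> 'v set \<Rightarrow> bool" where
  "simple_subcomodule H V W \<longleftrightarrow>
     subcomodule H V W \<and> W \<noteq> {0} \<and> (\<forall>U. subcomodule H V U \<and> U \<subseteq> W \<longrightarrow> U = {0} \<or> U = W)"

definition simple_comodule ::
    "('k::field, 'h::ring_1) hopf \<Rightarrow> ('k, 'h, 'v::ab_group_add) comodule \<Rightarrow> bool" where
  "simple_comodule H V \<longleftrightarrow> right_comodule H V \<and> simple_subcomodule H V (space V)"

definition direct_sum_of_simples ::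
    "('k::field, 'h::ring_1) hopf \<Rightarrow> ('k, 'h, 'v::ab_group_add) comodule \<Rightarrow> bool" where
  "direct_sum_of_simples H V \<longleftrightarrow>
     (\<exists>\<W>. finite \<W> \<and> (\<forall>W\<in>\<W>. simple_subcomodule H V W) \<and>
        (\<forall>v\<in>space V. \<exists>!w. w \<in> (\<Pi>\<^sub>E W\<in>\<W>. W) \<and> v = (\<Sum>W\<in>\<W>. w W)))"

text \<open>
  Quantifiers over all comodules must be restricted to comodules carried by a fixed type. The type
  \<^typ>\<open>nat \<Rightarrow>\<^sub>0 'k\<close> has countably infinite dimension, so every finite-dimensional comodule, and hence
  (by the fundamental theorem of comodules) every simple comodule, has an isomorphic copy carried
  by it.
\<close>

definition cosemisimple :: "('k::field, 'h::ring_1) hopf \<Rightarrow> bool" where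
  "cosemisimple H \<longleftrightarrow>
     (\<forall>V :: ('k, 'h, nat \<Rightarrow>\<^sub>0 'k) comodule.
        right_comodule H V \<and> finite_dimensional_comodule V \<longrightarrow> direct_sum_of_simples H V)"

definition linear_between ::
    "('k \<Rightarrow> 'v \<Rightarrow> 'v) \<Rightarrow> 'v::ab_group_add set \<Rightarrow>
     ('k \<Rightarrow> 'w \<Rightarrow> 'w) \<Rightarrow> 'w::ab_group_add set \<Rightarrow> ('v \<Rightarrow> 'w) \<Rightarrow> bool" where
  "linear_between s A s' B f \<longleftrightarrow>
     f \<in> A \<rightarrow> B \<and> (\<forall>v\<in>A. \<forall>w\<in>A. f (v + w) = f v + f w) \<and> (\<forall>c. \<forall>v\<in>A. f (s c v) = s' c (f v))"

definition comodule_isomorphic ::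
    "('k::field, 'h::ring_1) hopf \<Rightarrow> ('k, 'h, 'v::ab_group_add) comodule \<Rightarrow>
     ('k, 'h, 'w::ab_group_add) comodule \<Rightarrow> bool" where
  "comodule_isomorphic H V W \<longleftrightarrow>
     (\<exists>f. linear_between (vscale V) (space V) (vscale W) (space W) f \<and>
          bij_betw f (space V) (space W) \<and>
          (\<forall>v\<in>space V. VH_eq H W
             (linear_ext fs_scale (\<lambda>(u, a). basis_elt (f u, a)) (coact V v)) (coact W (f v))))"

definition simple_comodule_representatives ::
    "('k::field, 'h::ring_1) hopf \<Rightarrow> 'l set \<Rightarrow> ('l \<Rightarrow> ('k, 'h, 'v::ab_group_add) comodule) \<Rightarrow> bool"
  where
  "simple_comodule_representatives H \<Lambda> V \<longleftrightarrow>
     (\<forall>l\<in>\<Lambda>. simple_comodule H (V l)) \<and>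
     (\<forall>l\<in>\<Lambda>. \<forall>m\<in>\<Lambda>. comodule_isomorphic H (V l) (V m) \<longrightarrow> l = m) \<and>
     (\<forall>W :: ('k, 'h, nat \<Rightarrow>\<^sub>0 'k) comodule. simple_comodule H W \<longrightarrow>
        (\<exists>l\<in>\<Lambda>. comodule_isomorphic H W (V l)))"


section \<open>Algebras without unit\<close>

record ('k, 'a) nonunital_algebra =
  carrier :: "'a set"
  zero :: 'a
  add :: "'a \<Rightarrow> 'a \<Rightarrow> 'a"
  smult :: "'k \<Rightarrow> 'a \<Rightarrow> 'a"
  mult :: "'a \<Rightarrow> 'a \<Rightarrow> 'a"

definition algebra_isomorphic ::
    "('k, 'a) nonunital_algebra \<Rightarrow> ('k, 'b) nonunital_algebra \<Rightarrow> bool" where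
  "algebra_isomorphic A B \<longleftrightarrow>
     (\<exists>f. bij_betw f (carrier A) (carrier B) \<and>
        (\<forall>x\<in>carrier A. \<forall>y\<in>carrier A. f (add A x y) = add B (f x) (f y)) \<and>
        (\<forall>c. \<forall>x\<in>carrier A. f (smult A c x) = smult B c (f x)) \<and>
        (\<forall>x\<in>carrier A. \<forall>y\<in>carrier A. f (mult A x y) = mult B (f x) (f y)))"

definition convolution_algebra ::
    "('k::field, 'h::ring_1) hopf \<Rightarrow> ('h \<Rightarrow> 'k) \<Rightarrow> ('k, 'h) nonunital_algebra" where
  "convolution_algebra H I =
     \<lparr>carrier = UNIV, zero = 0, add = (+), smult = hscale H, mult = convolution H I\<rparr>"

definition End_algebra ::
    "('k::field, 'h, 'v::ab_group_add) comodule \<Rightarrow> ('k, 'v \<Rightarrow> 'v) nonunital_algebra" where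
  "End_algebra V =
     \<lparr>carrier = {f \<in> extensional (space V).
                   linear_between (vscale V) (space V) (vscale V) (space V) f},
      zero = (\<lambda>v\<in>space V. 0),
      add = (\<lambda>f g. \<lambda>v\<in>space V. f v + g v),
      smult = (\<lambda>c f. \<lambda>v\<in>space V. vscale V c (f v)),
      mult = compose (space V)\<rparr>"

definition direct_sum_algebra ::
    "'l set \<Rightarrow> ('l \<Rightarrow> ('k, 'a) nonunital_algebra) \<Rightarrow> ('k, 'l \<Rightarrow> 'a) nonunital_algebra" where
  "direct_sum_algebra \<Lambda> A =
     \<lparr>carrier = {F \<in> (\<Pi>\<^sub>E l\<in>\<Lambda>. carrier (A l)). finite {l \<in> \<Lambda>. F l \<noteq> zero (A l)}},
      zero = (\<lambda>l\<in>\<Lambda>. zero (A l)),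
      add = (\<lambda>F G. \<lambda>l\<in>\<Lambda>. add (A l) (F l) (G l)),
      smult = (\<lambda>c F. \<lambda>l\<in>\<Lambda>. smult (A l) c (F l)),
      mult = (\<lambda>F G. \<lambda>l\<in>\<Lambda>. mult (A l) (F l) (G l))\<rparr>"

end

theory Submission
  imports Defs
begin

text \<open>
  A functional \<open>\<zeta>\<close> on \<open>H\<close> acts on a right comodule by \<open>v \<mapsto> v\<^sub>0 \<zeta>(v\<^sub>1)\<close>, and subcomodules and colinear
  maps are the submodules and module maps for this action. Put \<open>b(g, x) = \<integral>(g S(x))\<close>. Invariance of
  the integral gives \<open>g\<^sub>1 b(g\<^sub>2, x) = x\<^sub>2 b(g, x\<^sub>1)\<close>, whence \<open>b(g * f, x) = b(g, x\<^sub>1) b(f, x\<^sub>2)\<close>, so letting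
  \<open>g\<close> act on each simple comodule through \<open>b(g, -)\<close> is an algebra homomorphism into the product of the
  endomorphism algebras. By co-semisimplicity \<open>H\<close> is spanned by the matrix coefficients of the simple
  comodules. The same identity and Schur's lemma show that the coefficient \<open>\<phi>(v\<^sub>0)v\<^sub>1\<close> of \<open>V\<^sub>\<lambda>\<close> acts as
  \<open>w \<mapsto> \<phi>(w) \<beta>(v)\<close> on \<open>V\<^sub>\<lambda>\<close> and as zero on every other simple comodule. The integral is also right
  invariant and does not vanish at \<open>1\<close>, which makes \<open>b\<close> nondegenerate; hence the homomorphism is
  injective and \<open>\<beta>\<close> is bijective, and the rank-one maps span the finite direct sum.
\<close>

section \<open>Linear algebra on subspaces\<close>

text \<open>Comultiplications and coactions return representatives, which satisfy the axioms only
  modulo the tensor relations. Over a field, multilinear forms separate the points of a tensor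
  product, so Hopf identities are proved as identities of scalars, and comodule notions are replaced
  by their counterparts for modules over the dual algebra, where the choice of representatives no
  longer matters. The hypotheses provide complete reducibility and a left integral only. Right
  invariance and \<open>I 1 \<noteq> 0\<close> have to be derived: on a simple comodule the integral
  acts as zero unless the comodule is trivial. Complete reducibility is assumed for comodules
  carried by \<open>nat \<Rightarrow>\<^sub>0 'k\<close>, so a finite-dimensional piece of
  \<open>H\<close> must be copied there before it applies. Since \<open>S \<circ> S\<close> need not
  be the identity, the orthogonality relations are twisted and \<open>\<beta>\<close> need not be a
  scalar. It is never computed; its linearity and bijectivity suffice.\<close>

abbreviation lin_on :: "('k::field \<Rightarrow> 'a \<Rightarrow> 'a) \<Rightarrow> 'a::ab_group_add set \<Rightarrow> ('a \<Rightarrow> 'k) \<Rightarrow> bool" where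
  "lin_on s A \<phi> \<equiv> linear_between s A (*) UNIV \<phi>"

lemma vector_space_field: "vector_space ((*) :: 'k::field \<Rightarrow> 'k \<Rightarrow> 'k)"
  by unfold_locales (auto simp: algebra_simps)

lemma linear_betweenD:
  assumes "linear_between s A s' B f"
  shows "v \<in> A \<Longrightarrow> f v \<in> B"
    and "v \<in> A \<Longrightarrow> w \<in> A \<Longrightarrow> f (v + w) = f v + f w"
    and "v \<in> A \<Longrightarrow> f (s c v) = s' c (f v)"
  using assms unfolding linear_between_def by auto

lemma linear_betweenI:
  assumes "\<And>v. v \<in> A \<Longrightarrow> f v \<in> B"
    and "\<And>v w. v \<in> A \<Longrightarrow> w \<in> A \<Longrightarrow> f (v + w) = f v + f w"
    and "\<And>c v. v \<in> A \<Longrightarrow> f (s c v) = s' c (f v)"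
  shows "linear_between s A s' B f"
  using assms unfolding linear_between_def by auto

lemma linear_between_compose:
  assumes "linear_between s A s' B f" "linear_between s' B s'' C g"
  shows "linear_between s A s'' C (\<lambda>x. g (f x))"
  using assms unfolding linear_between_def by (auto simp: Pi_iff)

lemma linear_between_mono:
  assumes "linear_between s A s' B f" "A' \<subseteq> A" "B \<subseteq> B'"
  shows "linear_between s A' s' B' f"
  using assms unfolding linear_between_def by blast

lemma linear_between_linear:
  assumes "Vector_Spaces.linear s s' f"
  shows "linear_between s A s' UNIV f"
  using assms by (intro linear_betweenI) (auto simp: Vector_Spaces.linear_iff)

lemma linear_between_0:
  assumes "linear_between s A s' B f" "vector_space s" "vector_space s'" "0 \<in> A"
  shows "f 0 = 0"
proof -
  interpret vs: vector_space s by fact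
  interpret vs': vector_space s' by fact
  show ?thesis using linear_betweenD(3)[OF assms(1,4), of 0] by simp
qed

lemma linear_between_uminus:
  assumes "linear_between s A s' B f" "vector_space s" "vector_space s'" "v \<in> A"
  shows "f (- v) = - f v"
proof -
  interpret vs: vector_space s by fact
  interpret vs': vector_space s' by fact
  show ?thesis using linear_betweenD(3)[OF assms(1,4), of "-1"] by simp
qed

lemma linear_between_diff:
  assumes "linear_between s A s' B f" "vector_space s" "vector_space s'"
    and "module.subspace s A" "v \<in> A" "w \<in> A"
  shows "f (v - w) = f v - f w"
proof -
  interpret vs: vector_space s by fact
  have "- w \<in> A" using assms vs.subspace_neg by blast
  then show ?thesis
    using linear_betweenD(2)[OF assms(1), of v "-w"] linear_between_uminus[OF assms(1-3,6)] assms(5)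
    by simp
qed

lemma linear_between_sum:
  assumes "linear_between s A s' B f" "vector_space s" "vector_space s'" "module.subspace s A"
    and "\<And>i. i \<in> J \<Longrightarrow> x i \<in> A"
  shows "f (\<Sum>i\<in>J. x i) = (\<Sum>i\<in>J. f (x i))"
  using assms(5)
proof (induction J rule: infinite_finite_induct)
  case (insert j J)
  interpret vs: vector_space s by fact
  have "(\<Sum>i\<in>J. x i) \<in> A" using insert assms(4) by (intro vs.subspace_sum) auto
  then show ?case using insert linear_betweenD(2)[OF assms(1)] by simp
qed (use linear_between_0[OF assms(1-3)] assms(2,4) in
      \<open>auto simp: module_iff_vector_space[symmetric] intro: module.subspace_0\<close>)

text \<open>A basis of \<open>span N\<close> stays independent when \<open>z\<close> is added, so
  the values 1 at \<open>z\<close> and 0 on the basis extend linearly. Separating a vector from a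
  span is what turns tensor equality, defined by membership in a span of relations, into tests on
  multilinear forms.\<close>

lemma (in vector_space) exists_functional:
  assumes "z \<notin> span N"
  obtains L where "lin_on scale UNIV L" "\<And>x. x \<in> N \<Longrightarrow> L x = 0" "L z = 1"
proof -
  obtain B where B: "B \<subseteq> N" "independent B" "N \<subseteq> span B"
    using maximal_independent_subset by blast
  have "span B = span N"
    using B by (metis span_mono span_span subset_antisym)
  then have z: "z \<notin> span B" using assms by simp
  then have ind: "independent (insert z B)" using B(2) by (rule independent_insertI)
  interpret vsp: vector_space_pair scale "(*) :: 'a \<Rightarrow> 'a \<Rightarrow> 'a"
    using vector_space_field by (simp add: vector_space_pair_def vector_space_axioms)
  obtain L where L: "Vector_Spaces.linear scale (*) L"
      "\<forall>x\<in>insert z B. L x = (if x = z then 1 else 0)"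
    using vsp.linear_independent_extend[OF ind, of "\<lambda>x. if x = z then 1 else 0"] by blast
  interpret L: Vector_Spaces.linear scale "(*)" L by fact
  have "x \<in> span B \<Longrightarrow> L x = 0" for x
    using L(2) z span_base by (intro L.eq_0_on_span[of B x]) auto
  then show ?thesis
    using that[of L] L linear_between_linear[OF L(1)] B(3) by auto
qed

lemma (in vector_space) functional_sep:
  assumes "\<And>L. lin_on scale UNIV L \<Longrightarrow> L x = L y"
  shows "x = y"
proof (rule ccontr)
  assume "x \<noteq> y"
  then have "x - y \<notin> span {}" by simp
  then obtain L where L: "lin_on scale UNIV L" "L (x - y) = 1"
    using exists_functional by blast
  have "L (x - y) = L x - L y"
    by (rule linear_between_diff[OF L(1)]) (auto intro: vector_space_axioms vector_space_field)
  then show False using assms[OF L(1)] L(2) by simp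
qed

text \<open>Coordinates are taken in a basis of the whole type that extends \<open>E\<close>. They
  are thus linear on \<open>UNIV\<close>, as functionals on \<open>H\<close> must be, while on
  \<open>A\<close> they agree with the coordinates in \<open>E\<close>.\<close>

lemma (in vector_space) finite_span_basis:
  assumes "finite B" "span B = A"
  obtains E e where "finite E" "E \<subseteq> A" "independent E" "span E = A"
    "\<And>x. lin_on scale UNIV (e x)" "\<And>v. v \<in> A \<Longrightarrow> v = (\<Sum>x\<in>E. scale (e x v) x)"
proof -
  obtain E where E: "E \<subseteq> B" "independent E" "B \<subseteq> span E"
    using maximal_independent_subset by blast
  have fin: "finite E" using E assms finite_subset by blast
  have sp: "span E = A" using E assms by (metis span_mono span_span subset_antisym)
  define E' where "E' = extend_basis E"
  have E': "independent E'" "E \<subseteq> E'" "span E' = UNIV"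
    using E(2) unfolding E'_def
    by (simp_all add: independent_extend_basis extend_basis_superset)
  have rep: "representation E' v = representation E v" if "v \<in> A" for v
    using representation_extend[OF E'(1)] E'(2) sp that by metis
  show ?thesis
  proof (rule that[of E "\<lambda>x v. representation E' v x"])
    show "lin_on scale UNIV (\<lambda>v. representation E' v x)" for x
      using E' by (intro linear_betweenI) (auto simp: representation_add representation_scale)
    show "v = (\<Sum>x\<in>E. scale (representation E' v x) x)" if "v \<in> A" for v
    proof -
      have "v \<in> span E" using that sp by simp
      from sum_representation_eq[OF E(2) this fin order_refl] show ?thesis
        unfolding rep[OF that] by (rule sym)
    qed
  qed (use fin sp E span_base rep in auto)
qed

lemma linear_between_inv_into:
  assumes f: "linear_between s A s' B f" and bij: "bij_betw f A B"
    and "vector_space s" "module.subspace s A"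
  shows "linear_between s' B s A (inv_into A f)"
proof -
  interpret vector_space s by fact
  have inv: "inv_into A f b \<in> A" "f (inv_into A f b) = b" if "b \<in> B" for b
    using that bij by (auto simp: bij_betw_def inv_into_into f_inv_into_f)
  have fA: "inv_into A f (f a) = a" if "a \<in> A" for a
    using that bij by (auto simp: bij_betw_def)
  show ?thesis
  proof (rule linear_betweenI)
    fix v w assume v: "v \<in> B" and w: "w \<in> B"
    have "f (inv_into A f v + inv_into A f w) = v + w"
      using linear_betweenD(2)[OF f] inv v w by simp
    then show "inv_into A f (v + w) = inv_into A f v + inv_into A f w"
      using fA[OF subspace_add[OF assms(4) inv(1)[OF v] inv(1)[OF w]]] by simp
  next
    fix c v assume v: "v \<in> B"
    have "f (s c (inv_into A f v)) = s' c v"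
      using linear_betweenD(3)[OF f] inv v by simp
    then show "inv_into A f (s' c v) = s c (inv_into A f v)"
      using fA[OF subspace_scale[OF assms(4) inv(1)[OF v]], of c] by simp
  qed (use inv in auto)
qed

lemma (in vector_space) subspace_finite_span:
  assumes "subspace D" "D \<subseteq> span F" "finite F"
  shows "\<exists>B. finite B \<and> span B = D"
proof -
  obtain B where B: "B \<subseteq> D" "independent B" "D \<subseteq> span B"
    using maximal_independent_subset by blast
  then have "finite B" using independent_span_bound[OF assms(3)] assms(2) by blast
  moreover have "span B = D" using B assms(1) by (intro span_subspace)
  ultimately show ?thesis by blast
qed

text \<open>An injective \<open>f\<close> sends a basis of \<open>A\<close> to an independent family
  of the same size; a vector of \<open>A\<close> outside its span would produce an independent set
  larger than the basis.\<close>

lemma (in vector_space) inj_imp_surj_on_span: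
  assumes "finite B" "span B = A" and f: "linear_between scale A scale A f" and "inj_on f A"
  shows "f ` A = A"
proof -
  obtain E e where E: "finite E" "E \<subseteq> A" "independent E" "span E = A"
    and e: "\<And>x. lin_on scale UNIV (e x)" "\<And>v. v \<in> A \<Longrightarrow> v = (\<Sum>x\<in>E. scale (e x v) x)"
    by (rule finite_span_basis[OF assms(1,2)], rule that) assumption+
  have A: "subspace A" using assms(2) by auto
  \<comment> \<open>\<open>f\<close> is linear only on \<open>A\<close>. Extending it by coordinates
    gives a map that is linear on the whole type and equals \<open>f\<close> on
    \<open>A\<close>.\<close>
  define g where "g v = (\<Sum>x\<in>E. scale (e x v) (f x))" for v
  have fA: "f x \<in> A" if "x \<in> A" for x using linear_betweenD(1)[OF f that] .
  have "Vector_Spaces.linear scale scale g"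
    unfolding Vector_Spaces.linear_iff g_def using linear_betweenD(2,3)[OF e(1)]
    by (auto simp: scale_sum_right sum.distrib scale_left_distrib vector_space_axioms)
  then interpret g: Vector_Spaces.linear scale scale g .
  have gf: "g v = f v" if "v \<in> A" for v
  proof -
    have "f v = f (\<Sum>x\<in>E. scale (e x v) x)" using e(2)[OF that] by simp
    also have "\<dots> = (\<Sum>x\<in>E. f (scale (e x v) x))"
      using A E(2) subspace_scale
      by (intro linear_between_sum[OF f vector_space_axioms vector_space_axioms A]) blast
    also have "\<dots> = g v"
      unfolding g_def using E(2) linear_betweenD(3)[OF f] by (intro sum.cong) auto
    finally show ?thesis by simp
  qed
  then have inj: "inj_on g A" using assms(4) inj_on_cong by blast
  have ind: "independent (g ` E)"
    using g.independent_injective_image[OF E(3)] inj E(4) by simp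
  have gE: "g ` E \<subseteq> A" using gf fA E(2) by auto
  have card: "card (g ` E) = card E" using inj E(2) by (meson card_image inj_on_subset)
  have "A \<subseteq> span (g ` E)"
  proof
    fix v assume v: "v \<in> A"
    show "v \<in> span (g ` E)"
    proof (rule ccontr)
      assume nv: "v \<notin> span (g ` E)"
      then have "independent (insert v (g ` E))" using ind by (rule independent_insertI)
      moreover have "insert v (g ` E) \<subseteq> span E" using gE v E(4) by auto
      ultimately have "card (insert v (g ` E)) \<le> card E"
        using independent_span_bound[OF E(1)] by blast
      then show False using card nv E(1) span_base by (simp add: card_insert_if split: if_splits)
    qed
  qed
  also have "\<dots> = g ` A" using g.span_image[of E] E(4) by simp
  also have "\<dots> = f ` A" using gf by auto
  finally show ?thesis using fA by auto
qed

subsection \<open>Eigenvectors over an algebraically closed field\<close>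

text \<open>This is \<open>p(f) v\<close>. An explicit sum over powers stands in for a polynomial in
  an endomorphism algebra, since \<open>f\<close> will be linear on a subspace only.\<close>

definition poly_act :: "('k::field \<Rightarrow> 'v \<Rightarrow> 'v) \<Rightarrow> ('v \<Rightarrow> 'v) \<Rightarrow> 'k poly \<Rightarrow> 'v \<Rightarrow> 'v::ab_group_add" where
  "poly_act s f p v = (\<Sum>i\<le>degree p. s (coeff p i) ((f ^^ i) v))"

context vector_space
begin

lemma poly_act_bound:
  "degree p \<le> n \<Longrightarrow> poly_act scale f p v = (\<Sum>i\<le>n. scale (coeff p i) ((f ^^ i) v))"
  unfolding poly_act_def by (rule sum.mono_neutral_left) (auto simp: coeff_eq_0)

lemma poly_act_add: "poly_act scale f (p + q) v = poly_act scale f p v + poly_act scale f q v"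
proof -
  define n where "n = max (degree p) (degree q)"
  have "degree (p + q) \<le> n" "degree p \<le> n" "degree q \<le> n"
    unfolding n_def by (auto intro: degree_add_le_max)
  then show ?thesis
    by (simp add: poly_act_bound[of _ n] sum.distrib scale_left_distrib)
qed

lemma poly_act_smult: "poly_act scale f (Polynomial.smult c p) v = scale c (poly_act scale f p v)"
  by (simp add: poly_act_bound[of _ "degree p"] degree_smult_le scale_sum_right)

lemma poly_act_monom: "poly_act scale f (monom c n) v = scale c ((f ^^ n) v)"
  by (subst poly_act_bound[of _ n])
    (auto simp: degree_monom_le if_distrib[of "\<lambda>c. scale c _"] cong: if_cong)

text \<open>Polynomials are bounded by vanishing coefficients from \<open>d\<close> on rather than
  by degree, so that \<open>d = 0\<close> still admits the zero polynomial.\<close>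

lemma subspace_poly_act: "subspace {poly_act scale f p v | p. \<forall>i\<ge>d. coeff p i = 0}"
proof (rule subspaceI)
  show "0 \<in> {poly_act scale f p v | p. \<forall>i\<ge>d. coeff p i = 0}"
    using poly_act_smult[of f 0 0 v] by (auto intro!: exI[of _ 0])
next
  fix x y assume "x \<in> {poly_act scale f p v | p. \<forall>i\<ge>d. coeff p i = 0}"
    "y \<in> {poly_act scale f p v | p. \<forall>i\<ge>d. coeff p i = 0}"
  then obtain p q where "x = poly_act scale f p v" "\<forall>i\<ge>d. coeff p i = 0"
    "y = poly_act scale f q v" "\<forall>i\<ge>d. coeff q i = 0" by blast
  then show "x + y \<in> {poly_act scale f p v | p. \<forall>i\<ge>d. coeff p i = 0}"
    by (auto intro!: exI[of _ "p + q"] simp: poly_act_add)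
next
  fix c x assume "x \<in> {poly_act scale f p v | p. \<forall>i\<ge>d. coeff p i = 0}"
  then obtain p where "x = poly_act scale f p v" "\<forall>i\<ge>d. coeff p i = 0" by blast
  then show "scale c x \<in> {poly_act scale f p v | p. \<forall>i\<ge>d. coeff p i = 0}"
    by (auto intro!: exI[of _ "Polynomial.smult c p"] simp: poly_act_smult)
qed

text \<open>As long as each \<open>(f ^^ d) v\<close> lies outside the span of its predecessors, the
  orbit yields independent sets of every size inside the span of the finite set \<open>B\<close>.
  Some power is therefore a combination of earlier ones, which is a polynomial relation.\<close>

lemma annihilating_poly:
  assumes "finite B" "span B = A" "f ` A \<subseteq> A" "v \<in> A"
  obtains p where "p \<noteq> 0" "poly_act scale f p v = 0"
proof -
  have orb: "(f ^^ i) v \<in> A" for i using assms by (induction i) auto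
  have "\<exists>d. (f ^^ d) v \<in> span ((\<lambda>i. (f ^^ i) v) ` {..<d})"
  proof (rule ccontr)
    assume "\<nexists>d. (f ^^ d) v \<in> span ((\<lambda>i. (f ^^ i) v) ` {..<d})"
    then have H: "(f ^^ d) v \<notin> span ((\<lambda>i. (f ^^ i) v) ` {..<d})" for d by simp
    have "independent ((\<lambda>i. (f ^^ i) v) ` {..<d}) \<and> card ((\<lambda>i. (f ^^ i) v) ` {..<d}) = d" for d
    proof (induction d)
      case (Suc d)
      have "(f ^^ d) v \<notin> (\<lambda>i. (f ^^ i) v) ` {..<d}" using H[of d] span_superset by (rule contra_subsetD[rotated])
      moreover have "(\<lambda>i. (f ^^ i) v) ` {..<Suc d} = insert ((f ^^ d) v) ((\<lambda>i. (f ^^ i) v) ` {..<d})"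
        unfolding lessThan_Suc image_insert ..
      moreover have "independent (insert ((f ^^ d) v) ((\<lambda>i. (f ^^ i) v) ` {..<d}))"
        using Suc by (rule independent_insertI[OF H conjunct1])
      ultimately show ?case using Suc by (simp only: card_insert_disjoint finite_imageI finite_lessThan not_False_eq_True simp_thms)
    qed (simp add: independent_empty)
    from this[of "Suc (card B)"] show False
      using independent_span_bound[OF assms(1), of "(\<lambda>i. (f ^^ i) v) ` {..<Suc (card B)}"]
        orb assms(2) by auto
  qed
  then obtain d where d: "(f ^^ d) v \<in> span ((\<lambda>i. (f ^^ i) v) ` {..<d})" by blast
  have "span ((\<lambda>i. (f ^^ i) v) ` {..<d}) \<subseteq> {poly_act scale f p v | p. \<forall>i\<ge>d. coeff p i = 0}"
  proof (rule span_minimal[OF _ subspace_poly_act], safe)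
    fix i assume "i < d"
    then show "\<exists>p. (f ^^ i) v = poly_act scale f p v \<and> (\<forall>i\<ge>d. coeff p i = 0)"
      by (intro exI[of _ "monom 1 i"]) (auto simp: poly_act_monom)
  qed
  then obtain q where q: "(f ^^ d) v = poly_act scale f q v" "\<forall>i\<ge>d. coeff q i = 0"
    using d by blast
  \<comment> \<open>The coefficient at \<open>d\<close> comes from \<open>monom 1 d\<close> alone,
    because \<open>q\<close> vanishes from \<open>d\<close> on; this makes the relation
    nontrivial.\<close>
  have "coeff (monom 1 d + Polynomial.smult (-1) q) d = 1" using q(2) by simp
  then have "monom 1 d + Polynomial.smult (-1) q \<noteq> 0" by (metis coeff_0 zero_neq_one)
  moreover have "poly_act scale f (monom 1 d + Polynomial.smult (-1) q) v = 0"
    by (simp only: poly_act_add poly_act_smult poly_act_monom q(1)[symmetric]) simp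
  ultimately show ?thesis using that by blast
qed

lemma poly_act_in:
  assumes "subspace A" "f ` A \<subseteq> A" "v \<in> A"
  shows "poly_act scale f p v \<in> A"
proof -
  have "(f ^^ i) v \<in> A" for i using assms by (induction i) auto
  then show ?thesis unfolding poly_act_def using assms(1)
    by (intro subspace_sum subspace_scale)
qed

lemma poly_act_linear_factor:
  assumes "subspace A" "linear_between scale A scale A f" "v \<in> A"
  shows "poly_act scale f ([:- a, 1:] * q) v
           = f (poly_act scale f q v) - scale a (poly_act scale f q v)"
proof -
  have orb: "(f ^^ i) v \<in> A" for i using assms(3) linear_betweenD(1)[OF assms(2)] by (induction i) auto
  have "poly_act scale f (pCons 0 q) v = (\<Sum>i\<le>Suc (degree q). scale (coeff (pCons 0 q) i) ((f ^^ i) v))"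
    by (rule poly_act_bound) (simp add: degree_pCons_le)
  also have "\<dots> = (\<Sum>i\<le>degree q. scale (coeff q i) (f ((f ^^ i) v)))"
    by (simp add: sum.atMost_Suc_shift del: sum.atMost_Suc)
  also have "\<dots> = f (poly_act scale f q v)"
    unfolding poly_act_def using orb assms(1) linear_betweenD(3)[OF assms(2)]
    by (subst linear_between_sum[OF assms(2) vector_space_axioms vector_space_axioms assms(1)])
      (auto intro: subspace_scale)
  finally have 1: "poly_act scale f (pCons 0 q) v = f (poly_act scale f q v)" .
  have "[:- a, 1:] * q = pCons 0 q + Polynomial.smult (- a) q" by simp
  then show ?thesis by (simp only: poly_act_add poly_act_smult 1) simp
qed

end

text \<open>Linear factors are stripped from an annihilating polynomial. With
  \<open>p = [:- a, 1:] * q\<close>, either \<open>q\<close> annihilates \<open>v\<close> too and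
  has smaller degree, or \<open>poly_act scale f q v\<close> is an eigenvector for \<open>a\<close>.
  A nonzero constant cannot annihilate \<open>v \<noteq> 0\<close>, so the process stops. Roots
  enter as a hypothesis because the scalars of the locale form an arbitrary field.\<close>

lemma (in vector_space) exists_eigenvector_aux:
  fixes p :: "'a poly"
  assumes "subspace A" "linear_between scale A scale A f" "v \<in> A" "v \<noteq> 0"
    and "p \<noteq> 0" "poly_act scale f p v = 0"
    and root: "\<And>p :: 'a poly. degree p > 0 \<Longrightarrow> \<exists>z. poly p z = 0"
  shows "\<exists>c. \<exists>w\<in>A. w \<noteq> 0 \<and> f w = scale c w"
  using assms(5,6)
proof (induction "degree p" arbitrary: p rule: less_induct)
  case less
  show ?case
  proof (cases "degree p = 0")
    case True
    then have "scale (coeff p 0) v = 0" using less by (simp add: poly_act_def)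
    then show ?thesis using assms(4) True less.prems(1) by (metis leading_coeff_0_iff scale_eq_0_iff)
  next
    case False
    then obtain a where "poly p a = 0" using root by blast
    then obtain q where q: "p = [:- a, 1:] * q" using poly_eq_0_iff_dvd by (metis dvdE)
    have q0: "q \<noteq> 0" using less.prems(1) q by auto
    define w where "w = poly_act scale f q v"
    have w: "w \<in> A"
      unfolding w_def using assms(1-3) linear_betweenD(1)[OF assms(2)] by (intro poly_act_in) auto
    show ?thesis
    proof (cases "w = 0")
      case True
      have "degree ([:- a, 1:] * q) = degree [:- a, 1:] + degree q"
        by (rule degree_mult_eq) (use q0 in simp_all)
      then have *: "degree q < degree p" using q by (simp del: mult_pCons_left)
      from less.hyps[OF * q0] show ?thesis using True unfolding w_def .
    next
      case False
      have "f w = scale a w"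
        using less.prems(2) poly_act_linear_factor[OF assms(1-3), of a q] q w_def by simp
      then show ?thesis using False w by blast
    qed
  qed
qed

lemma exists_eigenvector:
  fixes s :: "'k::alg_closed_field \<Rightarrow> 'v::ab_group_add \<Rightarrow> 'v"
  assumes "vector_space s" "finite B" "module.span s B = A" "linear_between s A s A f" "A \<noteq> {0}"
  obtains c w where "w \<in> A" "w \<noteq> 0" "f w = s c w"
proof -
  interpret vector_space s by fact
  have A: "subspace A" using assms(3) by auto
  obtain v where v: "v \<in> A" "v \<noteq> 0" using assms(5) subspace_0[OF A] by blast
  obtain p where p: "p \<noteq> 0" "poly_act s f p v = 0"
    using annihilating_poly[OF assms(2,3), of f v] v linear_betweenD(1)[OF assms(4)] by blast
  show ?thesis
    using exists_eigenvector_aux[OF A assms(4) v p] that alg_closed_imp_poly_has_root by blast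
qed

section \<open>Tensors\<close>

lemma linear_ext_superset:
  assumes "vector_space s" "finite P" "Poly_Mapping.keys t \<subseteq> P"
  shows "linear_ext s f t = (\<Sum>p\<in>P. s (Poly_Mapping.lookup t p) (f p))"
proof -
  interpret vector_space s by fact
  show ?thesis unfolding linear_ext_def
    using assms(2,3) by (intro sum.mono_neutral_left) (auto simp: in_keys_iff)
qed

lemma linear_ext_single:
  assumes "vector_space s"
  shows "linear_ext s f (Poly_Mapping.single p c) = s c (f p)"
  using linear_ext_superset[OF assms, of "{p}"] by simp

lemma linear_ext_basis_elt [simp]:
  assumes "vector_space s"
  shows "linear_ext s f (basis_elt p) = f p"
proof -
  interpret vector_space s by fact
  show ?thesis using linear_ext_single[OF assms, of f p 1] by simp
qed

lemma linear_ext_add: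
  assumes "vector_space s"
  shows "linear_ext s f (t + u) = linear_ext s f t + linear_ext s f u"
proof -
  interpret vector_space s by fact
  let ?P = "Poly_Mapping.keys t \<union> Poly_Mapping.keys u"
  show ?thesis
    using Poly_Mapping.keys_add[of t u]
    by (simp add: linear_ext_superset[OF assms, of ?P] lookup_add scale_left_distrib sum.distrib)
qed

lemma linear_ext_fs_scale:
  assumes "vector_space s"
  shows "linear_ext s f (fs_scale c t) = s c (linear_ext s f t)"
proof -
  interpret vector_space s by fact
  have "Poly_Mapping.keys (fs_scale c t) \<subseteq> Poly_Mapping.keys t" by (auto simp: in_keys_iff)
  then show ?thesis
    by (simp add: linear_ext_superset[OF assms, of "Poly_Mapping.keys t"] scale_sum_right)
qed

lemma linear_linear_ext:
  assumes "vector_space s"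
  shows "Vector_Spaces.linear fs_scale s (linear_ext s f)"
  unfolding Vector_Spaces.linear_iff
  using linear_ext_add[OF assms] linear_ext_fs_scale[OF assms] assms fs.vector_space_axioms by blast

lemma linear_ext_diff:
  assumes "vector_space s"
  shows "linear_ext s f (t - u) = linear_ext s f t - linear_ext s f u"
  using linear_linear_ext[OF assms, of f]
  unfolding Vector_Spaces.linear_iff_module_hom by (rule module_hom.diff)

lemma linear_ext_sum:
  assumes "vector_space s"
  shows "linear_ext s f (\<Sum>i\<in>J. t i) = (\<Sum>i\<in>J. linear_ext s f (t i))"
  using linear_linear_ext[OF assms, of f]
  unfolding Vector_Spaces.linear_iff_module_hom by (rule module_hom.sum)

lemma linear_ext_cong:
  assumes "\<And>p. p \<in> Poly_Mapping.keys t \<Longrightarrow> f p = g p"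
  shows "linear_ext s f t = linear_ext s g t"
  unfolding linear_ext_def using assms by (intro sum.cong) auto

lemma linear_between_linear_ext:
  assumes "linear_between s A s' B L" "vector_space s" "vector_space s'" "module.subspace s A"
    and "\<And>p. p \<in> Poly_Mapping.keys t \<Longrightarrow> f p \<in> A"
  shows "L (linear_ext s f t) = linear_ext s' (\<lambda>p. L (f p)) t"
proof -
  interpret vector_space s by fact
  show ?thesis unfolding linear_ext_def
    using assms(4,5) linear_betweenD(3)[OF assms(1)]
    by (subst linear_between_sum[OF assms(1-4)]) (auto intro: subspace_scale)
qed

lemma linear_ext_linear_ext:
  assumes "vector_space s"
  shows "linear_ext s f (linear_ext fs_scale g t) = linear_ext s (\<lambda>p. linear_ext s f (g p)) t"
  unfolding linear_ext_def[of fs_scale]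
  by (simp add: linear_ext_sum[OF assms] linear_ext_fs_scale[OF assms])
    (simp add: linear_ext_def)

lemma linear_ext_in:
  assumes "vector_space s" "module.subspace s A" "\<And>p. p \<in> Poly_Mapping.keys t \<Longrightarrow> f p \<in> A"
  shows "linear_ext s f t \<in> A"
proof -
  interpret vector_space s by fact
  show ?thesis unfolding linear_ext_def using assms(2,3)
    by (intro subspace_sum subspace_scale)
qed

lemma linear_ext_basis_elt_id: "linear_ext fs_scale basis_elt t = t"
proof (rule poly_mapping_eqI)
  fix p
  have "Poly_Mapping.lookup (linear_ext fs_scale basis_elt t) p
      = (\<Sum>q\<in>Poly_Mapping.keys t. Poly_Mapping.lookup t q * (if q = p then 1 else 0))"
    unfolding linear_ext_def by (simp add: lookup_sum lookup_single when_def)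
  also have "\<dots> = Poly_Mapping.lookup t p"
    by (auto simp: if_distrib in_keys_iff cong: if_cong)
  finally show "Poly_Mapping.lookup (linear_ext fs_scale basis_elt t) p = Poly_Mapping.lookup t p" .
qed

lemma linear_eq_linear_ext:
  assumes "lin_on fs_scale UNIV L"
  shows "L t = linear_ext (*) (\<lambda>p. L (basis_elt p)) t"
  using linear_between_linear_ext[OF assms fs.vector_space_axioms vector_space_field, of t basis_elt]
  by (simp add: linear_ext_basis_elt_id)

lemma fs_scale_single: "fs_scale c (Poly_Mapping.single i a) = Poly_Mapping.single i (c * a)"
  by (rule poly_mapping_eqI) (simp add: lookup_single when_def)

lemma fs_subspace_keys: "fs.subspace {t :: 'a \<Rightarrow>\<^sub>0 'b::field. Poly_Mapping.keys t \<subseteq> P}"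
proof (rule fs.subspaceI)
  fix x y :: "'a \<Rightarrow>\<^sub>0 'b" and c
  assume "x \<in> {t. Poly_Mapping.keys t \<subseteq> P}" "y \<in> {t. Poly_Mapping.keys t \<subseteq> P}"
  then show "x + y \<in> {t. Poly_Mapping.keys t \<subseteq> P}"
    using Poly_Mapping.keys_add[of x y] by blast
next
  fix x :: "'a \<Rightarrow>\<^sub>0 'b" and c
  assume "x \<in> {t. Poly_Mapping.keys t \<subseteq> P}"
  then show "fs_scale c x \<in> {t. Poly_Mapping.keys t \<subseteq> P}"
    by (auto simp: in_keys_iff)
qed simp

lemma keys_linear_ext:
  assumes "\<And>p. p \<in> Poly_Mapping.keys t \<Longrightarrow> Poly_Mapping.keys (f p) \<subseteq> P"
  shows "Poly_Mapping.keys (linear_ext fs_scale f t) \<subseteq> P"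
  using linear_ext_in[OF fs.vector_space_axioms fs_subspace_keys[of P], of t f] assms by simp

lemma linear_ext_slot_relations:
  assumes "vector_space s'" "linear_between s A s' UNIV (\<lambda>a. f (j a))" "z \<in> slot_relations s A j"
  shows "linear_ext s' f z = 0"
  using assms(3) linear_betweenD(2,3)[OF assms(2)]
  unfolding slot_relations_def
  by (auto simp: linear_ext_diff[OF assms(1)] linear_ext_fs_scale[OF assms(1)] assms(1))

lemma linear_ext_span_zero:
  assumes "vector_space s'" "\<And>x. x \<in> N \<Longrightarrow> linear_ext s' f x = 0" "z \<in> fs.span N"
  shows "linear_ext s' f z = 0"
  using linear_linear_ext[OF assms(1), of f] assms(2,3)
  unfolding Vector_Spaces.linear_iff_module_hom by (rule module_hom.eq_0_on_span)

text \<open>The universal property of the tensor product on representatives: a bilinear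
  \<open>f\<close> kills the generating relations, hence their span, so
  \<open>linear_ext s f\<close> descends to congruence classes.\<close>

lemma tensor_eq_linear_ext:
  assumes "tensor_eq sa A sb B t u" "vector_space s"
    and "\<And>b. b \<in> B \<Longrightarrow> linear_between sa A s UNIV (\<lambda>a. f (a, b))"
    and "\<And>a. a \<in> A \<Longrightarrow> linear_between sb B s UNIV (\<lambda>b. f (a, b))"
  shows "linear_ext s f t = linear_ext s f u"
proof -
  have "linear_ext s f (t - u) = 0"
    using assms(1) unfolding tensor_eq_def
  proof (rule linear_ext_span_zero[OF assms(2), rotated], elim UnE UN_E)
    show "linear_ext s f z = 0" if "b \<in> B" "z \<in> slot_relations sa A (\<lambda>a. (a, b))" for z b
      using linear_ext_slot_relations[OF assms(2), of sa A f "\<lambda>a. (a, b)"] assms(3) that by blast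
    show "linear_ext s f z = 0" if "a \<in> A" "z \<in> slot_relations sb B (\<lambda>b. (a, b))" for z a
      using linear_ext_slot_relations[OF assms(2), of sb B f "\<lambda>b. (a, b)"] assms(4) that by blast
  qed
  then show ?thesis by (simp add: linear_ext_diff[OF assms(2)])
qed

lemma tensor3_eq_linear_ext:
  assumes "tensor3_eq sa A sb B sc C t u" "vector_space s"
    and "\<And>b c. b \<in> B \<Longrightarrow> c \<in> C \<Longrightarrow> linear_between sa A s UNIV (\<lambda>a. f (a, b, c))"
    and "\<And>a c. a \<in> A \<Longrightarrow> c \<in> C \<Longrightarrow> linear_between sb B s UNIV (\<lambda>b. f (a, b, c))"
    and "\<And>a b. a \<in> A \<Longrightarrow> b \<in> B \<Longrightarrow> linear_between sc C s UNIV (\<lambda>c. f (a, b, c))"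
  shows "linear_ext s f t = linear_ext s f u"
proof -
  have "linear_ext s f (t - u) = 0"
    using assms(1) unfolding tensor3_eq_def
  proof (rule linear_ext_span_zero[OF assms(2), rotated], elim UnE UN_E)
    show "linear_ext s f z = 0"
      if "b \<in> B" "c \<in> C" "z \<in> slot_relations sa A (\<lambda>a. (a, b, c))" for z b c
      using linear_ext_slot_relations[OF assms(2), of sa A f "\<lambda>a. (a, b, c)"] assms(3) that by blast
    show "linear_ext s f z = 0"
      if "a \<in> A" "c \<in> C" "z \<in> slot_relations sb B (\<lambda>b. (a, b, c))" for z a c
      using linear_ext_slot_relations[OF assms(2), of sb B f "\<lambda>b. (a, b, c)"] assms(4) that by blast
    show "linear_ext s f z = 0"
      if "a \<in> A" "b \<in> B" "z \<in> slot_relations sc C (\<lambda>c. (a, b, c))" for z a b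
      using linear_ext_slot_relations[OF assms(2), of sc C f "\<lambda>c. (a, b, c)"] assms(5) that by blast
  qed
  then show ?thesis by (simp add: linear_ext_diff[OF assms(2)])
qed

text \<open>The relations of a slot are exactly the failures of additivity and homogeneity there, so
  a functional that kills them is linear in that slot. In this way a functional separating two
  tensors becomes a multilinear form.\<close>

lemma slot_relations_vanish:
  assumes "lin_on fs_scale UNIV L" "\<And>z. z \<in> slot_relations s A j \<Longrightarrow> L z = 0"
  shows "lin_on s A (\<lambda>a. L (basis_elt (j a)))"
proof (rule linear_betweenI)
  note D = linear_between_diff[OF assms(1) fs.vector_space_axioms vector_space_field fs.subspace_UNIV
      UNIV_I UNIV_I]
  show "L (basis_elt (j (v + w))) = L (basis_elt (j v)) + L (basis_elt (j w))"
    if "v \<in> A" "w \<in> A" for v w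
  proof -
    have "L (basis_elt (j (v + w)) - basis_elt (j v) - basis_elt (j w)) = 0"
      by (rule assms(2)) (use that in \<open>auto simp: slot_relations_def\<close>)
    then show ?thesis by (simp only: D) (simp add: diff_eq_eq add.commute)
  qed
  show "L (basis_elt (j (s c v))) = c * L (basis_elt (j v))" if "v \<in> A" for c v
  proof -
    have "L (basis_elt (j (s c v)) - fs_scale c (basis_elt (j v))) = 0"
      by (rule assms(2)) (use that in \<open>auto simp: slot_relations_def\<close>)
    then show ?thesis using linear_betweenD(3)[OF assms(1) UNIV_I, of c "basis_elt (j v)"]
      by (simp add: D)
  qed
qed simp

text \<open>Were \<open>t - u\<close> outside the span of the relations, some functional would be 1
  on it and 0 on the relations; its values on basis elements would be a bilinear form telling
  \<open>t\<close> and \<open>u\<close> apart.\<close>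

lemma tensor_eqI_forms:
  assumes "\<And>f. (\<And>b. b \<in> B \<Longrightarrow> lin_on sa A (\<lambda>a. f (a, b))) \<Longrightarrow>
       (\<And>a. a \<in> A \<Longrightarrow> lin_on sb B (\<lambda>b. f (a, b))) \<Longrightarrow> linear_ext (*) f t = linear_ext (*) f u"
  shows "tensor_eq sa A sb B t u"
proof (rule ccontr)
  assume "\<not> tensor_eq sa A sb B t u"
  then obtain L where L: "lin_on fs_scale UNIV L" "L (t - u) = 1" and
    0: "\<And>z. z \<in> (\<Union>b\<in>B. slot_relations sa A (\<lambda>a. (a, b))) \<union>
              (\<Union>a\<in>A. slot_relations sb B (\<lambda>b. (a, b))) \<Longrightarrow> L z = 0"
    unfolding tensor_eq_def by (rule fs.exists_functional) blast
  have "L t = L u"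
    unfolding linear_eq_linear_ext[OF L(1), of t] linear_eq_linear_ext[OF L(1), of u]
    by (rule assms; rule slot_relations_vanish[OF L(1)]; use 0 in blast)
  then show False
    using L linear_between_diff[OF L(1) fs.vector_space_axioms vector_space_field, of t u] by simp
qed

lemma tensor3_eqI_forms:
  assumes "\<And>f. (\<And>b c. b \<in> B \<Longrightarrow> c \<in> C \<Longrightarrow> lin_on sa A (\<lambda>a. f (a, b, c))) \<Longrightarrow>
       (\<And>a c. a \<in> A \<Longrightarrow> c \<in> C \<Longrightarrow> lin_on sb B (\<lambda>b. f (a, b, c))) \<Longrightarrow>
       (\<And>a b. a \<in> A \<Longrightarrow> b \<in> B \<Longrightarrow> lin_on sc C (\<lambda>c. f (a, b, c))) \<Longrightarrow>
       linear_ext (*) f t = linear_ext (*) f u"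
  shows "tensor3_eq sa A sb B sc C t u"
proof (rule ccontr)
  assume "\<not> tensor3_eq sa A sb B sc C t u"
  then obtain L where L: "lin_on fs_scale UNIV L" "L (t - u) = 1" and
    0: "\<And>z. z \<in> (\<Union>b\<in>B. \<Union>c\<in>C. slot_relations sa A (\<lambda>a. (a, b, c))) \<union>
                      (\<Union>a\<in>A. \<Union>c\<in>C. slot_relations sb B (\<lambda>b. (a, b, c))) \<union>
                      (\<Union>a\<in>A. \<Union>b\<in>B. slot_relations sc C (\<lambda>c. (a, b, c))) \<Longrightarrow> L z = 0"
    unfolding tensor3_eq_def by (rule fs.exists_functional) blast
  have 1: "b \<in> B \<Longrightarrow> c \<in> C \<Longrightarrow> z \<in> slot_relations sa A (\<lambda>a. (a, b, c)) \<Longrightarrow> L z = 0"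
    and 2: "a \<in> A \<Longrightarrow> c \<in> C \<Longrightarrow> z \<in> slot_relations sb B (\<lambda>b. (a, b, c)) \<Longrightarrow> L z = 0"
    and 3: "a \<in> A \<Longrightarrow> b \<in> B \<Longrightarrow> z \<in> slot_relations sc C (\<lambda>c. (a, b, c)) \<Longrightarrow> L z = 0"
    for a b c z
    by (rule 0, simp, metis)+
  have "L t = L u"
    unfolding linear_eq_linear_ext[OF L(1), of t] linear_eq_linear_ext[OF L(1), of u]
  proof (rule assms)
    show "lin_on sa A (\<lambda>a. L (basis_elt (a, b, c)))" if "b \<in> B" "c \<in> C" for b c
      using slot_relations_vanish[OF L(1) 1[OF that]] .
    show "lin_on sb B (\<lambda>b. L (basis_elt (a, b, c)))" if "a \<in> A" "c \<in> C" for a c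
      using slot_relations_vanish[OF L(1) 2[OF that]] .
    show "lin_on sc C (\<lambda>c. L (basis_elt (a, b, c)))" if "a \<in> A" "b \<in> B" for a b
      using slot_relations_vanish[OF L(1) 3[OF that]] .
  qed
  then show False
    using L linear_between_diff[OF L(1) fs.vector_space_axioms vector_space_field, of t u] by simp
qed

section \<open>Scalar-valued Sweedler calculus\<close>

text \<open>Identities in tensor powers of \<open>H\<close> are tested on multilinear forms; \<open>sw H x f\<close> stands for
  \<open>f(x\<^sub>1, x\<^sub>2)\<close>, and iterated coproducts are nested occurrences of \<open>sw\<close>.\<close>

definition sw :: "('k::field, 'h) hopf \<Rightarrow> 'h \<Rightarrow> ('h \<Rightarrow> 'h \<Rightarrow> 'k) \<Rightarrow> 'k" where
  "sw H x f = linear_ext (*) (\<lambda>(a, b). f a b) (comult H x)"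

lemma sw_alt:
  "sw H x f = (\<Sum>p\<in>Poly_Mapping.keys (comult H x). Poly_Mapping.lookup (comult H x) p * f (fst p) (snd p))"
  by (simp add: sw_def linear_ext_def case_prod_unfold)

lemma sw_swap: "sw H x (\<lambda>a b. sw H y (\<lambda>c d. f a b c d)) = sw H y (\<lambda>c d. sw H x (\<lambda>a b. f a b c d))"
  unfolding sw_alt sum_distrib_left
  by (subst sum.swap) (simp add: mult.left_commute)

lemma sw_cmult: "sw H x (\<lambda>a b. c * f a b) = c * sw H x f"
  unfolding sw_alt sum_distrib_left by (simp add: mult.left_commute)

lemma sw_mult_right: "sw H x (\<lambda>a b. f a b * c) = sw H x f * c"
  unfolding sw_alt sum_distrib_right by (simp add: mult.assoc)

context hopf_algebra
begin

abbreviation form :: "('h \<Rightarrow> 'k) \<Rightarrow> bool" where "form \<equiv> lin_on (hscale H) UNIV"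
abbreviation endo :: "('h \<Rightarrow> 'h) \<Rightarrow> bool" where
  "endo \<equiv> linear_between (hscale H) UNIV (hscale H) UNIV"
abbreviation S :: "'h \<Rightarrow> 'h" where "S \<equiv> antipode H"
abbreviation \<epsilon> :: "'h \<Rightarrow> 'k" where "\<epsilon> \<equiv> counit H"
abbreviation \<Delta> :: "'h \<Rightarrow> ('h \<Rightarrow> 'h \<Rightarrow> 'k) \<Rightarrow> 'k" where "\<Delta> \<equiv> sw H"

interpretation vH: vector_space "hscale H" by (rule vector_space)

text \<open>Closure rules for the linear maps built from products and \<open>S\<close>. Together
  with the rules for forms they discharge the multilinearity conditions attached to the Sweedler
  steps below.\<close>

lemma endo_intros [intro]:
  "endo (\<lambda>x. x)"
  "endo S"
  "endo g \<Longrightarrow> endo (\<lambda>x. S (g x))"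
  "endo g \<Longrightarrow> endo (\<lambda>x. g x * a)"
  "endo g \<Longrightarrow> endo (\<lambda>x. a * g x)"
proof -
  show S: "endo S" by (rule linear_between_linear[OF antipode_linear])
  show "endo (\<lambda>x. S (g x))" if "endo g" by (rule linear_between_compose[OF that S])
  show "endo (\<lambda>x. g x * a)" if "endo g"
    using that by (auto simp: linear_between_def distrib_right scale_mult_left)
  show "endo (\<lambda>x. a * g x)" if "endo g"
    using that by (auto simp: linear_between_def distrib_left scale_mult_right)
qed (simp add: linear_between_def)

lemma form_compose: "form \<zeta> \<Longrightarrow> endo g \<Longrightarrow> form (\<lambda>x. \<zeta> (g x))"
  by (rule linear_between_compose)

lemma form_counit: "form \<epsilon>"
  using linear_between_linear[OF counit_linear] .

lemma form_cmult: "form f \<Longrightarrow> form (\<lambda>x. c * f x)"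
  by (auto simp: linear_between_def distrib_left)

lemma form_multc: "form f \<Longrightarrow> form (\<lambda>x. f x * c)"
  by (auto simp: linear_between_def distrib_right)

lemma form_sw: "(\<And>a b. form (\<lambda>x. f x a b)) \<Longrightarrow> form (\<lambda>x. \<Delta> y (f x))"
  by (auto simp: linear_between_def sw_alt distrib_left sum.distrib sum_distrib_left mult.left_commute)

lemma form_eqI: "(\<And>\<zeta>. form \<zeta> \<Longrightarrow> \<zeta> x = \<zeta> y) \<Longrightarrow> x = y"
  by (rule vH.functional_sep)

lemma form_linear_ext:
  "form \<zeta> \<Longrightarrow> \<zeta> (linear_ext (hscale H) f t) = linear_ext (*) (\<lambda>p. \<zeta> (f p)) t"
  by (rule linear_between_linear_ext) (auto intro: vector_space vector_space_field)

definition bil :: "('h \<Rightarrow> 'h \<Rightarrow> 'k) \<Rightarrow> bool" where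
  "bil f \<longleftrightarrow> (\<forall>b. form (\<lambda>a. f a b)) \<and> (\<forall>a. form (f a))"

lemma bilI: "(\<And>b. form (\<lambda>a. f a b)) \<Longrightarrow> (\<And>a. form (\<lambda>b. f a b)) \<Longrightarrow> bil f"
  by (simp add: bil_def)

lemma bilD1: "bil f \<Longrightarrow> endo g \<Longrightarrow> form (\<lambda>a. f (g a) b)"
  using form_compose[of "\<lambda>a. f a b" g] by (simp add: bil_def)

lemma bilD2: "bil f \<Longrightarrow> endo g \<Longrightarrow> form (\<lambda>b. f a (g b))"
  using form_compose[of "f a" g] by (simp add: bil_def)

lemma sw_tensor_eq:
  assumes "HH_eq H t u" "bil f"
  shows "linear_ext (*) (\<lambda>(a, b). f a b) t = linear_ext (*) (\<lambda>(a, b). f a b) u"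
  by (rule tensor_eq_linear_ext[OF assms(1) vector_space_field])
    (use assms(2) in \<open>auto simp: bil_def\<close>)

text \<open>\<open>comult\<close> is linear only up to the tensor congruence; a bilinear
  \<open>f\<close> does not see the difference, so pairing with it restores linearity in
  \<open>x\<close>.\<close>

lemma form_sw_arg:
  assumes "bil f"
  shows "form (\<lambda>x. \<Delta> x f)"
proof (rule linear_betweenI)
  fix v w c
  show "\<Delta> (v + w) f = \<Delta> v f + \<Delta> w f"
    using sw_tensor_eq[OF comult_add assms]
    by (simp add: sw_def linear_ext_add[OF vector_space_field])
  show "\<Delta> (hscale H c v) f = c * \<Delta> v f"
    using sw_tensor_eq[OF comult_scale assms]
    by (simp add: sw_def linear_ext_fs_scale[OF vector_space_field])
qed simp

lemma sw_coassoc: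
  assumes "\<And>b c. form (\<lambda>a. f a b c)" "\<And>a c. form (\<lambda>b. f a b c)" "\<And>a b. form (\<lambda>c. f a b c)"
  shows "\<Delta> x (\<lambda>r c. \<Delta> r (\<lambda>a b. f a b c)) = \<Delta> x (\<lambda>a r. \<Delta> r (\<lambda>b c. f a b c))"
proof -
  have "linear_ext (*) (\<lambda>(a, b, c). f a b c)
         (linear_ext fs_scale
            (\<lambda>(a, b). linear_ext fs_scale (\<lambda>(a1, a2). basis_elt (a1, a2, b)) (comult H a))
            (comult H x)) =
        linear_ext (*) (\<lambda>(a, b, c). f a b c)
         (linear_ext fs_scale
            (\<lambda>(a, b). linear_ext fs_scale (\<lambda>(b1, b2). basis_elt (a, b1, b2)) (comult H b))
            (comult H x))"
    by (rule tensor3_eq_linear_ext[OF coassoc vector_space_field]) (use assms in auto)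
  then show ?thesis
    by (simp add: linear_ext_linear_ext vector_space_field sw_def case_prod_unfold)
qed

lemma sw_counit_left: "form f \<Longrightarrow> \<Delta> x (\<lambda>a b. \<epsilon> a * f b) = f x"
  using form_linear_ext[of f "\<lambda>(a, b). hscale H (\<epsilon> a) b" "comult H x"]
    linear_betweenD(3)[of "hscale H" UNIV "(*)" UNIV f]
  by (simp add: sw_def case_prod_unfold counit_left[unfolded case_prod_unfold])

lemma sw_counit_right: "form f \<Longrightarrow> \<Delta> x (\<lambda>a b. \<epsilon> b * f a) = f x"
  using form_linear_ext[of f "\<lambda>(a, b). hscale H (\<epsilon> b) a" "comult H x"]
    linear_betweenD(3)[of "hscale H" UNIV "(*)" UNIV f]
  by (simp add: sw_def case_prod_unfold counit_right[unfolded case_prod_unfold])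

lemma sw_one: "bil f \<Longrightarrow> \<Delta> 1 f = f 1 1"
  using sw_tensor_eq[OF comult_one] by (simp add: sw_def vector_space_field)

lemma sw_mult:
  "bil f \<Longrightarrow> \<Delta> (x * y) f = \<Delta> x (\<lambda>a b. \<Delta> y (\<lambda>c d. f (a * c) (b * d)))"
  using sw_tensor_eq[OF comult_mult]
  by (simp add: sw_def vector_space_field linear_ext_linear_ext case_prod_unfold)

lemma sw_antipode_left: "form f \<Longrightarrow> \<Delta> x (\<lambda>a b. f (S a * b)) = \<epsilon> x * f 1"
  using form_linear_ext[of f "\<lambda>(a, b). S a * b" "comult H x"]
    linear_betweenD(3)[of "hscale H" UNIV "(*)" UNIV f]
  by (simp add: sw_def case_prod_unfold antipode_left[unfolded case_prod_unfold])

lemma sw_antipode_right: "form f \<Longrightarrow> \<Delta> x (\<lambda>a b. f (a * S b)) = \<epsilon> x * f 1"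
  using form_linear_ext[of f "\<lambda>(a, b). a * S b" "comult H x"]
    linear_betweenD(3)[of "hscale H" UNIV "(*)" UNIV f]
  by (simp add: sw_def case_prod_unfold antipode_right[unfolded case_prod_unfold])

text \<open>Both \<open>\<Delta> \<circ> S\<close> and \<open>(S \<otimes> S) \<circ> \<Delta>\<^sup>o\<^sup>p\<close> are convolution inverses of \<open>\<Delta>\<close>.\<close>

lemma sw_antipode:
  assumes f: "bil f"
  shows "\<Delta> (S x) f = \<Delta> x (\<lambda>a b. f (S b) (S a))"
proof -
  have f1: "form (\<lambda>a. f (g a) b)" and f2: "form (\<lambda>a. f b (g a))" if "endo g" for g b
    using bilD1[OF f that] bilD2[OF f that] by auto
  \<comment> \<open>This evaluates \<open>f\<close> at the product of \<open>p \<otimes> q\<close>,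
    \<open>\<Delta>(b)\<close> and
    \<open>(S \<otimes> S)(\<Delta>\<^sup>o\<^sup>p(c))\<close>.\<close>
  define G where "G p q b c = \<Delta> b (\<lambda>u v. \<Delta> c (\<lambda>y z. f (p * (u * S z)) (q * (v * S y))))" for p q b c
  \<comment> \<open>The product of \<open>\<Delta>\<close> with
    \<open>(S \<otimes> S) \<circ> \<Delta>\<^sup>o\<^sup>p\<close> collapses: coassociativity pairs
    the inner legs, \<open>v\<close> with \<open>S y\<close>, and once they cancel \<open>u\<close>
    meets the antipode of the remaining leg.\<close>
  have G: "\<Delta> r (G p q) = \<epsilon> r * f p q" for p q r
  proof -
    have "\<Delta> r (G p q) = \<Delta> r (\<lambda>u r'. \<Delta> r' (\<lambda>v c. \<Delta> c (\<lambda>y z. f (p * (u * S z)) (q * (v * S y)))))"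
      unfolding G_def
      by (rule sw_coassoc) (intro form_sw f1 f2 form_sw_arg bilI endo_intros)+
    also have "\<dots> = \<Delta> r (\<lambda>u r'. \<Delta> r' (\<lambda>w z. \<Delta> w (\<lambda>v y. f (p * (u * S z)) (q * (v * S y)))))"
      by (subst sw_coassoc) ((intro f1 f2 endo_intros)+, rule refl)
    also have "\<dots> = \<Delta> r (\<lambda>u r'. \<Delta> r' (\<lambda>w z. \<epsilon> w * f (p * (u * S z)) q))"
    proof -
      have "\<Delta> w (\<lambda>v y. f e (q * (v * S y))) = \<epsilon> w * f e q" for w e
        using sw_antipode_right[of "\<lambda>h. f e (q * h)" w] f2[OF endo_intros(5)[OF endo_intros(1)], of e q]
        by simp
      then show ?thesis by simp
    qed
    also have "\<dots> = \<Delta> r (\<lambda>u r'. f (p * (u * S r')) q)"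
      by (subst sw_counit_left) ((intro f1 f2 endo_intros)+, rule refl)
    also have "\<dots> = \<epsilon> r * f p q"
      using sw_antipode_right[of "\<lambda>h. f (p * h) q" r] f1[OF endo_intros(5)[OF endo_intros(1)], of p q]
      by simp
    finally show ?thesis .
  qed
  \<comment> \<open>\<open>E\<close> is the triple convolution product of
    \<open>\<Delta> \<circ> S\<close>, \<open>\<Delta>\<close> and
    \<open>(S \<otimes> S) \<circ> \<Delta>\<^sup>o\<^sup>p\<close> at \<open>x\<close>; the two
    bracketings leave one outer factor each.\<close>
  define E where "E = \<Delta> x (\<lambda>a r. \<Delta> r (\<lambda>b c. \<Delta> (S a) (\<lambda>p q. G p q b c)))"
  have "E = \<Delta> x (\<lambda>a r. \<Delta> (S a) (\<lambda>p q. \<Delta> r (G p q)))"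
    unfolding E_def by (subst sw_swap) (rule refl)
  also have "\<dots> = \<Delta> x (\<lambda>a r. \<epsilon> r * \<Delta> (S a) f)"
    by (simp add: G sw_cmult)
  also have "\<dots> = \<Delta> (S x) f"
    by (rule sw_counit_right) (use form_compose[OF form_sw_arg[OF f]] in blast)
  finally have 1: "E = \<Delta> (S x) f" .
  have bG: "bil (\<lambda>p q. G p q b c)" "form (G p q b)" "form (\<lambda>b. G p q b c)" for p q b c
    unfolding G_def by (intro form_sw f1 f2 form_sw_arg bilI endo_intros)+
  have "E = \<Delta> x (\<lambda>e c. \<Delta> e (\<lambda>a b. \<Delta> (S a) (\<lambda>p q. G p q b c)))"
    unfolding E_def
  proof (rule sw_coassoc[symmetric])
    show "form (\<lambda>a. \<Delta> (S a) (\<lambda>p q. G p q b c))" for b c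
      using form_compose[OF form_sw_arg[OF bG(1)]] by blast
  qed (intro form_sw bG)+
  also have "\<dots> = \<Delta> x (\<lambda>e c. \<epsilon> e * \<Delta> c (\<lambda>y z. f (S z) (S y)))"
  proof -
    have "\<Delta> e (\<lambda>a b. \<Delta> (S a) (\<lambda>p q. G p q b c)) = \<epsilon> e * \<Delta> c (\<lambda>y z. f (S z) (S y))" for e c
    proof -
      define h where "h p q = \<Delta> c (\<lambda>y z. f (p * S z) (q * S y))" for p q
      have h: "bil h" unfolding h_def by (intro form_sw f1 f2 bilI endo_intros)
      have "\<Delta> e (\<lambda>a b. \<Delta> (S a) (\<lambda>p q. G p q b c)) = \<Delta> e (\<lambda>a b. \<Delta> (S a * b) h)"
        unfolding sw_mult[OF h] by (simp add: G_def h_def mult.assoc)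
      also have "\<dots> = \<epsilon> e * h 1 1"
        using sw_antipode_left[OF form_sw_arg[OF h]] sw_one[OF h] by simp
      finally show ?thesis by (simp add: h_def)
    qed
    then show ?thesis by simp
  qed
  also have "\<dots> = \<Delta> x (\<lambda>y z. f (S z) (S y))"
    by (rule sw_counit_left) (intro form_sw_arg bilI f1 f2 endo_intros)
  finally show ?thesis using 1 by simp
qed

text \<open>Both \<open>(x, y) \<mapsto> S (x y)\<close> and \<open>(x, y) \<mapsto> S y S x\<close> are convolution inverses of the
  multiplication.\<close>

lemma antipode_mult: "S (x * y) = S y * S x"
proof (rule form_eqI)
  fix \<zeta> assume \<zeta>: "form \<zeta>"
  note fc = form_compose[OF \<zeta>]
  \<comment> \<open>The triple product of \<open>S(x y)\<close>, \<open>x y\<close> and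
    \<open>S y S x\<close> over \<open>H \<otimes> H\<close>: the legs \<open>a, b, e\<close> come
    from \<open>x\<close> and \<open>c, d, g\<close> from \<open>y\<close>. Cancelling on the right
    leaves the first factor, cancelling on the left the last.\<close>
  define E where "E = \<Delta> x (\<lambda>a r. \<Delta> y (\<lambda>c t. \<Delta> r (\<lambda>b e. \<Delta> t (\<lambda>d g.
     \<zeta> (S (a * c) * (b * (d * (S g * S e))))))))"
  have inner: "\<Delta> t (\<lambda>d g. \<zeta> (u * (b * (d * (S g * S e))))) = \<epsilon> t * \<zeta> (u * (b * S e))" for t u b e
  proof -
    have "form (\<lambda>h. \<zeta> (u * (b * (h * S e))))" by (intro fc endo_intros)
    from sw_antipode_right[OF this, of t] show ?thesis by (simp add: mult.assoc)
  qed
  have inner2: "\<Delta> r (\<lambda>b e. \<zeta> (u * (b * S e))) = \<epsilon> r * \<zeta> u" for r u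
    using sw_antipode_right[OF fc[OF endo_intros(5)[OF endo_intros(1)], of u]] by simp
  have "E = \<Delta> x (\<lambda>a r. \<epsilon> r * \<Delta> y (\<lambda>c t. \<epsilon> t * \<zeta> (S (a * c))))"
    unfolding E_def by (simp add: inner inner2 sw_cmult mult.left_commute)
  also have "\<dots> = \<Delta> x (\<lambda>a r. \<epsilon> r * \<zeta> (S (a * y)))"
    by (subst sw_counit_right) ((intro fc endo_intros)+, rule refl)
  also have "\<dots> = \<zeta> (S (x * y))"
    by (rule sw_counit_right) (intro fc endo_intros)
  finally have 1: "E = \<zeta> (S (x * y))" .
  have "E = \<Delta> y (\<lambda>c t. \<Delta> x (\<lambda>a r. \<Delta> r (\<lambda>b e. \<Delta> t (\<lambda>d g.
     \<zeta> (S (a * c) * (b * (d * (S g * S e))))))))"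
    unfolding E_def by (rule sw_swap)
  also have "\<dots> = \<Delta> y (\<lambda>c t. \<Delta> x (\<lambda>s e. \<Delta> s (\<lambda>a b. \<Delta> t (\<lambda>d g.
     \<zeta> (S (a * c) * (b * (d * (S g * S e))))))))"
    by (subst sw_coassoc) ((intro form_sw fc endo_intros)+, rule refl)
  also have "\<dots> = \<Delta> x (\<lambda>s e. \<Delta> s (\<lambda>a b. \<Delta> y (\<lambda>c t. \<Delta> t (\<lambda>d g.
     \<zeta> (S (a * c) * (b * (d * (S g * S e))))))))"
    by (subst sw_swap, subst (2) sw_swap) (rule refl)
  also have "\<dots> = \<Delta> x (\<lambda>s e. \<Delta> s (\<lambda>a b. \<Delta> y (\<lambda>w g. \<Delta> w (\<lambda>c d.
     \<zeta> (S (a * c) * (b * (d * (S g * S e))))))))"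
    by (subst sw_coassoc) ((intro form_sw fc endo_intros)+, rule refl)
  also have "\<dots> = \<Delta> x (\<lambda>s e. \<Delta> y (\<lambda>w g. \<Delta> s (\<lambda>a b. \<Delta> w (\<lambda>c d.
     \<zeta> (S (a * c) * ((b * d) * (S g * S e)))))))"
    by (subst (2) sw_swap) (simp add: mult.assoc)
  also have "\<dots> = \<Delta> x (\<lambda>s e. \<Delta> y (\<lambda>w g. \<epsilon> s * (\<epsilon> w * \<zeta> (S g * S e))))"
  proof -
    \<comment> \<open>Since \<open>\<Delta>\<close> is multiplicative, this is the antipode axiom
      for the single element \<open>s * w\<close>.\<close>
    have "\<Delta> s (\<lambda>a b. \<Delta> w (\<lambda>c d. \<zeta> (S (a * c) * ((b * d) * u)))) = \<epsilon> s * (\<epsilon> w * \<zeta> u)" for s w u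
    proof -
      have b: "bil (\<lambda>p q. \<zeta> (S p * (q * u)))" by (intro bilI fc endo_intros)
      have "\<Delta> (s * w) (\<lambda>p q. \<zeta> ((S p * q) * u)) = \<epsilon> (s * w) * \<zeta> (1 * u)"
        by (rule sw_antipode_left) (intro fc endo_intros)
      then show ?thesis using sw_mult[OF b, of s w] by (simp add: mult.assoc counit_mult)
    qed
    then show ?thesis by simp
  qed
  also have "\<dots> = \<Delta> x (\<lambda>s e. \<epsilon> s * \<zeta> (S y * S e))"
    unfolding sw_cmult
    by (subst sw_counit_left) ((intro fc endo_intros)+, rule refl)
  also have "\<dots> = \<zeta> (S y * S x)"
    by (rule sw_counit_left) (intro fc endo_intros)
  finally show "\<zeta> (S (x * y)) = \<zeta> (S y * S x)" using 1 by simp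
qed

lemma antipode_one: "S 1 = 1"
proof (rule form_eqI)
  fix \<zeta> assume \<zeta>: "form \<zeta>"
  have "\<Delta> 1 (\<lambda>a b. \<zeta> (S a * b)) = \<zeta> (S 1 * 1)"
    by (rule sw_one) (intro bilI form_compose[OF \<zeta>] endo_intros)
  then show "\<zeta> (S 1) = \<zeta> 1" using sw_antipode_left[OF \<zeta>, of 1] by (simp add: counit_one)
qed

text \<open>Apply \<open>S\<close> to \<open>S(x\<^sub>1) x\<^sub>2 = \<epsilon>(x) 1\<close> and
  use antimultiplicativity. This is the cancellation behind the right shift below.\<close>

lemma sw_antipode_antipode:
  assumes \<zeta>: "form \<zeta>"
  shows "\<Delta> x (\<lambda>a b. \<zeta> (S b * S (S a))) = \<epsilon> x * \<zeta> 1"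
proof -
  have "form (\<lambda>h. \<zeta> (S h))" by (intro form_compose[OF \<zeta>] endo_intros)
  from sw_antipode_left[OF this, of x] show ?thesis by (simp add: antipode_mult antipode_one)
qed

subsection \<open>The bilinear form of a two-sided integral\<close>

definition left_inv :: "('h \<Rightarrow> 'k) \<Rightarrow> bool" where
  "left_inv I \<longleftrightarrow> form I \<and> (\<forall>\<zeta> x. form \<zeta> \<longrightarrow> \<Delta> x (\<lambda>a b. \<zeta> a * I b) = I x * \<zeta> 1)"

definition right_inv :: "('h \<Rightarrow> 'k) \<Rightarrow> bool" where
  "right_inv I \<longleftrightarrow> form I \<and> (\<forall>\<zeta> x. form \<zeta> \<longrightarrow> \<Delta> x (\<lambda>a b. I a * \<zeta> b) = I x * \<zeta> 1)"

lemma left_integral_inv: "left_integral H I \<Longrightarrow> left_inv I"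
  unfolding left_inv_def
proof (intro conjI allI impI)
  assume I: "left_integral H I"
  then show "form I" unfolding left_integral_def by (blast intro: linear_between_linear)
  fix \<zeta> x assume \<zeta>: "form \<zeta>"
  have "\<zeta> (linear_ext (hscale H) (\<lambda>(x1, x2). hscale H (I x2) x1) (comult H x)) = I x * \<zeta> 1"
    using I linear_betweenD(3)[OF \<zeta>] unfolding left_integral_def by simp
  then show "\<Delta> x (\<lambda>a b. \<zeta> a * I b) = I x * \<zeta> 1"
    using linear_betweenD(3)[OF \<zeta>]
    by (simp add: form_linear_ext[OF \<zeta>] sw_def case_prod_unfold mult.commute)
qed

text \<open>Invariance is applied to \<open>g * S p\<close>, whose coproduct is
  \<open>g\<^sub>1 S(p\<^sub>2) \<otimes> g\<^sub>2 S(p\<^sub>1)\<close>, and the free leg is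
  multiplied by \<open>q\<close> on the right. When \<open>p \<otimes> q\<close> runs over the
  coproduct of \<open>x\<close>, the factors \<open>S(x\<^sub>2) x\<^sub>3\<close> cancel.\<close>

lemma left_inv_shift:
  assumes I: "left_inv I" and \<zeta>: "form \<zeta>"
  shows "\<Delta> g (\<lambda>a b. \<zeta> a * I (b * S x)) = \<Delta> x (\<lambda>p q. I (g * S p) * \<zeta> q)"
proof -
  have fI: "form I" using I by (simp add: left_inv_def)
  note fc = form_compose[OF fI] form_compose[OF \<zeta>]
  have "I (g * S p) * \<zeta> q = \<Delta> g (\<lambda>a b. \<Delta> p (\<lambda>c d. \<zeta> (a * (S d * q)) * I (b * S c)))" for p q
  proof -
    have b: "bil (\<lambda>y z. \<zeta> (y * q) * I z)"
      by (intro bilI form_cmult form_multc fc fI endo_intros)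
    have b': "bil (\<lambda>y z. \<zeta> (a * (y * q)) * I (b * z))" for a b
      by (intro bilI form_cmult form_multc fc fI endo_intros)
    have "form (\<lambda>y. \<zeta> (y * q))" by (intro fc endo_intros)
    then have "I (g * S p) * \<zeta> (1 * q) = \<Delta> (g * S p) (\<lambda>y z. \<zeta> (y * q) * I z)"
      using I unfolding left_inv_def by metis
    also have "\<dots> = \<Delta> g (\<lambda>a b. \<Delta> (S p) (\<lambda>y z. \<zeta> (a * (y * q)) * I (b * z)))"
      unfolding sw_mult[OF b] by (simp add: mult.assoc)
    also have "\<dots> = \<Delta> g (\<lambda>a b. \<Delta> p (\<lambda>c d. \<zeta> (a * (S d * q)) * I (b * S c)))"
      unfolding sw_antipode[OF b'] ..
    finally show ?thesis by simp
  qed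
  then have "\<Delta> x (\<lambda>p q. I (g * S p) * \<zeta> q)
      = \<Delta> x (\<lambda>p q. \<Delta> g (\<lambda>a b. \<Delta> p (\<lambda>c d. \<zeta> (a * (S d * q)) * I (b * S c))))"
    by simp
  also have "\<dots> = \<Delta> g (\<lambda>a b. \<Delta> x (\<lambda>p q. \<Delta> p (\<lambda>c d. \<zeta> (a * (S d * q)) * I (b * S c))))"
    by (rule sw_swap)
  also have "\<dots> = \<Delta> g (\<lambda>a b. \<Delta> x (\<lambda>c r. \<Delta> r (\<lambda>d q. \<zeta> (a * (S d * q)) * I (b * S c))))"
    by (subst sw_coassoc) ((intro form_cmult form_multc fc endo_intros)+, rule refl)
  also have "\<dots> = \<Delta> g (\<lambda>a b. \<Delta> x (\<lambda>c r. \<epsilon> r * (\<zeta> a * I (b * S c))))"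
  proof -
    have "\<Delta> r (\<lambda>d q. \<zeta> (a * (S d * q)) * I u) = \<epsilon> r * (\<zeta> a * I u)" for a r u
      using sw_antipode_left[OF fc(2)[OF endo_intros(5)[OF endo_intros(1)]], of r a]
      by (simp add: sw_mult_right)
    then show ?thesis by simp
  qed
  also have "\<dots> = \<Delta> g (\<lambda>a b. \<zeta> a * I (b * S x))"
    by (subst sw_counit_right) ((intro form_cmult form_multc fc endo_intros)+, rule refl)
  finally show ?thesis by simp
qed

text \<open>The mirror argument leaves \<open>g\<^sub>2 S(q\<^sub>1)\<close> in the free leg. Here
  \<open>S(q\<^sub>1)\<close> has to be cancelled against the preceding leg \<open>p\<close> of
  \<open>x\<close>, and \<open>S(q\<^sub>1) S(S(p))\<close> does so; this is where the double
  antipode comes from.\<close>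

lemma right_inv_shift:
  assumes I: "right_inv I" and \<zeta>: "form \<zeta>"
  shows "\<Delta> g (\<lambda>a b. I (a * S x) * \<zeta> b) = \<Delta> x (\<lambda>p q. \<zeta> (S (S p)) * I (g * S q))"
proof -
  have fI: "form I" using I by (simp add: right_inv_def)
  note fc = form_compose[OF fI] form_compose[OF \<zeta>]
  have "\<zeta> (S (S p)) * I (g * S q)
      = \<Delta> g (\<lambda>a b. \<Delta> q (\<lambda>c d. I (a * S d) * \<zeta> (b * (S c * S (S p)))))" for p q
  proof -
    have b: "bil (\<lambda>y z. I y * \<zeta> (z * S (S p)))"
      by (intro bilI form_cmult form_multc fc fI endo_intros)
    have b': "bil (\<lambda>y z. I (a * y) * \<zeta> (b * (z * S (S p))))" for a b
      by (intro bilI form_cmult form_multc fc fI endo_intros)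
    have "form (\<lambda>z. \<zeta> (z * S (S p)))" by (intro fc endo_intros)
    then have "I (g * S q) * \<zeta> (1 * S (S p)) = \<Delta> (g * S q) (\<lambda>y z. I y * \<zeta> (z * S (S p)))"
      using I unfolding right_inv_def by metis
    also have "\<dots> = \<Delta> g (\<lambda>a b. \<Delta> (S q) (\<lambda>y z. I (a * y) * \<zeta> (b * (z * S (S p)))))"
      unfolding sw_mult[OF b] by (simp add: mult.assoc)
    also have "\<dots> = \<Delta> g (\<lambda>a b. \<Delta> q (\<lambda>c d. I (a * S d) * \<zeta> (b * (S c * S (S p)))))"
      unfolding sw_antipode[OF b'] ..
    finally show ?thesis by (simp add: mult.commute)
  qed
  then have "\<Delta> x (\<lambda>p q. \<zeta> (S (S p)) * I (g * S q))
      = \<Delta> x (\<lambda>p q. \<Delta> g (\<lambda>a b. \<Delta> q (\<lambda>c d. I (a * S d) * \<zeta> (b * (S c * S (S p))))))"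
    by simp
  also have "\<dots> = \<Delta> g (\<lambda>a b. \<Delta> x (\<lambda>p q. \<Delta> q (\<lambda>c d. I (a * S d) * \<zeta> (b * (S c * S (S p))))))"
    by (rule sw_swap)
  also have "\<dots> = \<Delta> g (\<lambda>a b. \<Delta> x (\<lambda>r d. \<Delta> r (\<lambda>p c. I (a * S d) * \<zeta> (b * (S c * S (S p))))))"
    by (subst sw_coassoc) ((intro form_cmult form_multc fc endo_intros)+, rule refl)
  also have "\<dots> = \<Delta> g (\<lambda>a b. \<Delta> x (\<lambda>r d. \<epsilon> r * (I (a * S d) * \<zeta> b)))"
  proof -
    have "\<Delta> r (\<lambda>p c. I u * \<zeta> (b * (S c * S (S p)))) = \<epsilon> r * (I u * \<zeta> b)" for b r u
      using sw_antipode_antipode[OF fc(2)[OF endo_intros(5)[OF endo_intros(1)]], of r b]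
      by (simp add: sw_cmult mult.left_commute)
    then show ?thesis by simp
  qed
  also have "\<dots> = \<Delta> g (\<lambda>a b. I (a * S x) * \<zeta> b)"
    by (subst sw_counit_left) ((intro form_cmult form_multc fc endo_intros)+, rule refl)
  finally show ?thesis by simp
qed

end

section \<open>Comodules as modules over the dual algebra\<close>

text \<open>Contraction of the second tensor factor, \<open>id \<otimes> \<zeta>\<close>, on
  representatives.\<close>

definition slice ::
    "('k::field, 'h, 'v::ab_group_add) comodule \<Rightarrow> ('h \<Rightarrow> 'k) \<Rightarrow> ('v \<times> 'h \<Rightarrow>\<^sub>0 'k) \<Rightarrow> 'v" where
  "slice V \<zeta> t = linear_ext (vscale V) (\<lambda>(w, a). vscale V (\<zeta> a) w) t"

definition cact :: "('k::field, 'h, 'v::ab_group_add) comodule \<Rightarrow> ('h \<Rightarrow> 'k) \<Rightarrow> 'v \<Rightarrow> 'v" where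
  "cact V \<zeta> v = slice V \<zeta> (coact V v)"

definition coef ::
    "('k::field, 'h::ring_1) hopf \<Rightarrow> ('k, 'h, 'v::ab_group_add) comodule \<Rightarrow> ('v \<Rightarrow> 'k) \<Rightarrow> 'v \<Rightarrow> 'h"
  where
  "coef H V \<phi> v = linear_ext (hscale H) (\<lambda>(w, a). hscale H (\<phi> w) a) (coact V v)"

context hopf_algebra
begin

interpretation vH: vector_space "hscale H" by (rule vector_space)

text \<open>The product of the dual algebra, transposed from the comultiplication; to be kept apart
  from \<open>convolution\<close>, which multiplies elements of \<open>H\<close>.\<close>

definition cv :: "('h \<Rightarrow> 'k) \<Rightarrow> ('h \<Rightarrow> 'k) \<Rightarrow> 'h \<Rightarrow> 'k" where
  "cv \<eta> \<zeta> x = \<Delta> x (\<lambda>a b. \<eta> a * \<zeta> b)"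

lemma form_cv: "form \<eta> \<Longrightarrow> form \<zeta> \<Longrightarrow> form (cv \<eta> \<zeta>)"
  unfolding cv_def by (intro form_sw_arg bilI form_cmult form_multc)

lemma cv_counit_left: "form \<zeta> \<Longrightarrow> cv \<epsilon> \<zeta> = \<zeta>"
  by (auto simp: cv_def sw_counit_left)

lemma slice_superset:
  assumes "vector_space (vscale V)" "finite P" "Poly_Mapping.keys t \<subseteq> P"
  shows "slice V \<zeta> t = (\<Sum>p\<in>P. vscale V (Poly_Mapping.lookup t p * \<zeta> (snd p)) (fst p))"
proof -
  interpret vector_space "vscale V" by fact
  show ?thesis
    unfolding slice_def linear_ext_superset[OF assms] by (simp add: case_prod_unfold)
qed

text \<open>A representative has finitely many \<open>H\<close>-components, so one finite family
  with coordinate forms suffices to expand them all. Contracting with these forms then recovers the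
  tensor.\<close>

lemma finite_coordinates:
  assumes "finite F"
  shows "\<exists>E e. finite E \<and> (\<forall>x. form (e x)) \<and> (\<forall>a\<in>F. a = (\<Sum>x\<in>E. hscale H (e x a) x))"
proof (rule vH.finite_span_basis[OF assms refl])
  fix E e
  assume "finite E" "\<And>x. form (e x)" "\<And>v. v \<in> vH.span F \<Longrightarrow> v = (\<Sum>x\<in>E. hscale H (e x v) x)"
  then show ?thesis by (intro exI[of _ E] exI[of _ e] conjI allI ballI) (simp_all add: vH.span_base)
qed

lemma form_sum_coords:
  assumes "form \<zeta>" "a = (\<Sum>x\<in>E. hscale H (c x) x)"
  shows "\<zeta> a = (\<Sum>x\<in>E. c x * \<zeta> x)"
  unfolding assms(2) using linear_betweenD(3)[OF assms(1)]
  by (subst linear_between_sum[OF assms(1) vector_space vector_space_field]) auto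

lemma sum_linear_ext:
  "linear_ext (*) (\<lambda>p. \<Sum>x\<in>E. f x p) t = (\<Sum>x\<in>E. linear_ext (*) (f x) t)"
  unfolding linear_ext_def by (subst sum.swap) (simp add: sum_distrib_left)

text \<open>Expand the \<open>H\<close>-components of both tensors in one finite independent family.\<close>

lemma VH_eqI:
  assumes V: "vector_space (vscale V)" "module.subspace (vscale V) (space V)"
    and "Poly_Mapping.keys t \<subseteq> space V \<times> UNIV" "Poly_Mapping.keys u \<subseteq> space V \<times> UNIV"
    and eq: "\<And>\<zeta>. form \<zeta> \<Longrightarrow> slice V \<zeta> t = slice V \<zeta> u"
  shows "VH_eq H V t u"
proof (rule tensor_eqI_forms)
  fix f
  assume f1: "\<And>b. b \<in> UNIV \<Longrightarrow> lin_on (vscale V) (space V) (\<lambda>a. f (a, b))"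
    and f2: "\<And>a. a \<in> space V \<Longrightarrow> form (\<lambda>b. f (a, b))"
  interpret vV: vector_space "vscale V" by fact
  obtain E e where X: "finite E \<and> (\<forall>x. form (e x)) \<and>
      (\<forall>a\<in>snd ` (Poly_Mapping.keys t \<union> Poly_Mapping.keys u). a = (\<Sum>x\<in>E. hscale H (e x a) x))"
    by (rule exE[OF finite_coordinates[of "snd ` (Poly_Mapping.keys t \<union> Poly_Mapping.keys u)"]], simp, elim exE, rule that)
  note E = X[THEN conjunct1] X[THEN conjunct2, THEN conjunct1, rule_format]
    and co = X[THEN conjunct2, THEN conjunct2, rule_format]
  have *: "linear_ext (*) f z = (\<Sum>x\<in>E. f (slice V (e x) z, x))"
    if z: "Poly_Mapping.keys z \<subseteq> space V \<times> UNIV"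
      "Poly_Mapping.keys z \<subseteq> Poly_Mapping.keys t \<union> Poly_Mapping.keys u" for z
  proof -
    have "linear_ext (*) f z = linear_ext (*) (\<lambda>p. \<Sum>x\<in>E. e x (snd p) * f (fst p, x)) z"
    proof (rule linear_ext_cong)
      fix p assume p: "p \<in> Poly_Mapping.keys z"
      then have "fst p \<in> space V" using z(1) by auto
      from form_sum_coords[OF f2[OF this] co[of "snd p"]] p z(2)
      show "f p = (\<Sum>x\<in>E. e x (snd p) * f (fst p, x))" by auto
    qed
    also have "\<dots> = (\<Sum>x\<in>E. linear_ext (*) (\<lambda>p. e x (snd p) * f (fst p, x)) z)"
      by (rule sum_linear_ext)
    also have "\<dots> = (\<Sum>x\<in>E. f (slice V (e x) z, x))"
    proof (rule sum.cong[OF refl])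
      fix x
      have "f (slice V (e x) z, x)
          = linear_ext (*) (\<lambda>p. f (case p of (w, a) \<Rightarrow> vscale V (e x a) w, x)) z"
        unfolding slice_def
        using z(1) vV.subspace_scale[OF V(2)]
        by (intro linear_between_linear_ext[OF f1 V(1) vector_space_field V(2)]) auto
      also have "\<dots> = linear_ext (*) (\<lambda>p. e x (snd p) * f (fst p, x)) z"
      proof (rule linear_ext_cong)
        fix p assume "p \<in> Poly_Mapping.keys z"
        then have "fst p \<in> space V" using z(1) by auto
        then show "f (case p of (w, a) \<Rightarrow> vscale V (e x a) w, x) = e x (snd p) * f (fst p, x)"
          using linear_betweenD(3)[OF f1[of x]] by (simp add: case_prod_unfold)
      qed
      finally show "linear_ext (*) (\<lambda>p. e x (snd p) * f (fst p, x)) z = f (slice V (e x) z, x)" ..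
    qed
    finally show ?thesis .
  qed
  show "linear_ext (*) f t = linear_ext (*) f u"
    using *[of t] *[of u] assms(3,4) eq[OF E(2)] by simp
qed

text \<open>The same expansion is carried out in both \<open>H\<close>-slots with one common family,
  so that only contractions by products of two coordinate forms enter.\<close>

lemma VHH_eqI:
  assumes V: "vector_space (vscale V)" "module.subspace (vscale V) (space V)"
    and "Poly_Mapping.keys t \<subseteq> space V \<times> UNIV" "Poly_Mapping.keys u \<subseteq> space V \<times> UNIV"
    and eq: "\<And>\<eta> \<zeta>. form \<eta> \<Longrightarrow> form \<zeta> \<Longrightarrow>
      linear_ext (vscale V) (\<lambda>(w, a, b). vscale V (\<eta> a * \<zeta> b) w) t =
      linear_ext (vscale V) (\<lambda>(w, a, b). vscale V (\<eta> a * \<zeta> b) w) u"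
  shows "VHH_eq H V t u"
proof (rule tensor3_eqI_forms)
  fix f
  assume f1: "\<And>b c. b \<in> UNIV \<Longrightarrow> c \<in> UNIV \<Longrightarrow> lin_on (vscale V) (space V) (\<lambda>a. f (a, b, c))"
    and f2: "\<And>a c. a \<in> space V \<Longrightarrow> c \<in> UNIV \<Longrightarrow> form (\<lambda>b. f (a, b, c))"
    and f3: "\<And>a b. a \<in> space V \<Longrightarrow> b \<in> UNIV \<Longrightarrow> form (\<lambda>c. f (a, b, c))"
  interpret vV: vector_space "vscale V" by fact
  let ?K = "Poly_Mapping.keys t \<union> Poly_Mapping.keys u"
  let ?F = "(fst \<circ> snd) ` ?K \<union> (snd \<circ> snd) ` ?K"
  obtain E e where X: "finite E \<and> (\<forall>x. form (e x)) \<and>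
      (\<forall>a\<in>?F. a = (\<Sum>x\<in>E. hscale H (e x a) x))"
    by (rule exE[OF finite_coordinates[of "?F"]], simp, elim exE, rule that)
  note E = X[THEN conjunct1] X[THEN conjunct2, THEN conjunct1, rule_format]
    and co = X[THEN conjunct2, THEN conjunct2, rule_format]
  define sl where "sl x y z = linear_ext (vscale V) (\<lambda>(w, a, b). vscale V (e x a * e y b) w) z" for x y z
  have *: "linear_ext (*) f z = (\<Sum>x\<in>E. \<Sum>y\<in>E. f (sl x y z, x, y))"
    if z: "Poly_Mapping.keys z \<subseteq> space V \<times> UNIV" "Poly_Mapping.keys z \<subseteq> ?K" for z
  proof -
    have "linear_ext (*) f z = linear_ext (*) (\<lambda>p. \<Sum>x\<in>E. \<Sum>y\<in>E.
            e x (fst (snd p)) * e y (snd (snd p)) * f (fst p, x, y)) z"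
    proof (rule linear_ext_cong)
      fix p assume p: "p \<in> Poly_Mapping.keys z"
      then have w: "fst p \<in> space V" using z(1) by auto
      have a: "fst (snd p) \<in> ?F" "snd (snd p) \<in> ?F" using p z(2) by auto
      have "f p = f (fst p, fst (snd p), snd (snd p))" by simp
      also have "\<dots> = (\<Sum>x\<in>E. e x (fst (snd p)) * f (fst p, x, snd (snd p)))"
        by (rule form_sum_coords[OF f2[OF w UNIV_I] co[OF a(1)]])
      also have "\<dots> = (\<Sum>x\<in>E. e x (fst (snd p)) * (\<Sum>y\<in>E. e y (snd (snd p)) * f (fst p, x, y)))"
        by (subst form_sum_coords[OF f3[OF w UNIV_I] co[OF a(2)]]) (rule refl)
      finally show "f p = (\<Sum>x\<in>E. \<Sum>y\<in>E. e x (fst (snd p)) * e y (snd (snd p)) * f (fst p, x, y))"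
        by (simp add: sum_distrib_left mult.assoc)
    qed
    also have "\<dots> = (\<Sum>x\<in>E. \<Sum>y\<in>E.
        linear_ext (*) (\<lambda>p. e x (fst (snd p)) * e y (snd (snd p)) * f (fst p, x, y)) z)"
      by (simp add: sum_linear_ext)
    also have "\<dots> = (\<Sum>x\<in>E. \<Sum>y\<in>E. f (sl x y z, x, y))"
    proof (intro sum.cong[OF refl])
      fix x y
      have "f (sl x y z, x, y)
          = linear_ext (*) (\<lambda>p. f (case p of (w, a, b) \<Rightarrow> vscale V (e x a * e y b) w, x, y)) z"
        unfolding sl_def
        using z(1) vV.subspace_scale[OF V(2)]
        by (intro linear_between_linear_ext[OF f1 V(1) vector_space_field V(2)]) auto
      also have "\<dots> = linear_ext (*) (\<lambda>p. e x (fst (snd p)) * e y (snd (snd p)) * f (fst p, x, y)) z"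
      proof (rule linear_ext_cong)
        fix p assume "p \<in> Poly_Mapping.keys z"
        then have "fst p \<in> space V" using z(1) by auto
        then show "f (case p of (w, a, b) \<Rightarrow> vscale V (e x a * e y b) w, x, y)
            = e x (fst (snd p)) * e y (snd (snd p)) * f (fst p, x, y)"
          using linear_betweenD(3)[OF f1[of x y]] by (simp add: case_prod_unfold)
      qed
      finally show "linear_ext (*) (\<lambda>p. e x (fst (snd p)) * e y (snd (snd p)) * f (fst p, x, y)) z
          = f (sl x y z, x, y)" ..
    qed
    finally show ?thesis .
  qed
  show "linear_ext (*) f t = linear_ext (*) f u"
    using *[of t] *[of u] assms(3,4) eq[OF E(2) E(2)] by (simp add: sl_def)
qed

lemma slice_cong_tensor:
  assumes "vector_space (vscale V)" "VH_eq H V t u" "form \<zeta>"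
  shows "slice V \<zeta> t = slice V \<zeta> u"
proof -
  interpret vector_space "vscale V" by fact
  show ?thesis unfolding slice_def
    by (rule tensor_eq_linear_ext[OF assms(2,1)])
      (use assms(3) in \<open>auto simp: linear_between_def scale_left_distrib scale_right_distrib mult.commute\<close>)
qed

lemma slice_in:
  assumes "vector_space (vscale V)" "module.subspace (vscale V) W" "Poly_Mapping.keys t \<subseteq> W \<times> UNIV"
  shows "slice V \<zeta> t \<in> W"
proof -
  interpret vector_space "vscale V" by fact
  show ?thesis unfolding slice_def
    using assms(3) subspace_scale[OF assms(2)] by (intro linear_ext_in[OF assms(1,2)]) auto
qed

lemma slice_add: "vector_space (vscale V) \<Longrightarrow> slice V \<zeta> (t + u) = slice V \<zeta> t + slice V \<zeta> u"
  unfolding slice_def by (rule linear_ext_add)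

lemma slice_fs_scale: "vector_space (vscale V) \<Longrightarrow> slice V \<zeta> (fs_scale c t) = vscale V c (slice V \<zeta> t)"
  unfolding slice_def by (rule linear_ext_fs_scale)

text \<open>Contracted with \<open>\<eta> \<otimes> \<zeta>\<close>, this side of the
  coassociativity axiom is the iterated action and the other side, treated next, is the action of
  \<open>cv \<eta> \<zeta>\<close>. The leg of the outer coaction stands last, so
  \<open>\<zeta>\<close> acts first.\<close>

lemma slice_coassoc_left:
  assumes V: "vector_space (vscale V)" "module.subspace (vscale V) (space V)"
    and \<eta>: "linear_between (vscale V) (space V) (vscale V) (space V) (cact V \<eta>)"
    and t: "Poly_Mapping.keys t \<subseteq> space V \<times> UNIV"
  shows "linear_ext (vscale V) (\<lambda>(w, a, b). vscale V (\<eta> a * \<zeta> b) w)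
         (linear_ext fs_scale
            (\<lambda>(w, a). linear_ext fs_scale (\<lambda>(u, b). basis_elt (u, b, a)) (coact V w)) t)
         = cact V \<eta> (slice V \<zeta> t)"
proof -
  interpret vV: vector_space "vscale V" by fact
  have "cact V \<eta> (slice V \<zeta> t) = linear_ext (vscale V) (\<lambda>p. cact V \<eta> (case p of (w, a) \<Rightarrow> vscale V (\<zeta> a) w)) t"
    unfolding slice_def
    using t vV.subspace_scale[OF V(2)]
    by (intro linear_between_linear_ext[OF \<eta> V(1,1,2)]) auto
  also have "\<dots> = linear_ext (vscale V) (\<lambda>(w, a). vscale V (\<zeta> a) (cact V \<eta> w)) t"
    using t linear_betweenD(3)[OF \<eta>] by (intro linear_ext_cong) auto
  also have "\<dots> = linear_ext (vscale V) (\<lambda>(w, a). linear_ext (vscale V) (\<lambda>(u, b). vscale V (\<eta> b * \<zeta> a) u) (coact V w)) t"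
  proof (rule linear_ext_cong, clarify)
    fix w a
    show "vscale V (\<zeta> a) (cact V \<eta> w) = linear_ext (vscale V) (\<lambda>(u, b). vscale V (\<eta> b * \<zeta> a) u) (coact V w)"
      by (simp add: cact_def slice_def linear_ext_def vV.scale_sum_right case_prod_unfold mult.commute
          mult.left_commute)
  qed
  finally show ?thesis
    by (simp add: linear_ext_linear_ext[OF V(1)] V(1) case_prod_unfold)
qed

lemma slice_coassoc_right:
  assumes V: "vector_space (vscale V)"
  shows "linear_ext (vscale V) (\<lambda>(w, a, b). vscale V (\<eta> a * \<zeta> b) w)
         (linear_ext fs_scale
            (\<lambda>(w, a). linear_ext fs_scale (\<lambda>(a1, a2). basis_elt (w, a1, a2)) (comult H a)) t)
         = slice V (cv \<eta> \<zeta>) t"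
proof -
  interpret vV: vector_space "vscale V" by fact
  have "vscale V (cv \<eta> \<zeta> a) w = linear_ext (vscale V) (\<lambda>(a1, a2). vscale V (\<eta> a1 * \<zeta> a2) w) (comult H a)"
    for w a
    by (simp add: cv_def sw_alt linear_ext_def vV.scale_sum_left case_prod_unfold)
  then show ?thesis
    by (simp add: linear_ext_linear_ext[OF V(1)] V(1) case_prod_unfold slice_def)
qed

text \<open>Each comodule axiom equates tensors over the carrier, and such tensors are determined by
  their contractions. So it is enough to have a linear unital action of the dual algebra that arises
  from a coaction with legs in the carrier.\<close>

lemma right_comoduleI:
  assumes V: "vector_space (vscale V)" "module.subspace (vscale V) (space V)"
    and cl: "\<And>v. v \<in> space V \<Longrightarrow> Poly_Mapping.keys (coact V v) \<subseteq> space V \<times> UNIV"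
    and lin: "\<And>\<zeta>. form \<zeta> \<Longrightarrow> linear_between (vscale V) (space V) (vscale V) (space V) (cact V \<zeta>)"
    and mult: "\<And>\<eta> \<zeta> v. form \<eta> \<Longrightarrow> form \<zeta> \<Longrightarrow> v \<in> space V \<Longrightarrow>
      cact V \<eta> (cact V \<zeta> v) = cact V (cv \<eta> \<zeta>) v"
    and one: "\<And>v. v \<in> space V \<Longrightarrow> cact V \<epsilon> v = v"
  shows "right_comodule H V"
proof (rule right_comodule.intro)
  interpret vV: vector_space "vscale V" by fact
  show "vector_space (vscale V)" "module.subspace (vscale V) (space V)" by fact+
  show "Poly_Mapping.keys (coact V v) \<subseteq> space V \<times> UNIV" if "v \<in> space V" for v
    by (rule cl[OF that])
  show "VH_eq H V (coact V (v + w)) (coact V v + coact V w)" if "v \<in> space V" "w \<in> space V" for v w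
  proof (rule VH_eqI[OF V])
    show "Poly_Mapping.keys (coact V v + coact V w) \<subseteq> space V \<times> UNIV"
      using cl[OF that(1)] cl[OF that(2)] Poly_Mapping.keys_add[of "coact V v"] by blast
  qed (use that cl vV.subspace_add[OF V(2)] linear_betweenD(2)[OF lin] in
      \<open>auto simp: slice_add[OF V(1)] cact_def\<close>)
  show "VH_eq H V (coact V (vscale V c v)) (fs_scale c (coact V v))" if "v \<in> space V" for v c
  proof (rule VH_eqI[OF V])
    show "Poly_Mapping.keys (fs_scale c (coact V v)) \<subseteq> space V \<times> UNIV"
      using cl[OF that] fs.subspace_scale[OF fs_subspace_keys] by blast
  qed (use that cl vV.subspace_scale[OF V(2)] linear_betweenD(3)[OF lin] in
      \<open>auto simp: slice_fs_scale[OF V(1)] cact_def\<close>)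
  show "VHH_eq H V
         (linear_ext fs_scale
            (\<lambda>(w, a). linear_ext fs_scale (\<lambda>(u, b). basis_elt (u, b, a)) (coact V w))
            (coact V v))
         (linear_ext fs_scale
            (\<lambda>(w, a). linear_ext fs_scale (\<lambda>(a1, a2). basis_elt (w, a1, a2)) (comult H a))
            (coact V v))" if v: "v \<in> space V" for v
  proof (rule VHH_eqI[OF V])
    show "Poly_Mapping.keys (linear_ext fs_scale
            (\<lambda>(w, a). linear_ext fs_scale (\<lambda>(u, b). basis_elt (u, b, a)) (coact V w))
            (coact V v)) \<subseteq> space V \<times> UNIV"
    proof (intro keys_linear_ext, clarsimp split: prod.splits)
      fix w a u b c d
      assume 1: "(w, a) \<in> Poly_Mapping.keys (coact V v)"
        "(u, b) \<in> Poly_Mapping.keys (linear_ext fs_scale (\<lambda>(u, b). basis_elt (u, b, a)) (coact V w))"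
      have w: "w \<in> space V" using 1(1) cl[OF v] by auto
      have "Poly_Mapping.keys (linear_ext fs_scale (\<lambda>(u, b). basis_elt (u, b, a)) (coact V w)) \<subseteq> space V \<times> UNIV"
        using cl[OF w] by (intro keys_linear_ext) auto
      then show "u \<in> space V" using 1(2) by auto
    qed
    show "Poly_Mapping.keys (linear_ext fs_scale
            (\<lambda>(w, a). linear_ext fs_scale (\<lambda>(a1, a2). basis_elt (w, a1, a2)) (comult H a))
            (coact V v)) \<subseteq> space V \<times> UNIV"
    proof (intro keys_linear_ext, clarsimp split: prod.splits)
      fix w a u b c d
      assume 1: "(w, a) \<in> Poly_Mapping.keys (coact V v)"
        "(u, b) \<in> Poly_Mapping.keys (linear_ext fs_scale (\<lambda>(a1, a2). basis_elt (w, a1, a2)) (comult H a))"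
      have "Poly_Mapping.keys (linear_ext fs_scale (\<lambda>(a1, a2). basis_elt (w, a1, a2)) (comult H a)) \<subseteq> space V \<times> UNIV"
        using 1(1) cl[OF v] by (intro keys_linear_ext) auto
      then show "u \<in> space V" using 1(2) by auto
    qed
  qed (simp only: slice_coassoc_left[OF V lin cl[OF v]] slice_coassoc_right[OF V(1)]
        mult[OF _ _ v, unfolded cact_def[of V _ v]])
  show "linear_ext (vscale V) (\<lambda>(w, a). vscale V (counit H a) w) (coact V v) = v"
    if "v \<in> space V" for v
    using one[OF that] by (simp add: cact_def slice_def)
qed

section \<open>The dual-algebra module attached to a fixed comodule\<close>

context
  fixes V :: "('k, 'h, 'v::ab_group_add) comodule"
  assumes C: "right_comodule H V"
begin

lemma comodule_vs: "vector_space (vscale V)"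
  using C by (rule right_comodule.vector_space)

lemma comodule_subspace: "module.subspace (vscale V) (space V)"
  using C by (rule right_comodule.subspace)

interpretation vV: vector_space "vscale V" by (rule comodule_vs)

lemma cact_in: "v \<in> space V \<Longrightarrow> cact V \<zeta> v \<in> space V"
  unfolding cact_def
  by (intro slice_in comodule_vs comodule_subspace right_comodule.coact_closed[OF C])

lemma cact_linear:
  assumes "form \<zeta>"
  shows "linear_between (vscale V) (space V) (vscale V) (space V) (cact V \<zeta>)"
proof (rule linear_betweenI)
  show "cact V \<zeta> (v + w) = cact V \<zeta> v + cact V \<zeta> w" if "v \<in> space V" "w \<in> space V" for v w
    using slice_cong_tensor[OF comodule_vs right_comodule.coact_add[OF C that] assms]
    by (simp add: cact_def slice_add[OF comodule_vs])
  show "cact V \<zeta> (vscale V c v) = vscale V c (cact V \<zeta> v)" if "v \<in> space V" for v c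
    using slice_cong_tensor[OF comodule_vs right_comodule.coact_scale[OF C that] assms]
    by (simp add: cact_def slice_fs_scale[OF comodule_vs])
qed (rule cact_in)

lemma cact_cact:
  assumes "form \<eta>" "form \<zeta>" "v \<in> space V"
  shows "cact V \<eta> (cact V \<zeta> v) = cact V (cv \<eta> \<zeta>) v"
proof -
  let ?f = "\<lambda>(w, a, b). vscale V (\<eta> a * \<zeta> b) w"
  have "linear_ext (vscale V) ?f
         (linear_ext fs_scale
            (\<lambda>(w, a). linear_ext fs_scale (\<lambda>(u, b). basis_elt (u, b, a)) (coact V w)) (coact V v)) =
        linear_ext (vscale V) ?f
         (linear_ext fs_scale
            (\<lambda>(w, a). linear_ext fs_scale (\<lambda>(a1, a2). basis_elt (w, a1, a2)) (comult H a))
            (coact V v))"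
    by (rule tensor3_eq_linear_ext[OF right_comodule.coact_coassoc[OF C assms(3)] comodule_vs])
      (use assms(1,2) in \<open>auto simp: linear_between_def vV.scale_left_distrib vV.scale_right_distrib
         distrib_left distrib_right mult.assoc mult.left_commute\<close>)
  then show ?thesis
    unfolding slice_coassoc_left[OF comodule_vs comodule_subspace cact_linear[OF assms(1)]
        right_comodule.coact_closed[OF C assms(3)]] slice_coassoc_right[OF comodule_vs]
    by (simp add: cact_def)
qed

lemma cact_counit: "v \<in> space V \<Longrightarrow> cact V \<epsilon> v = v"
  unfolding cact_def slice_def by (rule right_comodule.coact_counit[OF C])

lemma cact_plus: "cact V (\<lambda>x. \<eta> x + \<zeta> x) v = cact V \<eta> v + cact V \<zeta> v"
  by (simp add: cact_def slice_superset[OF comodule_vs finite_keys order_refl] distrib_left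
      vV.scale_left_distrib sum.distrib)

lemma cact_times: "cact V (\<lambda>x. c * \<zeta> x) v = vscale V c (cact V \<zeta> v)"
  by (simp add: cact_def slice_superset[OF comodule_vs finite_keys order_refl]
      vV.scale_sum_right mult.left_commute)

lemma cact_sum: "cact V (\<lambda>x. \<Sum>i\<in>J. c i * \<zeta> i x) v = (\<Sum>i\<in>J. vscale V (c i) (cact V (\<zeta> i) v))"
  by (simp add: cact_def slice_superset[OF comodule_vs finite_keys order_refl]
      vV.scale_sum_right vV.scale_sum_left sum_distrib_left mult.left_commute)
    (rule sum.swap)

text \<open>Both sides contract \<open>coact V v\<close> with
  \<open>\<phi> \<otimes> \<zeta>\<close>, in the two possible orders. This is the bridge between
  values of functionals on matrix coefficients and the action.\<close>

lemma form_coef: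
  assumes "lin_on (vscale V) (space V) \<phi>" "form \<zeta>" "v \<in> space V"
  shows "\<zeta> (coef H V \<phi> v) = \<phi> (cact V \<zeta> v)"
proof -
  have "\<phi> (cact V \<zeta> v) = linear_ext (*) (\<lambda>p. \<phi> (case p of (w, a) \<Rightarrow> vscale V (\<zeta> a) w)) (coact V v)"
    unfolding cact_def slice_def
    using right_comodule.coact_closed[OF C assms(3)] vV.subspace_scale[OF comodule_subspace]
    by (intro linear_between_linear_ext[OF assms(1) comodule_vs vector_space_field comodule_subspace]) auto
  also have "\<dots> = linear_ext (*) (\<lambda>p. \<zeta> (case p of (w, a) \<Rightarrow> hscale H (\<phi> w) a)) (coact V v)"
    using right_comodule.coact_closed[OF C assms(3)] linear_betweenD(3)[OF assms(1)]
      linear_betweenD(3)[OF assms(2)]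
    by (intro linear_ext_cong) (auto simp: mult.commute)
  also have "\<dots> = \<zeta> (coef H V \<phi> v)"
    unfolding coef_def by (rule form_linear_ext[OF assms(2), symmetric])
  finally show ?thesis ..
qed

text \<open>Forwards, a representative with legs in \<open>W\<close> is contracted. Backwards,
  expanding the \<open>H\<close>-legs in finite coordinates \<open>e x\<close> rewrites the coaction
  of \<open>w\<close> as the sum of \<open>cact V (e x) w \<otimes> x\<close>, whose first legs lie
  in \<open>W\<close> by stability.\<close>

lemma subcomodule_iff:
  "subcomodule H V W \<longleftrightarrow>
     module.subspace (vscale V) W \<and> W \<subseteq> space V \<and> (\<forall>\<zeta>. form \<zeta> \<longrightarrow> (\<forall>w\<in>W. cact V \<zeta> w \<in> W))"
proof (intro iffI conjI allI impI ballI)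
  assume W: "subcomodule H V W"
  then show 1: "module.subspace (vscale V) W" and 2: "W \<subseteq> space V"
    by (auto simp: subcomodule_def)
  fix \<zeta> w assume \<zeta>: "form \<zeta>" and w: "w \<in> W"
  obtain t where t: "Poly_Mapping.keys t \<subseteq> W \<times> UNIV" "VH_eq H V (coact V w) t"
    using W w unfolding subcomodule_def by blast
  then show "cact V \<zeta> w \<in> W"
    unfolding cact_def slice_cong_tensor[OF comodule_vs t(2) \<zeta>] by (intro slice_in comodule_vs 1)
next
  assume W: "module.subspace (vscale V) W \<and> W \<subseteq> space V \<and> (\<forall>\<zeta>. form \<zeta> \<longrightarrow> (\<forall>w\<in>W. cact V \<zeta> w \<in> W))"
  show "subcomodule H V W"
    unfolding subcomodule_def
  proof (intro conjI ballI)
    fix w assume w: "w \<in> W"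
    obtain E e where X: "finite E \<and> (\<forall>x. form (e x)) \<and>
        (\<forall>a\<in>snd ` Poly_Mapping.keys (coact V w). a = (\<Sum>x\<in>E. hscale H (e x a) x))"
      by (rule exE[OF finite_coordinates[of "snd ` Poly_Mapping.keys (coact V w)"]], simp, elim exE, rule that)
    note E = X[THEN conjunct1] X[THEN conjunct2, THEN conjunct1, rule_format]
      and co = X[THEN conjunct2, THEN conjunct2, rule_format]
    define t :: "'v \<times> 'h \<Rightarrow>\<^sub>0 'k" where "t = (\<Sum>x\<in>E. basis_elt (cact V (e x) w, x))"
    have t: "t \<in> {t. Poly_Mapping.keys t \<subseteq> W \<times> UNIV}"
      unfolding t_def by (rule fs.subspace_sum[OF fs_subspace_keys]) (use W w E in auto)
    have "VH_eq H V (coact V w) t"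
    proof (rule VH_eqI[OF comodule_vs comodule_subspace])
      show "Poly_Mapping.keys (coact V w) \<subseteq> space V \<times> UNIV"
        using right_comodule.coact_closed[OF C] w W by blast
      show "Poly_Mapping.keys t \<subseteq> space V \<times> UNIV" using t W by blast
      fix \<zeta> assume \<zeta>: "form \<zeta>"
      have "slice V \<zeta> (coact V w) = slice V (\<lambda>a. \<Sum>x\<in>E. \<zeta> x * e x a) (coact V w)"
        unfolding slice_def using form_sum_coords[OF \<zeta> co]
        by (intro linear_ext_cong) (force simp: mult.commute)
      also have "\<dots> = (\<Sum>x\<in>E. vscale V (\<zeta> x) (cact V (e x) w))"
        using cact_sum[of \<zeta> e E w] by (simp add: cact_def)
      also have "\<dots> = slice V \<zeta> t"
        by (simp add: t_def slice_def linear_ext_sum[OF comodule_vs] comodule_vs)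
      finally show "slice V \<zeta> (coact V w) = slice V \<zeta> t" .
    qed
    then show "\<exists>t. Poly_Mapping.keys t \<subseteq> W \<times> UNIV \<and> VH_eq H V (coact V w) t"
      using t by blast
  qed (use W in auto)
qed

text \<open>Local finiteness of comodules: every contraction of \<open>coact V v\<close> lies in the
  span of its finitely many first legs, and the counit returns \<open>v\<close> itself.\<close>

lemma orbit_subcomodule:
  assumes v: "v \<in> space V"
  defines "U \<equiv> {cact V \<zeta> v | \<zeta>. form \<zeta>}"
  shows "subcomodule H V U" "v \<in> U" "\<exists>B. finite B \<and> vV.span B = U"
proof -
  have sub: "vV.subspace U"
  proof (rule vV.subspaceI)
    have "cact V (\<lambda>x. 0 * \<epsilon> x) v = 0" unfolding cact_times by simp
    moreover have "form (\<lambda>x. 0 * \<epsilon> x)" by (intro form_cmult form_counit)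
    ultimately show "0 \<in> U" unfolding U_def by (metis (mono_tags, lifting) mem_Collect_eq)
  next
    fix x y assume "x \<in> U" "y \<in> U"
    then obtain \<eta> \<zeta> where "form \<eta>" "form \<zeta>" "x = cact V \<eta> v" "y = cact V \<zeta> v"
      unfolding U_def by blast
    moreover from this have "form (\<lambda>x. \<eta> x + \<zeta> x)" by (auto simp: linear_between_def distrib_left)
    ultimately show "x + y \<in> U" unfolding U_def using cact_plus[of \<eta> \<zeta> v]
      by (metis (mono_tags, lifting) mem_Collect_eq)
  next
    fix c x assume "x \<in> U"
    then obtain \<zeta> where "form \<zeta>" "x = cact V \<zeta> v" unfolding U_def by blast
    then show "vscale V c x \<in> U" unfolding U_def using cact_times[of c \<zeta> v] form_cmult[of \<zeta> c]
      by (metis (mono_tags, lifting) mem_Collect_eq)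
  qed
  have "cact V \<eta> w \<in> U" if "form \<eta>" "w \<in> U" for \<eta> w
    using that v cact_cact[OF that(1)] form_cv[OF that(1)] unfolding U_def by blast
  then show "subcomodule H V U"
    unfolding subcomodule_iff using sub cact_in[OF v] by (auto simp: U_def)
  show "v \<in> U" using cact_counit[OF v] form_counit unfolding U_def by (metis (mono_tags, lifting) mem_Collect_eq)
  have keys: "Poly_Mapping.keys (coact V v) \<subseteq> vV.span (fst ` Poly_Mapping.keys (coact V v)) \<times> UNIV"
    by (auto intro!: vV.span_base intro: rev_image_eqI)
  have "U \<subseteq> vV.span (fst ` Poly_Mapping.keys (coact V v))"
    unfolding U_def cact_def using slice_in[OF comodule_vs vV.subspace_span keys] by blast
  then show "\<exists>B. finite B \<and> vV.span B = U"
    by (rule vV.subspace_finite_span[OF sub]) simp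
qed

lemma kernel_subcomodule:
  fixes W :: "('k, 'h, 'w::ab_group_add) comodule"
  assumes W: "right_comodule H W"
    and f: "linear_between (vscale V) (space V) (vscale W) (space W :: 'w::ab_group_add set) f"
    and int: "\<And>\<zeta> v. form \<zeta> \<Longrightarrow> v \<in> space V \<Longrightarrow> f (cact V \<zeta> v) = cact W \<zeta> (f v)"
  shows "subcomodule H V {v \<in> space V. f v = 0}"
  unfolding subcomodule_iff
proof (intro conjI allI impI ballI)
  interpret vW: vector_space "vscale W" using W by (rule right_comodule.vector_space)
  have W0: "0 \<in> space W" using right_comodule.subspace[OF W] by (rule vW.subspace_0)
  show "vV.subspace {v \<in> space V. f v = 0}"
    using vV.subspace_0[OF comodule_subspace] vV.subspace_add[OF comodule_subspace]
      vV.subspace_scale[OF comodule_subspace] linear_betweenD(2,3)[OF f]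
      linear_between_0[OF f comodule_vs vW.vector_space_axioms]
    by (intro vV.subspaceI) auto
next
  fix \<zeta> v assume \<zeta>: "form \<zeta>" and v: "v \<in> {v \<in> space V. f v = 0}"
  interpret vW: vector_space "vscale W" using W by (rule right_comodule.vector_space)
  have "cact W \<zeta> 0 = 0"
  proof -
    have "0 \<in> space W" using right_comodule.subspace[OF W] by (rule vW.subspace_0)
    then have "f 0 = 0" "f (cact V \<zeta> 0) = cact W \<zeta> (f 0)" "cact V \<zeta> 0 = 0"
      using linear_between_0[OF f comodule_vs vW.vector_space_axioms]
        linear_between_0[OF cact_linear[OF \<zeta>] comodule_vs comodule_vs] int[OF \<zeta>, of 0]
        vV.subspace_0[OF comodule_subspace] by auto
    then show ?thesis by metis
  qed
  then show "cact V \<zeta> v \<in> {v \<in> space V. f v = 0}"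
    using int[OF \<zeta>] v cact_in by auto
qed auto

lemma image_subcomodule:
  fixes W :: "('k, 'h, 'w::ab_group_add) comodule"
  assumes W: "right_comodule H W"
    and f: "linear_between (vscale W) (space W) (vscale V) (space V) f"
    and int: "\<And>\<zeta> v. form \<zeta> \<Longrightarrow> v \<in> space W \<Longrightarrow> f (cact W \<zeta> v) = cact V \<zeta> (f v)"
    and closed: "\<And>\<zeta> v. v \<in> space W \<Longrightarrow> cact W \<zeta> v \<in> space W"
  shows "subcomodule H V (f ` space W)"
  unfolding subcomodule_iff
proof (intro conjI allI impI ballI)
  interpret vW: vector_space "vscale W" using W by (rule right_comodule.vector_space)
  note sW = right_comodule.subspace[OF W]
  show "vV.subspace (f ` space W)"
  proof (rule vV.subspaceI)
    show "0 \<in> f ` space W"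
      using linear_between_0[OF f vW.vector_space_axioms comodule_vs] vW.subspace_0[OF sW]
      by (metis image_eqI)
    show "x + y \<in> f ` space W" if "x \<in> f ` space W" "y \<in> f ` space W" for x y
      using that by (auto simp: linear_betweenD(2)[OF f, symmetric] vW.subspace_add[OF sW])
    show "vscale V c x \<in> f ` space W" if "x \<in> f ` space W" for c x
      using that by (auto simp: linear_betweenD(3)[OF f, symmetric] vW.subspace_scale[OF sW])
  qed
  show "f ` space W \<subseteq> space V" using linear_betweenD(1)[OF f] by blast
  show "cact V \<zeta> w \<in> f ` space W" if "form \<zeta>" "w \<in> f ` space W" for \<zeta> w
    using that int[OF that(1)] closed by (metis (no_types, lifting) image_iff)
qed

end

end

section \<open>The regular comodule and transport of comodule structures\<close>

definition regular :: "('k::field, 'h::ring_1) hopf \<Rightarrow> ('k, 'h, 'h) comodule" where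
  "regular H = \<lparr>space = UNIV, vscale = hscale H, coact = comult H\<rparr>"

lemma regular_simps [simp]:
  "space (regular H) = UNIV" "vscale (regular H) = hscale H" "coact (regular H) = comult H"
  by (simp_all add: regular_def)

context hopf_algebra
begin

interpretation vH: vector_space "hscale H" by (rule vector_space)

lemma regular_comodule: "right_comodule H (regular H)"
  by (rule right_comodule.intro)
    (simp_all add: vector_space comult_add comult_scale coassoc counit_right)

lemma form_cact_regular:
  assumes "form \<eta>"
  shows "\<eta> (cact (regular H) \<zeta> x) = cv \<eta> \<zeta> x"
  unfolding cact_def slice_def cv_def sw_def
  using linear_betweenD(3)[OF assms]
  by (simp add: form_linear_ext[OF assms] case_prod_unfold mult.commute)

text \<open>Taking coefficients against a fixed \<open>\<phi>\<close> is a comodule map into the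
  regular comodule, since any form \<open>\<eta>\<close> gives \<open>\<phi>\<close> of the action
  of \<open>cv \<eta> \<zeta>\<close> on both sides.\<close>

lemma cact_regular_coef:
  assumes "right_comodule H V" "lin_on (vscale V) (space V) \<phi>" "form \<zeta>" "v \<in> space V"
  shows "cact (regular H) \<zeta> (coef H V \<phi> v) = coef H V \<phi> (cact V \<zeta> v)"
  by (rule form_eqI)
    (simp add: form_cact_regular form_coef form_cv cact_cact cact_in assms)

text \<open>Complete reducibility speaks about one carrier type only, so subcomodules of
  \<open>H\<close> have to be copied along linear injections. With the identity as injection, the
  same construction turns a subcomodule into a comodule of its own.\<close>

lemma transport_subcomodule:
  fixes V :: "('k, 'h, 'v::ab_group_add) comodule" and s' :: "'k \<Rightarrow> 'w::ab_group_add \<Rightarrow> 'w"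
  assumes C: "right_comodule H V" and W: "subcomodule H V W" and s': "vector_space s'"
    and \<tau>: "linear_between (vscale V) W s' UNIV \<tau>" and inj: "inj_on \<tau> W"
  obtains T :: "('k, 'h, 'w) comodule" where "right_comodule H T" "vscale T = s'" "space T = \<tau> ` W"
    "\<And>\<zeta> w. form \<zeta> \<Longrightarrow> w \<in> W \<Longrightarrow> cact T \<zeta> (\<tau> w) = \<tau> (cact V \<zeta> w)"
proof -
  interpret vV: vector_space "vscale V" using C by (rule comodule_vs)
  interpret vW: vector_space s' by fact
  have sW: "vV.subspace W" and WV: "W \<subseteq> space V" using W by (auto simp: subcomodule_def)
  have act: "cact V \<zeta> w \<in> W" if "form \<zeta>" "w \<in> W" for \<zeta> w
    using W that unfolding subcomodule_iff[OF C] by blast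
  \<comment> \<open>\<open>coact V w\<close> may have legs outside \<open>W\<close>, where
    \<open>\<tau>\<close> is not controlled; a congruent representative with legs in
    \<open>W\<close> is chosen before pushing forward.\<close>
  have "\<exists>t. \<forall>w\<in>W. Poly_Mapping.keys (t w) \<subseteq> W \<times> UNIV \<and> VH_eq H V (coact V w) (t w)"
    using W unfolding subcomodule_def by (intro bchoice) blast
  then obtain t where t: "\<And>w. w \<in> W \<Longrightarrow> Poly_Mapping.keys (t w) \<subseteq> W \<times> UNIV"
      "\<And>w. w \<in> W \<Longrightarrow> VH_eq H V (coact V w) (t w)" by blast
  define T :: "('k, 'h, 'w) comodule" where
    "T = \<lparr>space = \<tau> ` W, vscale = s',
          coact = (\<lambda>v. linear_ext fs_scale (\<lambda>(w, a). basis_elt (\<tau> w, a)) (t (inv_into W \<tau> v)))\<rparr>"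
  have T: "vscale T = s'" "space T = \<tau> ` W" by (simp_all add: T_def)
  have coact: "coact T (\<tau> w) = linear_ext fs_scale (\<lambda>(w, a). basis_elt (\<tau> w, a)) (t w)"
    if "w \<in> W" for w
    using that inj by (simp add: T_def)
  have cact: "cact T \<zeta> (\<tau> w) = \<tau> (cact V \<zeta> w)" if \<zeta>: "form \<zeta>" and w: "w \<in> W" for \<zeta> w
  proof -
    have "\<tau> (cact V \<zeta> w) = \<tau> (slice V \<zeta> (t w))"
      unfolding cact_def using slice_cong_tensor[OF vV.vector_space_axioms t(2)[OF w] \<zeta>] by simp
    also have "\<dots> = linear_ext s' (\<lambda>p. \<tau> (case p of (u, a) \<Rightarrow> vscale V (\<zeta> a) u)) (t w)"
      unfolding slice_def using t(1)[OF w] vV.subspace_scale[OF sW]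
      by (intro linear_between_linear_ext[OF \<tau> vV.vector_space_axioms s' sW]) auto
    also have "\<dots> = linear_ext s' (\<lambda>(u, a). s' (\<zeta> a) (\<tau> u)) (t w)"
      using t(1)[OF w] linear_betweenD(3)[OF \<tau>] by (intro linear_ext_cong) auto
    also have "\<dots> = cact T \<zeta> (\<tau> w)"
      unfolding cact_def coact[OF w] slice_def T(1)
      by (simp add: linear_ext_linear_ext[OF s'] s' case_prod_unfold)
    finally show ?thesis ..
  qed
  have "right_comodule H T"
  proof (rule right_comoduleI)
    show "vector_space (vscale T)" using s' T by simp
    show "module.subspace (vscale T) (space T)" unfolding T
    proof (rule vW.subspaceI)
      have "\<tau> 0 = 0" using linear_between_0[OF \<tau> vV.vector_space_axioms s'] vV.subspace_0[OF sW] by simp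
      then show "0 \<in> \<tau> ` W" using vV.subspace_0[OF sW] by (metis image_eqI)
    qed (auto simp: linear_betweenD(2,3)[OF \<tau>, symmetric] vV.subspace_add[OF sW] vV.subspace_scale[OF sW])
    show "Poly_Mapping.keys (coact T v) \<subseteq> space T \<times> UNIV" if v: "v \<in> space T" for v
    proof -
      obtain w where w: "w \<in> W" "v = \<tau> w" using v T by auto
      show ?thesis unfolding w(2) coact[OF w(1)] T
        using t(1)[OF w(1)] by (intro keys_linear_ext) auto
    qed
    show "linear_between (vscale T) (space T) (vscale T) (space T) (cact T \<zeta>)" if \<zeta>: "form \<zeta>" for \<zeta>
    proof (rule linear_betweenI)
      show "cact T \<zeta> v \<in> space T" if "v \<in> space T" for v
        using that act[OF \<zeta>] by (auto simp: T cact[OF \<zeta>])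
      fix v c assume "v \<in> space T"
      then obtain w where w: "w \<in> W" "v = \<tau> w" using T by auto
      have "vscale T c v = \<tau> (vscale V c w)" using linear_betweenD(3)[OF \<tau>] w T by simp
      then have "cact T \<zeta> (vscale T c v) = \<tau> (cact V \<zeta> (vscale V c w))"
        by (simp only: cact[OF \<zeta> vV.subspace_scale[OF sW w(1)]])
      also have "\<dots> = vscale T c (cact T \<zeta> v)"
        using w WV linear_betweenD(3)[OF cact_linear[OF C \<zeta>]] linear_betweenD(3)[OF \<tau> act[OF \<zeta> w(1)]]
        by (simp add: T cact[OF \<zeta>] subset_iff)
      finally show "cact T \<zeta> (vscale T c v) = vscale T c (cact T \<zeta> v)" .
    next
      fix v v' assume "v \<in> space T" "v' \<in> space T"
      then obtain w w' where w: "w \<in> W" "v = \<tau> w" "w' \<in> W" "v' = \<tau> w'" using T by auto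
      have "v + v' = \<tau> (w + w')" using linear_betweenD(2)[OF \<tau>] w T by simp
      then have "cact T \<zeta> (v + v') = \<tau> (cact V \<zeta> (w + w'))"
        by (simp only: cact[OF \<zeta> vV.subspace_add[OF sW w(1,3)]])
      also have "\<dots> = cact T \<zeta> v + cact T \<zeta> v'"
        using w WV linear_betweenD(2)[OF cact_linear[OF C \<zeta>]]
          linear_betweenD(2)[OF \<tau> act[OF \<zeta> w(1)] act[OF \<zeta> w(3)]]
        by (simp add: cact[OF \<zeta>] subset_iff)
      finally show "cact T \<zeta> (v + v') = cact T \<zeta> v + cact T \<zeta> v'" .
    qed
    show "cact T \<eta> (cact T \<zeta> v) = cact T (cv \<eta> \<zeta>) v"
      if "form \<eta>" "form \<zeta>" "v \<in> space T" for \<eta> \<zeta> v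
      using that T WV act by (auto simp: cact form_cv cact_cact[OF C])
    show "cact T \<epsilon> v = v" if "v \<in> space T" for v
      using that T WV cact[OF form_counit] cact_counit[OF C] by auto
  qed
  then show ?thesis using that[of T] T cact by blast
qed

text \<open>Both tensors in the definition have legs in \<open>space W\<close>, so contractions
  decide their equality, and contracting the pushforward of \<open>coact V v\<close> along
  \<open>f\<close> gives \<open>f (cact V \<zeta> v)\<close>.\<close>

lemma comodule_isomorphic_iff:
  assumes V: "right_comodule H V" and W: "right_comodule H W"
  shows "comodule_isomorphic H V W \<longleftrightarrow>
     (\<exists>f. linear_between (vscale V) (space V) (vscale W) (space W) f \<and>
          bij_betw f (space V) (space W) \<and>
          (\<forall>\<zeta> v. form \<zeta> \<longrightarrow> v \<in> space V \<longrightarrow> f (cact V \<zeta> v) = cact W \<zeta> (f v)))"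
proof -
  have "(\<forall>v\<in>space V. VH_eq H W
             (linear_ext fs_scale (\<lambda>(u, a). basis_elt (f u, a)) (coact V v)) (coact W (f v))) \<longleftrightarrow>
      (\<forall>\<zeta> v. form \<zeta> \<longrightarrow> v \<in> space V \<longrightarrow> f (cact V \<zeta> v) = cact W \<zeta> (f v))"
    if f: "linear_between (vscale V) (space V) (vscale W) (space W) f" for f
  proof -
    interpret vV: vector_space "vscale V" using V by (rule comodule_vs)
    interpret vW: vector_space "vscale W" using W by (rule comodule_vs)
    define t where "t v = linear_ext fs_scale (\<lambda>(u, a). basis_elt (f u, a :: 'h) :: _ \<Rightarrow>\<^sub>0 'k) (coact V v)" for v
    have t: "slice W \<zeta> (t v) = f (cact V \<zeta> v)" if v: "v \<in> space V" for v \<zeta>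
    proof -
      have "f (cact V \<zeta> v) = linear_ext (vscale W) (\<lambda>p. f (case p of (u, a) \<Rightarrow> vscale V (\<zeta> a) u)) (coact V v)"
        unfolding cact_def slice_def
        using right_comodule.coact_closed[OF V v] vV.subspace_scale[OF comodule_subspace[OF V]]
        by (intro linear_between_linear_ext[OF f comodule_vs[OF V] comodule_vs[OF W] comodule_subspace[OF V]]) auto
      also have "\<dots> = linear_ext (vscale W) (\<lambda>(u, a). vscale W (\<zeta> a) (f u)) (coact V v)"
        using right_comodule.coact_closed[OF V v] linear_betweenD(3)[OF f]
        by (intro linear_ext_cong) auto
      finally show ?thesis
        unfolding t_def slice_def
        by (simp add: linear_ext_linear_ext[OF comodule_vs[OF W]] comodule_vs[OF W] case_prod_unfold)
    qed
    have "VH_eq H W (t v) (coact W (f v)) \<longleftrightarrow> (\<forall>\<zeta>. form \<zeta> \<longrightarrow> f (cact V \<zeta> v) = cact W \<zeta> (f v))"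
      if v: "v \<in> space V" for v
    proof
      assume "VH_eq H W (t v) (coact W (f v))"
      from slice_cong_tensor[OF comodule_vs[OF W] this]
      show "\<forall>\<zeta>. form \<zeta> \<longrightarrow> f (cact V \<zeta> v) = cact W \<zeta> (f v)"
        using t[OF v] by (simp add: cact_def)
    next
      assume 1: "\<forall>\<zeta>. form \<zeta> \<longrightarrow> f (cact V \<zeta> v) = cact W \<zeta> (f v)"
      show "VH_eq H W (t v) (coact W (f v))"
      proof (rule VH_eqI[OF comodule_vs[OF W] comodule_subspace[OF W]])
        show "Poly_Mapping.keys (t v) \<subseteq> space W \<times> UNIV"
          unfolding t_def using right_comodule.coact_closed[OF V v] linear_betweenD(1)[OF f]
          by (intro keys_linear_ext) auto
        show "Poly_Mapping.keys (coact W (f v)) \<subseteq> space W \<times> UNIV"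
          by (rule right_comodule.coact_closed[OF W linear_betweenD(1)[OF f v]])
        show "slice W \<zeta> (t v) = slice W \<zeta> (coact W (f v))" if "form \<zeta>" for \<zeta>
          using 1 that t[OF v] by (simp add: cact_def)
      qed
    qed
    then show ?thesis unfolding t_def by blast
  qed
  then show ?thesis unfolding comodule_isomorphic_def by blast
qed

subsection \<open>Simple comodules\<close>

lemma simple_comoduleD:
  assumes "simple_comodule H V"
  shows "right_comodule H V" "space V \<noteq> {0}"
    "subcomodule H V U \<Longrightarrow> U = {0} \<or> U = space V"
  using assms unfolding simple_comodule_def simple_subcomodule_def
  by (auto simp: subcomodule_def)

text \<open>Any nonzero vector generates a simple comodule, and what one vector generates is
  finite-dimensional. Eigenvectors and the passage from injective to surjective depend on
  this.\<close>

lemma simple_finite_span: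
  assumes "simple_comodule H V"
  shows "\<exists>B. finite B \<and> module.span (vscale V) B = space V"
proof -
  note V = simple_comoduleD[OF assms]
  interpret vV: vector_space "vscale V" using V(1) by (rule comodule_vs)
  obtain v where v: "v \<in> space V" "v \<noteq> 0"
    using V(2) vV.subspace_0[OF comodule_subspace[OF V(1)]] by blast
  note U = orbit_subcomodule[OF V(1) v(1)]
  have "{cact V \<zeta> v |\<zeta>. form \<zeta>} = space V"
    using V(3)[OF U(1)] U(2) v(2) by blast
  then show ?thesis using U(3) by simp
qed

lemma schur_bij:
  assumes V: "simple_comodule H V" and W: "simple_comodule H W"
    and f: "linear_between (vscale V) (space V) (vscale W) (space W) f"
    and int: "\<And>\<zeta> v. form \<zeta> \<Longrightarrow> v \<in> space V \<Longrightarrow> f (cact V \<zeta> v) = cact W \<zeta> (f v)"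
    and nz: "v \<in> space V" "f v \<noteq> 0"
  shows "bij_betw f (space V) (space W)"
proof -
  note V = simple_comoduleD[OF V] and W = simple_comoduleD[OF W]
  interpret vV: vector_space "vscale V" using V(1) by (rule comodule_vs)
  have "{v \<in> space V. f v = 0} = {0} \<or> {v \<in> space V. f v = 0} = space V"
    by (intro V(3) kernel_subcomodule[OF V(1) W(1) f int])
  then have ker: "{v \<in> space V. f v = 0} = {0}" using nz by blast
  have "f ` space V = {0} \<or> f ` space V = space W"
    by (intro W(3) image_subcomodule[OF W(1) V(1) f int cact_in[OF V(1)]])
  then have "f ` space V = space W" using nz by blast
  moreover have "inj_on f (space V)"
  proof (rule inj_onI)
    fix x y assume xy: "x \<in> space V" "y \<in> space V" "f x = f y"
    then have "f (x - y) = 0"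
      using linear_between_diff[OF f comodule_vs[OF V(1)] comodule_vs[OF W(1)] comodule_subspace[OF V(1)]]
      by simp
    then have "x - y \<in> {v \<in> space V. f v = 0}"
      using xy vV.subspace_diff[OF comodule_subspace[OF V(1)]] by simp
    then show "x = y" unfolding ker by simp
  qed
  ultimately show ?thesis by (simp add: bij_betw_def)
qed

lemma schur_iso:
  assumes V: "simple_comodule H V" and W: "simple_comodule H W"
    and f: "linear_between (vscale V) (space V) (vscale W) (space W) f"
    and int: "\<And>\<zeta> v. form \<zeta> \<Longrightarrow> v \<in> space V \<Longrightarrow> f (cact V \<zeta> v) = cact W \<zeta> (f v)"
    and "\<not> comodule_isomorphic H V W" "v \<in> space V"
  shows "f v = 0"
proof (rule ccontr)
  assume "f v \<noteq> 0"
  from schur_bij[OF V W f int assms(6) this]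
  have "comodule_isomorphic H V W"
    unfolding comodule_isomorphic_iff[OF simple_comoduleD(1)[OF V] simple_comoduleD(1)[OF W]]
    using f int by (intro exI[of _ f]) simp
  then show False using assms(5) by simp
qed

text \<open>On \<open>W\<close> the coaction of \<open>V\<close> may return representatives with
  legs outside \<open>W\<close>; transport along the identity replaces them by others inside without
  changing the action.\<close>

lemma simple_subcomodule_restrict:
  assumes C: "right_comodule H V" and W: "simple_subcomodule H V W"
  obtains T where "simple_comodule H T" "vscale T = vscale V" "space T = W"
    "\<And>\<zeta> w. form \<zeta> \<Longrightarrow> w \<in> W \<Longrightarrow> cact T \<zeta> w = cact V \<zeta> w"
proof -
  have sub: "subcomodule H V W" using W by (simp add: simple_subcomodule_def)
  then have WV: "W \<subseteq> space V" by (simp add: subcomodule_def)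
  show ?thesis
  proof (rule transport_subcomodule[OF C sub comodule_vs[OF C], of "\<lambda>x. x"])
    fix T assume T: "right_comodule H T" "vscale T = vscale V" "space T = (\<lambda>x. x) ` W"
      "\<And>\<zeta> w. form \<zeta> \<Longrightarrow> w \<in> W \<Longrightarrow> cact T \<zeta> w = cact V \<zeta> w"
    have iff: "subcomodule H T U \<longleftrightarrow> subcomodule H V U" if "U \<subseteq> W" for U
    proof -
      have "(\<forall>\<zeta>. form \<zeta> \<longrightarrow> (\<forall>w\<in>U. cact T \<zeta> w \<in> U)) \<longleftrightarrow>
          (\<forall>\<zeta>. form \<zeta> \<longrightarrow> (\<forall>w\<in>U. cact V \<zeta> w \<in> U))"
        using that T(4) by (intro all_cong ball_cong refl) (simp add: subset_iff)
      then show ?thesis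
        unfolding subcomodule_iff[OF C] subcomodule_iff[OF T(1)] T(2,3) image_ident
        using that WV by auto
    qed
    have "simple_subcomodule H T (space T)"
      using W iff unfolding simple_subcomodule_def T(3) image_ident by blast
    then show thesis
      using that[of T] T unfolding simple_comodule_def image_ident by blast
  qed (auto simp: linear_between_def)
qed

section \<open>Matrix coefficients and complete reducibility\<close>

definition coefs :: "('k, 'h, 'v::ab_group_add) comodule \<Rightarrow> 'h set" where
  "coefs V = {coef H V \<phi> v | \<phi> v. lin_on (vscale V) (space V) \<phi> \<and> v \<in> space V}"

text \<open>Each \<open>x\<close> is \<open>\<epsilon>(x\<^sub>1) x\<^sub>2\<close>, a coefficient of the finite-dimensional comodule it generates.\<close>

lemma span_coefs:
  fixes V :: "'l \<Rightarrow> ('k, 'h, 'v::ab_group_add) comodule"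
  assumes "cosemisimple H" and rep: "simple_comodule_representatives H \<Lambda> V"
  shows "x \<in> vH.span (\<Union>l\<in>\<Lambda>. coefs (V l))"
proof -
  let ?M = "\<Union>l\<in>\<Lambda>. coefs (V l)"
  define D where "D = {cact (regular H) \<zeta> x | \<zeta>. form \<zeta>}"
  have D: "subcomodule H (regular H) D" "x \<in> D"
    and "\<exists>B. finite B \<and> vH.span B = D"
    using orbit_subcomodule[OF regular_comodule, of x] unfolding D_def by simp_all
  then obtain B where B: "finite B" "vH.span B = D" by blast
  have sD: "vH.subspace D" using B(2) by auto
  obtain E e where E: "finite E" "\<And>b. form (e b)"
      and co: "\<And>v. v \<in> D \<Longrightarrow> v = (\<Sum>b\<in>E. hscale H (e b v) b)"
    by (rule vH.finite_span_basis[OF B], rule that) assumption+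
  obtain h :: "'h \<Rightarrow> nat" where h: "inj_on h E"
    using finite_imp_inj_to_nat_seg[OF E(1)] by blast
  \<comment> \<open>The coordinate along \<open>b\<close> is stored at position \<open>h b\<close>,
    which copies \<open>D\<close> into the carrier type for which \<open>cosemisimple\<close> is
    stated.\<close>
  define \<tau> :: "'h \<Rightarrow> nat \<Rightarrow>\<^sub>0 'k" where "\<tau> y = (\<Sum>b\<in>E. Poly_Mapping.single (h b) (e b y))" for y
  have \<tau>lin: "linear_between (hscale H) D fs_scale UNIV \<tau>"
  proof (rule linear_betweenI)
    show "\<tau> (v + w) = \<tau> v + \<tau> w" for v w
      using linear_betweenD(2)[OF E(2)] by (simp add: \<tau>_def single_add sum.distrib)
    show "\<tau> (hscale H c v) = fs_scale c (\<tau> v)" for c v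
      using linear_betweenD(3)[OF E(2)] by (simp add: \<tau>_def fs.scale_sum_right fs_scale_single)
  qed simp
  have lookup: "Poly_Mapping.lookup (\<tau> y) (h b) = e b y" if "b \<in> E" for y b
  proof -
    have "Poly_Mapping.lookup (\<tau> y) (h b) = (\<Sum>b'\<in>E. if b' = b then e b' y else 0)"
      unfolding \<tau>_def lookup_sum
      using h that by (intro sum.cong) (auto simp: lookup_single when_def inj_on_eq_iff)
    then show ?thesis using E(1) that by simp
  qed
  have \<tau>inj: "inj_on \<tau> D"
  proof (rule inj_onI)
    fix y z assume "y \<in> D" "z \<in> D" "\<tau> y = \<tau> z"
    then have "e b y = e b z" if "b \<in> E" for b using lookup[OF that] by metis
    then have "(\<Sum>b\<in>E. hscale H (e b y) b) = (\<Sum>b\<in>E. hscale H (e b z) b)" by simp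
    then show "y = z" using co[OF \<open>y \<in> D\<close>] co[OF \<open>z \<in> D\<close>] by metis
  qed
  obtain T where T: "right_comodule H T" "vscale T = fs_scale" "space T = \<tau> ` D"
    and Tact: "\<And>\<zeta> y. form \<zeta> \<Longrightarrow> y \<in> D \<Longrightarrow> cact T \<zeta> (\<tau> y) = \<tau> (cact (regular H) \<zeta> y)"
    by (rule transport_subcomodule[OF regular_comodule D(1) fs.vector_space_axioms, of \<tau>])
      (use \<tau>lin \<tau>inj in \<open>auto\<close>)
  have "finite_dimensional_comodule T"
    unfolding finite_dimensional_comodule_def T(2)
  proof (rule fs.subspace_finite_span)
    show "fs.subspace (space T)" using comodule_subspace[OF T(1)] T(2) by simp
    show "finite ((\<lambda>b. basis_elt (h b) :: nat \<Rightarrow>\<^sub>0 'k) ` E)" using E(1) by simp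
    have "\<tau> y = (\<Sum>b\<in>E. fs_scale (e b y) (basis_elt (h b)))" for y
      by (simp add: \<tau>_def fs_scale_single)
    moreover have "(\<Sum>b\<in>E. fs_scale (e b y) (basis_elt (h b))) \<in> fs.span ((\<lambda>b. basis_elt (h b)) ` E)" for y
      by (intro fs.span_sum fs.span_scale) (rule fs.span_base, blast)
    ultimately show "space T \<subseteq> fs.span ((\<lambda>b. basis_elt (h b)) ` E)"
      unfolding T(3) by (simp add: image_subset_iff)
  qed
  then have ds: "direct_sum_of_simples H T"
    using assms(1) T(1) unfolding cosemisimple_def by blast
  define P where "P \<W> \<longleftrightarrow> finite \<W> \<and> (\<forall>W\<in>\<W>. simple_subcomodule H T W) \<and>
      (\<forall>v\<in>space T. \<exists>!w. w \<in> (\<Pi>\<^sub>E W\<in>\<W>. W) \<and> v = (\<Sum>W\<in>\<W>. w W))" for \<W>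
  obtain \<W> where P: "P \<W>"
    using ds unfolding direct_sum_of_simples_def P_def[symmetric] by blast
  note ds = P[unfolded P_def, THEN conjunct2, THEN conjunct2]
  from P[unfolded P_def, THEN conjunct2, THEN conjunct1]
  have \<W>: "W \<in> \<W> \<Longrightarrow> simple_subcomodule H T W" for W by simp
  have "\<tau> x \<in> space T" using D(2) T(3) by simp
  with ds obtain w where w: "w \<in> (\<Pi>\<^sub>E W\<in>\<W>. W)" "\<tau> x = (\<Sum>W\<in>\<W>. w W)" by blast
  define \<sigma> where "\<sigma> = inv_into D \<tau>"
  have bij: "bij_betw \<tau> D (space T)" using \<tau>inj T(3) by (simp add: bij_betw_def)
  have \<sigma>lin: "linear_between fs_scale (space T) (hscale H) D \<sigma>"
    unfolding \<sigma>_def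
  proof (rule linear_between_inv_into[OF _ bij vector_space sD])
    show "linear_between (hscale H) D fs_scale (space T) \<tau>"
      using \<tau>lin T(3) by (auto simp: linear_between_def)
  qed
  have \<sigma>\<tau>: "\<sigma> (\<tau> y) = y" if "y \<in> D" for y using that \<tau>inj by (simp add: \<sigma>_def)
  have main: "\<sigma> z \<in> ?M" if W: "W \<in> \<W>" and z: "z \<in> W" for W z
  proof -
    obtain T' where T': "simple_comodule H T'" "vscale T' = vscale T" "space T' = W"
      and T'act: "\<And>\<zeta> w. form \<zeta> \<Longrightarrow> w \<in> W \<Longrightarrow> cact T' \<zeta> w = cact T \<zeta> w"
      by (rule simple_subcomodule_restrict[OF T(1) \<W>[OF W]], rule that) assumption+
    have WT: "W \<subseteq> space T" using \<W>[OF W] by (simp add: simple_subcomodule_def subcomodule_def)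
    obtain l where l: "l \<in> \<Lambda>" "comodule_isomorphic H T' (V l)"
      using rep T'(1) unfolding simple_comodule_representatives_def by blast
    have Vl: "simple_comodule H (V l)"
      using rep l(1) unfolding simple_comodule_representatives_def by blast
    note CT = simple_comoduleD(1)[OF T'(1)] and CV = simple_comoduleD(1)[OF Vl]
    obtain f where f: "linear_between (vscale T) W (vscale (V l)) (space (V l)) f"
      "bij_betw f W (space (V l))"
      and fact: "\<And>\<zeta> v. form \<zeta> \<Longrightarrow> v \<in> W \<Longrightarrow> f (cact T' \<zeta> v) = cact (V l) \<zeta> (f v)"
      using l(2) unfolding comodule_isomorphic_iff[OF CT CV] T'(2,3) by blast
    have sW: "module.subspace fs_scale W" using comodule_subspace[OF CT] T'(2,3) T(2) by simp
    have flin: "linear_between fs_scale W (vscale (V l)) (space (V l)) f" using f(1) T(2) by simp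
    define g where "g = inv_into W f"
    have g: "linear_between (vscale (V l)) (space (V l)) fs_scale W g"
      unfolding g_def by (rule linear_between_inv_into[OF flin f(2) fs.vector_space_axioms sW])
    have gf: "g (f y) = y" if "y \<in> W" for y using f(2) that by (simp add: g_def bij_betw_def)
    \<comment> \<open>The counit on the summand, read on \<open>V l\<close> through the inverse
      isomorphism \<open>g\<close> and the inverse \<open>\<sigma>\<close> of the copying
      map.\<close>
    define \<phi> where "\<phi> u = \<epsilon> (\<sigma> (g u))" for u
    have \<phi>: "lin_on (vscale (V l)) (space (V l)) \<phi>"
      unfolding \<phi>_def
      using linear_between_compose[OF linear_between_mono[OF g order_refl WT]
          linear_between_compose[OF linear_between_mono[OF \<sigma>lin order_refl subset_UNIV] form_counit]] .
    have fz: "f z \<in> space (V l)" using linear_betweenD(1)[OF flin z] .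
    obtain y where y: "y \<in> D" "z = \<tau> y" using z WT T(3) by blast
    \<comment> \<open>Against \<open>\<zeta>\<close> the coefficient gives the counit of
      \<open>\<zeta>\<close> acting on the original element, which by the counit axiom is
      \<open>\<zeta>\<close> of that element.\<close>
    have "coef H (V l) \<phi> (f z) = \<sigma> z"
    proof (rule form_eqI)
      fix \<zeta> assume \<zeta>: "form \<zeta>"
      have Wact: "cact T' \<zeta> z \<in> W" using cact_in[OF CT, of z] z T'(3) by simp
      have "cact (regular H) \<zeta> y \<in> D"
        using D(1) \<zeta> y(1) unfolding subcomodule_iff[OF regular_comodule] by blast
      then have "\<sigma> (cact T \<zeta> z) = cact (regular H) \<zeta> y"
        unfolding y(2) Tact[OF \<zeta> y(1)] by (rule \<sigma>\<tau>)
      then have "\<zeta> (coef H (V l) \<phi> (f z)) = \<epsilon> (cact (regular H) \<zeta> y)"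
        unfolding form_coef[OF CV \<phi> \<zeta> fz] fact[OF \<zeta> z, symmetric] \<phi>_def gf[OF Wact]
        unfolding T'act[OF \<zeta> z] by simp
      also have "\<dots> = \<zeta> (\<sigma> z)"
        unfolding form_cact_regular[OF form_counit] cv_counit_left[OF \<zeta>] y(2) \<sigma>\<tau>[OF y(1)] ..
      finally show "\<zeta> (coef H (V l) \<phi> (f z)) = \<zeta> (\<sigma> z)" .
    qed
    then have "\<sigma> z \<in> coefs (V l)" unfolding coefs_def using \<phi> fz by (metis (mono_tags, lifting) mem_Collect_eq)
    then show ?thesis using l(1) by blast
  qed
  have wW: "w W \<in> W" "w W \<in> space T" if "W \<in> \<W>" for W
    using w(1) that \<W>[OF that] by (auto simp: simple_subcomodule_def subcomodule_def)
  have sT: "fs.subspace (space T)" using comodule_subspace[OF T(1)] T(2) by simp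
  have "x = \<sigma> (\<tau> x)" using \<sigma>\<tau>[OF D(2)] by simp
  also have "\<dots> = (\<Sum>W\<in>\<W>. \<sigma> (w W))"
    unfolding w(2) by (rule linear_between_sum[OF \<sigma>lin fs.vector_space_axioms vector_space sT wW(2)])
  also have "\<dots> \<in> vH.span ?M"
    using main wW(1) by (intro vH.span_sum vH.span_base) blast
  finally show ?thesis .
qed

end

section \<open>Separation by functionals and Schur's lemma with scalars\<close>

context hopf_algebra
begin

interpretation vH: vector_space "hscale H" by (rule vector_space)

lemma form_eq_on_span:
  assumes "form f" "form g" "\<And>y. y \<in> M \<Longrightarrow> f y = g y" "x \<in> vH.span M"
  shows "f x = g x"
proof -
  have "vH.subspace {x. f x = g x}"
    using linear_betweenD(2,3)[OF assms(1)] linear_betweenD(2,3)[OF assms(2)]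
      linear_between_0[OF assms(1) vector_space vector_space_field]
      linear_between_0[OF assms(2) vector_space vector_space_field]
    by (intro vH.subspaceI) auto
  then show ?thesis using vH.span_minimal[of M "{x. f x = g x}"] assms(3,4) by blast
qed

lemma comodule_functional_sep:
  assumes "right_comodule H V"
    and "\<And>\<phi>. lin_on (vscale V) (space V) \<phi> \<Longrightarrow> \<phi> x = \<phi> y"
  shows "x = y"
proof -
  interpret vV: vector_space "vscale V" by (rule comodule_vs[OF assms(1)])
  show ?thesis
    by (rule vV.functional_sep) (rule assms(2), erule linear_between_mono, auto)
qed

end

text \<open>Simple comodules are finite-dimensional, so algebraic closedness supplies an eigenvalue
  \<open>c\<close> of \<open>f\<close>. The kernel of \<open>f\<close> minus \<open>c\<close> is
  then a nonzero subcomodule, hence everything.\<close>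

lemma schur_scalar:
  fixes H :: "('k::alg_closed_field, 'h::ring_1) hopf" and V :: "('k, 'h, 'v::ab_group_add) comodule"
  assumes H: "hopf_algebra H" and V: "simple_comodule H V"
    and f: "linear_between (vscale V) (space V) (vscale V) (space V) f"
    and int: "\<And>\<zeta> v. lin_on (hscale H) UNIV \<zeta> \<Longrightarrow> v \<in> space V \<Longrightarrow> f (cact V \<zeta> v) = cact V \<zeta> (f v)"
  obtains c where "\<And>v. v \<in> space V \<Longrightarrow> f v = vscale V c v"
proof -
  interpret hopf_algebra H by fact
  note fin = simple_finite_span[OF V] and V = simple_comoduleD[OF V]
  note C = V(1)
  interpret vV: vector_space "vscale V" using C by (rule comodule_vs)
  note sV = comodule_subspace[OF C]
  obtain B where B: "finite B" "vV.span B = space V" using fin by blast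
  obtain c w where w: "w \<in> space V" "w \<noteq> 0" "f w = vscale V c w"
    using exists_eigenvector[OF vV.vector_space_axioms B f V(2)] by blast
  define g where "g v = f v - vscale V c v" for v
  have g: "linear_between (vscale V) (space V) (vscale V) (space V) g"
    unfolding g_def
    using linear_betweenD[OF f] vV.subspace_diff[OF sV] vV.subspace_scale[OF sV]
    by (intro linear_betweenI) (simp_all add: vV.scale_right_distrib vV.scale_right_diff_distrib mult.commute)
  have "g (cact V \<zeta> v) = cact V \<zeta> (g v)" if \<zeta>: "form \<zeta>" and v: "v \<in> space V" for \<zeta> v
    unfolding g_def
    using int[OF \<zeta> v] linear_betweenD(1)[OF f v] vV.subspace_scale[OF sV v]
      linear_betweenD(3)[OF cact_linear[OF C \<zeta>] v]
      linear_between_diff[OF cact_linear[OF C \<zeta>] vV.vector_space_axioms vV.vector_space_axioms sV]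
    by simp
  then have "{v \<in> space V. g v = 0} = {0} \<or> {v \<in> space V. g v = 0} = space V"
    by (intro V(3) kernel_subcomodule[OF C C g])
  moreover have "w \<in> {v \<in> space V. g v = 0}" using w by (simp add: g_def)
  ultimately have "{v \<in> space V. g v = 0} = space V" using w(2) by blast
  then have "f v = vscale V c v" if "v \<in> space V" for v using that by (auto simp: g_def)
  then show ?thesis by (rule that)
qed

section \<open>Two-sided invariance of the integral\<close>

locale cosemisimple_hopf_algebra = hopf_algebra H
  for H :: "('k::alg_closed_field, 'h::ring_1) hopf" +
  fixes I :: "'h \<Rightarrow> 'k" and \<Lambda> :: "'l set"
    and V :: "'l \<Rightarrow> ('k, 'h, 'v::ab_group_add) comodule"
  assumes cosemisimple: "cosemisimple H"
    and left_integral: "left_integral H I"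
    and representatives: "simple_comodule_representatives H \<Lambda> V"
begin

interpretation vH: vector_space "hscale H" by (rule vector_space)

lemma simple: "l \<in> \<Lambda> \<Longrightarrow> simple_comodule H (V l)"
  and non_iso: "l \<in> \<Lambda> \<Longrightarrow> m \<in> \<Lambda> \<Longrightarrow> l \<noteq> m \<Longrightarrow> \<not> comodule_isomorphic H (V l) (V m)"
  using representatives unfolding simple_comodule_representatives_def by blast+

lemma comod: "l \<in> \<Lambda> \<Longrightarrow> right_comodule H (V l)"
  using simple_comoduleD(1)[OF simple] .

lemma in_span_coefs: "x \<in> vH.span (\<Union>l\<in>\<Lambda>. coefs (V l))"
  by (rule span_coefs[OF cosemisimple representatives])

text \<open>As coefficients span \<open>H\<close>, an identity between functionals reduces to an
  identity between their actions on each \<open>V l\<close>.\<close>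

lemma form_eqI_coefs:
  assumes "form f" "form g"
    and "\<And>l \<phi> v. l \<in> \<Lambda> \<Longrightarrow> lin_on (vscale (V l)) (space (V l)) \<phi> \<Longrightarrow> v \<in> space (V l) \<Longrightarrow>
      f (coef H (V l) \<phi> v) = g (coef H (V l) \<phi> v)"
  shows "f x = g x"
  by (rule form_eq_on_span[OF assms(1,2) _ in_span_coefs]) (use assms(3) in \<open>auto simp: coefs_def\<close>)

lemma left_inv: "left_inv I"
  by (rule left_integral_inv[OF left_integral])

lemma form_I: "form I"
  using left_inv by (simp add: left_inv_def)

text \<open>The integral maps a comodule to its invariant vectors, and these form a subcomodule.\<close>

lemma integral_action:
  assumes l: "l \<in> \<Lambda>"
  shows "(\<forall>v\<in>space (V l). cact (V l) I v = 0) \<or>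
     (\<forall>\<zeta> w. form \<zeta> \<longrightarrow> w \<in> space (V l) \<longrightarrow> cact (V l) \<zeta> w = vscale (V l) (\<zeta> 1) w)"
proof (subst disj_imp, intro impI)
  note C = comod[OF l]
  interpret vV: vector_space "vscale (V l)" by (rule comodule_vs[OF C])
  assume "\<not> (\<forall>v\<in>space (V l). cact (V l) I v = 0)"
  then obtain v where v: "v \<in> space (V l)" "cact (V l) I v \<noteq> 0" by blast
  define u where "u = cact (V l) I v"
  have u: "u \<in> space (V l)" "u \<noteq> 0" using v cact_in[OF C] by (auto simp: u_def)
  have inv: "cact (V l) \<zeta> u = vscale (V l) (\<zeta> 1) u" if \<zeta>: "form \<zeta>" for \<zeta>
  proof (rule comodule_functional_sep[OF C])
    fix \<phi> assume \<phi>: "lin_on (vscale (V l)) (space (V l)) \<phi>"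
    have "\<phi> (cact (V l) \<zeta> u) = cv \<zeta> I (coef H (V l) \<phi> v)"
      unfolding u_def
      by (simp add: cact_cact[OF C \<zeta> form_I v(1)] form_coef[OF C \<phi> form_cv[OF \<zeta> form_I] v(1)])
    also have "\<dots> = I (coef H (V l) \<phi> v) * \<zeta> 1"
      using left_inv \<zeta> by (simp add: left_inv_def cv_def)
    also have "\<dots> = \<phi> (vscale (V l) (\<zeta> 1) u)"
      using form_coef[OF C \<phi> form_I v(1)] linear_betweenD(3)[OF \<phi> u(1)]
      by (simp add: u_def mult.commute)
    finally show "\<phi> (cact (V l) \<zeta> u) = \<phi> (vscale (V l) (\<zeta> 1) u)" .
  qed
  \<comment> \<open>One invariant vector is enough: its line is a subcomodule, so by simplicity it
    is all of \<open>V l\<close>, which is thus the trivial comodule.\<close>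
  have "subcomodule H (V l) (vV.span {u})"
    unfolding subcomodule_iff[OF C]
  proof (intro conjI allI impI ballI)
    show "vV.span {u} \<subseteq> space (V l)"
      using u(1) comodule_subspace[OF C] by (intro vV.span_minimal) auto
    fix \<zeta> w assume \<zeta>: "form \<zeta>" and "w \<in> vV.span {u}"
    then obtain c where c: "w = vscale (V l) c u" by (auto simp: vV.span_singleton)
    show "cact (V l) \<zeta> w \<in> vV.span {u}"
      unfolding c linear_betweenD(3)[OF cact_linear[OF C \<zeta>] u(1)] inv[OF \<zeta>]
      by (intro vV.span_scale vV.span_base) simp
  qed simp
  then have "vV.span {u} = {0} \<or> vV.span {u} = space (V l)"
    by (rule simple_comoduleD(3)[OF simple[OF l]])
  then have sp: "space (V l) = vV.span {u}"
    using u(2) vV.span_base[of u "{u}"] by auto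
  show "\<forall>\<zeta> w. form \<zeta> \<longrightarrow> w \<in> space (V l) \<longrightarrow> cact (V l) \<zeta> w = vscale (V l) (\<zeta> 1) w"
  proof (intro allI impI)
    fix \<zeta> w assume \<zeta>: "form \<zeta>" and "w \<in> space (V l)"
    then obtain c where c: "w = vscale (V l) c u" using sp by (auto simp: vV.span_singleton)
    show "cact (V l) \<zeta> w = vscale (V l) (\<zeta> 1) w"
      unfolding c linear_betweenD(3)[OF cact_linear[OF C \<zeta>] u(1)] inv[OF \<zeta>]
      by (simp add: mult.commute)
  qed
qed

text \<open>Tested on one simple comodule: where \<open>I\<close> acts as zero both sides vanish,
  and where the action is trivial the order of \<open>I\<close> and \<open>\<zeta>\<close> does not
  matter.\<close>

lemma right_inv: "right_inv I"
  unfolding right_inv_def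
proof (intro conjI allI impI)
  fix \<zeta> x assume \<zeta>: "form \<zeta>"
  have "cv I \<zeta> x = I x * \<zeta> 1"
  proof (rule form_eqI_coefs[OF form_cv[OF form_I \<zeta>] form_multc[OF form_I]])
    fix l \<phi> v assume l: "l \<in> \<Lambda>" and \<phi>: "lin_on (vscale (V l)) (space (V l)) \<phi>"
      and v: "v \<in> space (V l)"
    note C = comod[OF l]
    interpret vV: vector_space "vscale (V l)" by (rule comodule_vs[OF C])
    have "cact (V l) I (cact (V l) \<zeta> v) = vscale (V l) (\<zeta> 1) (cact (V l) I v)"
      using integral_action[OF l] v cact_in[OF C v] form_I \<zeta>
        linear_betweenD(3)[OF cact_linear[OF C form_I] v] by auto
    then show "cv I \<zeta> (coef H (V l) \<phi> v) = I (coef H (V l) \<phi> v) * \<zeta> 1"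
      by (simp add: form_coef[OF C \<phi> _ v] form_cv form_I \<zeta> cact_cact[OF C form_I \<zeta> v, symmetric]
          linear_betweenD(3)[OF \<phi> cact_in[OF C v]] mult.commute)
  qed
  then show "\<Delta> x (\<lambda>a b. I a * \<zeta> b) = I x * \<zeta> 1" by (simp add: cv_def)
qed (rule form_I)

text \<open>On a trivial comodule \<open>I\<close> acts as the scalar \<open>I 1\<close>. If this
  were 0, then \<open>I\<close> would act as zero on every simple comodule and hence vanish on all
  coefficients, but an integral is nonzero.\<close>

lemma integral_one: "I 1 \<noteq> 0"
proof
  assume 0: "I 1 = 0"
  have "I x = 0" for x
  proof (rule form_eqI_coefs[OF form_I, of "\<lambda>_. 0"])
    show "form (\<lambda>_. 0)" by (simp add: linear_between_def)
    fix l \<phi> v assume l: "l \<in> \<Lambda>" and \<phi>: "lin_on (vscale (V l)) (space (V l)) \<phi>"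
      and v: "v \<in> space (V l)"
    note C = comod[OF l]
    interpret vV: vector_space "vscale (V l)" by (rule comodule_vs[OF C])
    have "cact (V l) I v = 0" using integral_action[OF l] v form_I 0 by auto
    then show "I (coef H (V l) \<phi> v) = 0"
      using form_coef[OF C \<phi> form_I v]
        linear_between_0[OF \<phi> vV.vector_space_axioms vector_space_field vV.subspace_0[OF comodule_subspace[OF C]]]
      by simp
  qed
  then show False using left_integral unfolding left_integral_def by blast
qed

section \<open>The integral pairing and its nondegeneracy\<close>

definition b :: "'h \<Rightarrow> 'h \<Rightarrow> 'k" where "b g x = I (g * S x)"

lemma bil_b: "bil b"
  unfolding b_def by (intro bilI form_compose[OF form_I] endo_intros)

lemma form_b: "form (b g)" "form (\<lambda>g. b g x)"
  using bil_b by (simp_all add: bil_def)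

lemma b_left_shift: "form \<zeta> \<Longrightarrow> cv \<zeta> (\<lambda>g. b g x) g = b g (cact (regular H) \<zeta> x)"
  using left_inv_shift[OF left_inv, of \<zeta> g x] form_cact_regular[OF form_b(1)[of g], of \<zeta> x]
  by (simp add: cv_def b_def)

lemma b_right_shift:
  "form \<zeta> \<Longrightarrow> b (cact (regular H) \<zeta> g) x = \<Delta> x (\<lambda>p q. \<zeta> (S (S p)) * b g q)"
  using form_cact_regular[OF form_b(2)[of x], of \<zeta> g] right_inv_shift[OF right_inv, of \<zeta> g x]
  by (simp add: cv_def b_def)

text \<open>By the right shift the radical is stable under the regular action. For \<open>y\<close>
  in it, the antipode axiom gives \<open>\<epsilon>(y) I(1) = b(y\<^sub>1, y\<^sub>2)\<close>, and
  this is 0 because the first legs can be taken in the radical. With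
  \<open>y = g\<^sub>1 \<zeta>(g\<^sub>2)\<close> one has \<open>\<epsilon>(y) = \<zeta>(g)\<close>,
  so every functional vanishes on \<open>g\<close>.\<close>

lemma b_nondegenerate:
  assumes "\<And>x. b g x = 0"
  shows "g = 0"
proof (rule form_eqI)
  have shift: "b (cact (regular H) \<zeta> y) x = 0" if "form \<zeta>" "\<And>x. b y x = 0" for \<zeta> x y
    using b_right_shift[OF that(1), of y x] that(2) sw_cmult[of H x 0] by simp
  fix \<zeta> assume \<zeta>: "form \<zeta>"
  define y where "y = cact (regular H) \<zeta> g"
  have y: "b y x = 0" for x using shift[OF \<zeta> assms] by (simp add: y_def)
  \<comment> \<open>Expanding the second legs in coordinates turns the first legs into
    \<open>cact (regular H) (e x) y\<close>, which stay in the radical.\<close>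
  obtain E e where X: "finite E \<and> (\<forall>x. form (e x)) \<and>
      (\<forall>a\<in>snd ` Poly_Mapping.keys (comult H y). a = (\<Sum>x\<in>E. hscale H (e x a) x))"
    by (rule exE[OF finite_coordinates[of "snd ` Poly_Mapping.keys (comult H y)"]], simp, elim exE, rule that)
  note E = X[THEN conjunct2, THEN conjunct1, rule_format]
    and co = X[THEN conjunct2, THEN conjunct2, rule_format]
  have "\<epsilon> y * I 1 = \<Delta> y b"
    unfolding b_def by (rule sw_antipode_right[OF form_I, symmetric])
  also have "\<dots> = linear_ext (*) (\<lambda>p. \<Sum>x\<in>E. e x (snd p) * b (fst p) x) (comult H y)"
    unfolding sw_def case_prod_unfold
    by (rule linear_ext_cong) (rule form_sum_coords[OF form_b(1) co], simp)
  also have "\<dots> = (\<Sum>x\<in>E. linear_ext (*) (\<lambda>p. e x (snd p) * b (fst p) x) (comult H y))"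
    by (rule sum_linear_ext)
  also have "\<dots> = (\<Sum>x\<in>E. cv (\<lambda>p. b p x) (e x) y)"
    by (simp add: cv_def sw_def case_prod_unfold mult.commute)
  also have "\<dots> = (\<Sum>x\<in>E. b (cact (regular H) (e x) y) x)"
    by (simp add: form_cact_regular[OF form_b(2)])
  also have "\<dots> = 0" using shift[OF E y] by simp
  finally have "\<epsilon> y = 0" using integral_one by simp
  then have "\<zeta> g = 0"
    unfolding y_def form_cact_regular[OF form_counit] cv_counit_left[OF \<zeta>] .
  then show "\<zeta> g = \<zeta> 0" using linear_between_0[OF \<zeta> vector_space vector_space_field] by simp
qed

text \<open>The definition gives \<open>b(f, g\<^sub>1) b(g\<^sub>2, x)\<close>; the left shift with
  \<open>\<zeta> = b f\<close> moves the first factor onto the second leg of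
  \<open>x\<close>.\<close>

lemma b_convolution: "b (convolution H I g f) = cv (b g) (b f)"
proof
  fix x
  have "b (convolution H I g f) x = \<Delta> g (\<lambda>a c. b f a * b c x)"
    unfolding convolution_def form_linear_ext[OF form_b(2)] sw_def case_prod_unfold
    using linear_betweenD(3)[OF form_b(2)] by (simp add: b_def)
  also have "\<dots> = cv (b f) (\<lambda>g. b g x) g" by (simp add: cv_def)
  also have "\<dots> = cv (b g) (b f) x"
    unfolding b_left_shift[OF form_b(1)] by (rule form_cact_regular[OF form_b(1)])
  finally show "b (convolution H I g f) x = cv (b g) (b f) x" .
qed

section \<open>The Fourier transform\<close>

abbreviation act :: "'l \<Rightarrow> 'h \<Rightarrow> 'v \<Rightarrow> 'v" where "act l g \<equiv> cact (V l) (b g)"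
abbreviation dual :: "'l \<Rightarrow> ('v \<Rightarrow> 'k) \<Rightarrow> bool" where
  "dual l \<equiv> lin_on (vscale (V l)) (space (V l))"

text \<open>Both sides are the pairing \<open>b\<close> of the coefficient of \<open>v\<close> with
  the coefficient of \<open>w\<close>, regarded as a functional of its second or of its first
  argument.\<close>

lemma act_coef:
  assumes "l \<in> \<Lambda>" "m \<in> \<Lambda>" "dual l \<phi>" "v \<in> space (V l)" "dual m \<psi>" "w \<in> space (V m)"
  shows "\<psi> (act m (coef H (V l) \<phi> v) w) = \<phi> (cact (V l) (\<lambda>g. b g (coef H (V m) \<psi> w)) v)"
  by (rule trans[OF form_coef[OF comod[OF assms(2)] assms(5) form_b(1) assms(6), symmetric]
        form_coef[OF comod[OF assms(1)] assms(3) form_b(2) assms(4)]])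

text \<open>The averaged map \<open>M\<close> sends \<open>w\<close> to \<open>v\<^sub>0 \<integral>(v\<^sub>1 S(w\<^sub>1)) \<psi>(w\<^sub>0)\<close>.\<close>

lemma average_linear:
  assumes l: "l \<in> \<Lambda>" and m: "m \<in> \<Lambda>" and v: "v \<in> space (V l)" and \<psi>: "dual m \<psi>"
  defines "M \<equiv> \<lambda>w. cact (V l) (\<lambda>g. b g (coef H (V m) \<psi> w)) v"
  shows "linear_between (vscale (V m)) (space (V m)) (vscale (V l)) (space (V l)) M"
    and "form \<zeta> \<Longrightarrow> w \<in> space (V m) \<Longrightarrow> M (cact (V m) \<zeta> w) = cact (V l) \<zeta> (M w)"
proof -
  note Cl = comod[OF l] and Cm = comod[OF m]
  interpret vl: vector_space "vscale (V l)" by (rule comodule_vs[OF Cl])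
  interpret vm: vector_space "vscale (V m)" by (rule comodule_vs[OF Cm])
  note sm = comodule_subspace[OF Cm]
  show "linear_between (vscale (V m)) (space (V m)) (vscale (V l)) (space (V l)) M"
  proof (rule linear_betweenI)
    show "M w \<in> space (V l)" for w unfolding M_def by (rule cact_in[OF Cl v])
    show "M (w + w') = M w + M w'" if "w \<in> space (V m)" "w' \<in> space (V m)" for w w'
    proof -
      have "b g (coef H (V m) \<psi> (w + w')) = b g (coef H (V m) \<psi> w) + b g (coef H (V m) \<psi> w')" for g
        using that vm.subspace_add[OF sm]
        by (simp add: form_coef[OF Cm \<psi> form_b(1)] linear_betweenD(2)[OF cact_linear[OF Cm form_b(1)]]
            linear_betweenD(2)[OF \<psi>] cact_in[OF Cm])
      then show ?thesis unfolding M_def by (simp add: cact_plus[OF Cl])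
    qed
    show "M (vscale (V m) c w) = vscale (V l) c (M w)" if "w \<in> space (V m)" for c w
    proof -
      have "b g (coef H (V m) \<psi> (vscale (V m) c w)) = c * b g (coef H (V m) \<psi> w)" for g
        using that vm.subspace_scale[OF sm]
        by (simp add: form_coef[OF Cm \<psi> form_b(1)] linear_betweenD(3)[OF cact_linear[OF Cm form_b(1)]]
            linear_betweenD(3)[OF \<psi>] cact_in[OF Cm])
      then show ?thesis unfolding M_def by (simp add: cact_times[OF Cl])
    qed
  qed
  show "M (cact (V m) \<zeta> w) = cact (V l) \<zeta> (M w)" if \<zeta>: "form \<zeta>" and w: "w \<in> space (V m)"
  proof -
    \<comment> \<open>Coefficients are colinear, so acting on \<open>w\<close> is the regular action
      on its coefficient, and the left shift turns that into a left factor \<open>\<zeta>\<close> in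
      the dual algebra.\<close>
    have "M (cact (V m) \<zeta> w) = cact (V l) (cv \<zeta> (\<lambda>g. b g (coef H (V m) \<psi> w))) v"
      unfolding M_def cact_regular_coef[OF Cm \<psi> \<zeta> w, symmetric] b_left_shift[OF \<zeta>, symmetric] ..
    also have "\<dots> = cact (V l) \<zeta> (M w)"
      unfolding M_def by (rule cact_cact[OF Cl \<zeta> form_b(2) v, symmetric])
    finally show ?thesis .
  qed
qed

text \<open>Pairing with \<open>\<psi>\<close> exposes the averaged map, which is colinear from
  \<open>V m\<close> to \<open>V l\<close> and hence zero by Schur's lemma.\<close>

lemma act_coef_other:
  assumes l: "l \<in> \<Lambda>" and m: "m \<in> \<Lambda>" "l \<noteq> m" and \<phi>: "dual l \<phi>" and v: "v \<in> space (V l)"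
    and w: "w \<in> space (V m)"
  shows "act m (coef H (V l) \<phi> v) w = 0"
proof (rule comodule_functional_sep[OF comod[OF m(1)]])
  fix \<psi> assume \<psi>: "dual m \<psi>"
  have "cact (V l) (\<lambda>g. b g (coef H (V m) \<psi> w)) v = 0"
    by (rule schur_iso[OF simple[OF m(1)] simple[OF l] average_linear[OF l m(1) v \<psi>] _ w])
      (use non_iso[OF m(1) l] m(2) in auto)
  moreover have "\<phi> 0 = 0" "\<psi> 0 = 0"
    using linear_between_0[OF \<phi> comodule_vs[OF comod[OF l]] vector_space_field]
      linear_between_0[OF \<psi> comodule_vs[OF comod[OF m(1)]] vector_space_field]
      comodule_subspace[OF comod[OF l]] comodule_vs[OF comod[OF l]]
      comodule_subspace[OF comod[OF m(1)]] comodule_vs[OF comod[OF m(1)]]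
    by (auto simp: module_iff_vector_space[symmetric] dest: module.subspace_0)
  ultimately show "\<psi> (act m (coef H (V l) \<phi> v) w) = \<psi> 0"
    unfolding act_coef[OF l m(1) \<phi> v \<psi> w] by simp
qed

text \<open>The actions on all simple comodules fix \<open>b g\<close> on coefficients, hence
  everywhere, and nondegeneracy recovers \<open>g\<close>. This is injectivity of the
  transform.\<close>

lemma b_eqI:
  assumes "\<And>l w. l \<in> \<Lambda> \<Longrightarrow> w \<in> space (V l) \<Longrightarrow> act l g w = act l g' w"
  shows "g = g'"
proof -
  have "b g x = b g' x" for x
    by (rule form_eqI_coefs[OF form_b(1) form_b(1)]) (simp add: form_coef[OF comod] form_b assms)
  then have "b (g - g') x = 0" for x
    using linear_between_diff[OF form_b(2) vector_space vector_space_field vH.subspace_UNIV UNIV_I UNIV_I]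
    by simp
  then show ?thesis using b_nondegenerate[of "g - g'"] by simp
qed

lemma act_zero: "l \<in> \<Lambda> \<Longrightarrow> act l 0 w = 0"
proof -
  assume l: "l \<in> \<Lambda>"
  interpret vl: vector_space "vscale (V l)" by (rule comodule_vs[OF comod[OF l]])
  have "b 0 = (\<lambda>x. 0 * b 0 x)"
    using linear_between_0[OF form_b(2) vector_space vector_space_field] by auto
  then have "act l 0 w = cact (V l) (\<lambda>x. 0 * b 0 x) w" by simp
  then show ?thesis by (simp only: cact_times[OF comod[OF l]] vl.scale_zero_left)
qed

lemma act_add: "l \<in> \<Lambda> \<Longrightarrow> act l (g + g') w = act l g w + act l g' w"
proof -
  assume l: "l \<in> \<Lambda>"
  have "b (g + g') = (\<lambda>x. b g x + b g' x)" using linear_betweenD(2)[OF form_b(2)] by auto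
  then show ?thesis by (simp only: cact_plus[OF comod[OF l]])
qed

lemma act_scale: "l \<in> \<Lambda> \<Longrightarrow> act l (hscale H c g) w = vscale (V l) c (act l g w)"
proof -
  assume l: "l \<in> \<Lambda>"
  have "b (hscale H c g) = (\<lambda>x. c * b g x)" using linear_betweenD(3)[OF form_b(2)] by auto
  then show ?thesis by (simp only: cact_times[OF comod[OF l]])
qed

lemma act_sum: "l \<in> \<Lambda> \<Longrightarrow> act l (\<Sum>i\<in>J. g i) w = (\<Sum>i\<in>J. act l (g i) w)"
  by (induction J rule: infinite_finite_induct) (simp_all add: act_zero act_add)

text \<open>By Schur's lemma the averaged map is a scalar depending bilinearly on \<open>\<psi>\<close> and \<open>v\<close>; this scalar
  is \<open>\<psi>(\<beta> v)\<close>.\<close>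

lemma act_coef_same:
  assumes l: "l \<in> \<Lambda>"
  obtains \<beta> where "linear_between (vscale (V l)) (space (V l)) (vscale (V l)) (space (V l)) \<beta>"
    "\<beta> ` space (V l) = space (V l)"
    "\<And>\<phi> v w. dual l \<phi> \<Longrightarrow> v \<in> space (V l) \<Longrightarrow> w \<in> space (V l) \<Longrightarrow>
       act l (coef H (V l) \<phi> v) w = vscale (V l) (\<phi> w) (\<beta> v)"
proof -
  note C = comod[OF l]
  interpret vV: vector_space "vscale (V l)" by (rule comodule_vs[OF C])
  note sV = comodule_subspace[OF C]
  obtain w0 where w0: "w0 \<in> space (V l)" "w0 \<noteq> 0"
    using simple_comoduleD(2)[OF simple[OF l]] vV.subspace_0[OF sV] by blast
  have "w0 \<notin> vV.span {}" using w0(2) by simp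
  then obtain \<phi>0 where "lin_on (vscale (V l)) UNIV \<phi>0" "\<phi>0 w0 = 1"
    by (rule vV.exists_functional)
  then have \<phi>0: "dual l \<phi>0" "\<phi>0 w0 = 1" by (auto intro: linear_between_mono)
  \<comment> \<open>As \<open>\<phi>0\<close> is 1 at \<open>w0\<close>, the formula to be proved
    leaves no other choice for \<open>\<beta> v\<close>.\<close>
  define \<beta> where "\<beta> v = act l (coef H (V l) \<phi>0 v) w0" for v
  have \<beta>: "act l (coef H (V l) \<phi> v) w = vscale (V l) (\<phi> w) (\<beta> v)"
    if \<phi>: "dual l \<phi>" and v: "v \<in> space (V l)" and w: "w \<in> space (V l)" for \<phi> v w
  proof (rule comodule_functional_sep[OF C])
    fix \<psi> assume \<psi>: "dual l \<psi>"
    \<comment> \<open>The scalar depends on \<open>\<psi>\<close> and \<open>v\<close> but not on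
      the functional and vector of the coefficient action, so evaluating at \<open>\<phi>0\<close>
      and \<open>w0\<close> identifies it with \<open>\<psi> (\<beta> v)\<close>.\<close>
    obtain c where c: "\<And>w. w \<in> space (V l) \<Longrightarrow>
        cact (V l) (\<lambda>g. b g (coef H (V l) \<psi> w)) v = vscale (V l) c w"
      using schur_scalar[OF hopf_algebra_axioms simple[OF l] average_linear[OF l l v \<psi>]] by blast
    have *: "\<psi> (act l (coef H (V l) \<phi>' v) w') = c * \<phi>' w'" if "dual l \<phi>'" "w' \<in> space (V l)" for \<phi>' w'
      using act_coef[OF l l that(1) v \<psi> that(2)] c[OF that(2)] linear_betweenD(3)[OF that]
      by simp
    have "\<beta> v \<in> space (V l)" unfolding \<beta>_def by (rule cact_in[OF C w0(1)])
    then have "\<psi> (vscale (V l) (\<phi> w) (\<beta> v)) = \<phi> w * \<psi> (\<beta> v)" by (rule linear_betweenD(3)[OF \<psi>])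
    also have "\<psi> (\<beta> v) = c" using *[OF \<phi>0(1) w0(1)] \<phi>0(2) by (simp add: \<beta>_def)
    finally show "\<psi> (act l (coef H (V l) \<phi> v) w) = \<psi> (vscale (V l) (\<phi> w) (\<beta> v))"
      using *[OF \<phi> w] by (simp add: mult.commute)
  qed
  have coef_add: "coef H (V l) \<phi>0 (v + v') = coef H (V l) \<phi>0 v + coef H (V l) \<phi>0 v'"
    if "v \<in> space (V l)" "v' \<in> space (V l)" for v v'
    using that vV.subspace_add[OF sV]
    by (intro form_eqI) (simp add: form_coef[OF C \<phi>0(1)] linear_betweenD(2)[OF cact_linear[OF C]]
        linear_betweenD(2)[OF \<phi>0(1)] cact_in[OF C] linear_betweenD(2))
  have coef_scale: "coef H (V l) \<phi>0 (vscale (V l) c v) = hscale H c (coef H (V l) \<phi>0 v)"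
    if "v \<in> space (V l)" for c v
    using that vV.subspace_scale[OF sV]
    by (intro form_eqI) (simp add: form_coef[OF C \<phi>0(1)] linear_betweenD(3)[OF cact_linear[OF C]]
        linear_betweenD(3)[OF \<phi>0(1)] cact_in[OF C] linear_betweenD(3))
  have lin: "linear_between (vscale (V l)) (space (V l)) (vscale (V l)) (space (V l)) \<beta>"
    unfolding \<beta>_def
    by (intro linear_betweenI) (simp_all add: coef_add coef_scale act_add[OF l] act_scale[OF l] cact_in[OF C w0(1)])
  \<comment> \<open>If \<open>\<beta> v = 0\<close>, every coefficient of \<open>v\<close> acts as
    zero on all simple comodules and is therefore 0; its counit is \<open>\<phi> v\<close>, so all
    functionals vanish on \<open>v\<close>.\<close>
  have ker: "v = 0" if v: "v \<in> space (V l)" and "\<beta> v = 0" for v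
  proof (rule comodule_functional_sep[OF C])
    fix \<phi> assume \<phi>: "dual l \<phi>"
    have "coef H (V l) \<phi> v = 0"
    proof (rule b_eqI)
      fix m w assume m: "m \<in> \<Lambda>" and w: "w \<in> space (V m)"
      have "act l (coef H (V l) \<phi> v) w = 0" if "w \<in> space (V l)" for w
        unfolding \<beta>[OF \<phi> v that] \<open>\<beta> v = 0\<close> by (rule vV.scale_zero_right)
      then show "act m (coef H (V l) \<phi> v) w = act m 0 w"
        using act_coef_other[OF l m _ \<phi> v w] w by (cases "l = m") (simp_all add: act_zero m)
    qed
    then have "\<epsilon> (coef H (V l) \<phi> v) = \<epsilon> 0" by simp
    then show "\<phi> v = \<phi> 0"
      using form_coef[OF C \<phi> form_counit v] cact_counit[OF C v]
        linear_between_0[OF form_counit vector_space vector_space_field]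
        linear_between_0[OF \<phi> vV.vector_space_axioms vector_space_field vV.subspace_0[OF sV]]
      by simp
  qed
  have "inj_on \<beta> (space (V l))"
  proof (rule inj_onI)
    fix x y assume xy: "x \<in> space (V l)" "y \<in> space (V l)" "\<beta> x = \<beta> y"
    then have "\<beta> (x - y) = 0"
      using linear_between_diff[OF lin vV.vector_space_axioms vV.vector_space_axioms sV] by simp
    then show "x = y" using ker[of "x - y"] vV.subspace_diff[OF sV] xy by simp
  qed
  moreover obtain B where "finite B" "vV.span B = space (V l)"
    using simple_finite_span[OF simple[OF l]] by blast
  ultimately have "\<beta> ` space (V l) = space (V l)"
    using vV.inj_imp_surj_on_span lin by blast
  then show ?thesis using that[of \<beta>] lin \<beta> by blast
qed

text \<open>In coordinates \<open>T\<close> is the sum of the rank-one maps sending \<open>w\<close>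
  to \<open>e x w\<close> times \<open>T x\<close>. Surjectivity of \<open>\<beta>\<close> writes
  each \<open>T x\<close> as \<open>\<beta> (u x)\<close>, so the coefficients of \<open>u x\<close>
  against \<open>e x\<close> add up to a preimage supported at \<open>l\<close> alone.\<close>

lemma act_surj:
  assumes l: "l \<in> \<Lambda>"
    and T: "linear_between (vscale (V l)) (space (V l)) (vscale (V l)) (space (V l)) T"
  shows "\<exists>g. (\<forall>w\<in>space (V l). act l g w = T w) \<and>
      (\<forall>m\<in>\<Lambda>. m \<noteq> l \<longrightarrow> (\<forall>w\<in>space (V m). act m g w = 0))"
proof -
  note C = comod[OF l]
  interpret vV: vector_space "vscale (V l)" by (rule comodule_vs[OF C])
  note sV = comodule_subspace[OF C]
  obtain \<beta> where \<beta>: "\<beta> ` space (V l) = space (V l)"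
    and act: "\<And>\<phi> v w. dual l \<phi> \<Longrightarrow> v \<in> space (V l) \<Longrightarrow> w \<in> space (V l) \<Longrightarrow>
       act l (coef H (V l) \<phi> v) w = vscale (V l) (\<phi> w) (\<beta> v)"
    by (rule act_coef_same[OF l], rule that) assumption+
  obtain B where B: "finite B" "vV.span B = space (V l)"
    using simple_finite_span[OF simple[OF l]] by blast
  obtain E e where E: "finite E" "E \<subseteq> space (V l)" "\<And>x. lin_on (vscale (V l)) UNIV (e x)"
    and co: "\<And>w. w \<in> space (V l) \<Longrightarrow> w = (\<Sum>x\<in>E. vscale (V l) (e x w) x)"
    by (rule vV.finite_span_basis[OF B], rule that) assumption+
  have e: "dual l (e x)" for x using E(3) by (rule linear_between_mono) auto
  have "\<exists>u\<in>space (V l). \<beta> u = T x" if "x \<in> E" for x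
    using \<beta> linear_betweenD(1)[OF T, of x] E(2) that by (metis imageE subsetD)
  then obtain u where u: "\<And>x. x \<in> E \<Longrightarrow> u x \<in> space (V l)" "\<And>x. x \<in> E \<Longrightarrow> \<beta> (u x) = T x"
    by metis
  define g where "g = (\<Sum>x\<in>E. coef H (V l) (e x) (u x))"
  have "act l g w = T w" if w: "w \<in> space (V l)" for w
  proof -
    have "T w = T (\<Sum>x\<in>E. vscale (V l) (e x w) x)" using co[OF w] by simp
    also have "\<dots> = (\<Sum>x\<in>E. T (vscale (V l) (e x w) x))"
      using E(2) vV.subspace_scale[OF sV]
      by (intro linear_between_sum[OF T vV.vector_space_axioms vV.vector_space_axioms sV]) blast
    also have "\<dots> = (\<Sum>x\<in>E. act l (coef H (V l) (e x) (u x)) w)"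
      using E(2) linear_betweenD(3)[OF T] act[OF e _ w] u by (intro sum.cong) auto
    finally show ?thesis by (simp add: g_def act_sum[OF l])
  qed
  moreover have "act m g w = 0" if "m \<in> \<Lambda>" "m \<noteq> l" "w \<in> space (V m)" for m w
    using act_coef_other[OF l that(1) that(2)[symmetric] e u(1) that(3)] that(1)
    by (simp add: g_def act_sum)
  ultimately show ?thesis by blast
qed

text \<open>A coefficient of \<open>V l\<close> acts only on \<open>V l\<close>; finite support is
  preserved by linear combinations, and coefficients span \<open>H\<close>.\<close>

lemma finite_support: "finite {l \<in> \<Lambda>. \<exists>w\<in>space (V l). act l g w \<noteq> 0}"
proof -
  let ?s = "\<lambda>g. {l \<in> \<Lambda>. \<exists>w\<in>space (V l). act l g w \<noteq> 0}"
  have "vH.subspace {g. finite (?s g)}"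
  proof (rule vH.subspaceI)
    show "0 \<in> {g. finite (?s g)}" by (auto simp: act_zero cong: conj_cong)
    show "x + y \<in> {g. finite (?s g)}" if "x \<in> {g. finite (?s g)}" "y \<in> {g. finite (?s g)}" for x y
    proof -
      have "?s (x + y) \<subseteq> ?s x \<union> ?s y" by (auto simp: act_add)
      then show ?thesis using that finite_subset by blast
    qed
    show "hscale H c x \<in> {g. finite (?s g)}" if "x \<in> {g. finite (?s g)}" for c x
    proof -
      have "?s (hscale H c x) \<subseteq> ?s x"
      proof clarsimp
        fix l w assume l: "l \<in> \<Lambda>" and "w \<in> space (V l)" "act l (hscale H c x) w \<noteq> 0"
        interpret vV: vector_space "vscale (V l)" by (rule comodule_vs[OF comod[OF l]])
        show "\<exists>w\<in>space (V l). act l x w \<noteq> 0"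
          using \<open>w \<in> space (V l)\<close> \<open>act l (hscale H c x) w \<noteq> 0\<close> act_scale[OF l, of c x w]
            vV.scale_zero_right by metis
      qed
      then show ?thesis using that finite_subset by blast
    qed
  qed
  moreover have "(\<Union>l\<in>\<Lambda>. coefs (V l)) \<subseteq> {g. finite (?s g)}"
  proof clarify
    fix l x assume l: "l \<in> \<Lambda>" and "x \<in> coefs (V l)"
    then obtain \<phi> v where \<phi>: "dual l \<phi>" "v \<in> space (V l)" "x = coef H (V l) \<phi> v"
      unfolding coefs_def by blast
    have "?s x \<subseteq> {l}" using act_coef_other[OF l _ _ \<phi>(1,2)] \<phi>(3) by blast
    then show "finite (?s x)" using finite_subset by blast
  qed
  ultimately show ?thesis using vH.span_minimal in_span_coefs[of g] by blast
qed

text \<open>Both restrictions are there because the direct sum and the endomorphism algebras consist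
  of extensional functions.\<close>

definition fourier :: "'h \<Rightarrow> 'l \<Rightarrow> 'v \<Rightarrow> 'v" where
  "fourier g = (\<lambda>l\<in>\<Lambda>. \<lambda>v\<in>space (V l). act l g v)"

lemma fourier_iso:
  "algebra_isomorphic (convolution_algebra H I) (direct_sum_algebra \<Lambda> (\<lambda>l. End_algebra (V l)))"
proof -
  let ?A = "convolution_algebra H I" and ?B = "direct_sum_algebra \<Lambda> (\<lambda>l. End_algebra (V l))"
  have into: "fourier g \<in> carrier ?B" for g
  proof -
    have "{l \<in> \<Lambda>. fourier g l \<noteq> (\<lambda>v\<in>space (V l). 0)} \<subseteq> {l \<in> \<Lambda>. \<exists>w\<in>space (V l). act l g w \<noteq> 0}"
      by (auto simp: fourier_def fun_eq_iff restrict_def split: if_splits)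
    then have "finite {l \<in> \<Lambda>. fourier g l \<noteq> (\<lambda>v\<in>space (V l). 0)}"
      using finite_support finite_subset by blast
    moreover have "linear_between (vscale (V l)) (space (V l)) (vscale (V l)) (space (V l)) (fourier g l)"
      if l: "l \<in> \<Lambda>" for l
    proof -
      interpret vV: vector_space "vscale (V l)" by (rule comodule_vs[OF comod[OF l]])
      note sV = comodule_subspace[OF comod[OF l]]
      show ?thesis
        using l linear_betweenD[OF cact_linear[OF comod[OF l] form_b(1)]]
          vV.subspace_add[OF sV] vV.subspace_scale[OF sV]
        by (intro linear_betweenI) (simp_all add: fourier_def)
    qed
    ultimately show ?thesis
      by (auto simp: direct_sum_algebra_def End_algebra_def PiE_def Pi_def)
        (auto simp: fourier_def)
  qed
  have "inj fourier"
  proof (rule injI)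
    fix g g' assume eq: "fourier g = fourier g'"
    show "g = g'"
    proof (rule b_eqI)
      fix l w assume "l \<in> \<Lambda>" "w \<in> space (V l)"
      then show "act l g w = act l g' w"
        using fun_cong[OF fun_cong[OF eq, of l], of w] by (simp add: fourier_def)
    qed
  qed
  moreover have "F \<in> range fourier" if F: "F \<in> carrier ?B" for F
  proof -
    define L where "L = {l \<in> \<Lambda>. F l \<noteq> (\<lambda>v\<in>space (V l). 0)}"
    have L: "finite L" "L \<subseteq> \<Lambda>"
      using F by (auto simp: L_def direct_sum_algebra_def End_algebra_def)
    have Fl: "F l \<in> extensional (space (V l))"
      "linear_between (vscale (V l)) (space (V l)) (vscale (V l)) (space (V l)) (F l)" if "l \<in> \<Lambda>" for l
      using F that by (auto simp: direct_sum_algebra_def End_algebra_def PiE_def Pi_def)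
    have Fext: "F \<in> extensional \<Lambda>" using F by (auto simp: direct_sum_algebra_def PiE_def)
    have "\<forall>l\<in>\<Lambda>. \<exists>g. (\<forall>w\<in>space (V l). act l g w = F l w) \<and>
      (\<forall>m\<in>\<Lambda>. m \<noteq> l \<longrightarrow> (\<forall>w\<in>space (V m). act m g w = 0))"
      using act_surj Fl(2) by blast
    then obtain g where g: "\<And>l w. l \<in> \<Lambda> \<Longrightarrow> w \<in> space (V l) \<Longrightarrow> act l (g l) w = F l w"
      and g0: "\<And>l m w. l \<in> \<Lambda> \<Longrightarrow> m \<in> \<Lambda> \<Longrightarrow> m \<noteq> l \<Longrightarrow> w \<in> space (V m) \<Longrightarrow> act m (g l) w = 0"
      by (metis (no_types, lifting))
    have act: "act m (\<Sum>l\<in>L. g l) w = F m w" if m: "m \<in> \<Lambda>" and w: "w \<in> space (V m)" for m w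
    proof -
      have "act m (\<Sum>l\<in>L. g l) w = (\<Sum>l\<in>L. if l = m then F m w else 0)"
        unfolding act_sum[OF m] using L(2) g[OF m w] g0[OF _ m _ w] by (intro sum.cong) auto
      \<comment> \<open>For \<open>m\<close> outside \<open>L\<close> no summand survives, and
        \<open>F m\<close> is the zero map by the choice of \<open>L\<close>.\<close>
      also have "\<dots> = F m w"
        using L(1) m w by (auto simp: L_def)
      finally show ?thesis .
    qed
    have "F = fourier (\<Sum>l\<in>L. g l)"
    proof (rule extensionalityI[OF Fext])
      show "fourier (\<Sum>l\<in>L. g l) \<in> extensional \<Lambda>" by (simp add: fourier_def)
      fix l assume l: "l \<in> \<Lambda>"
      show "F l = fourier (\<Sum>l\<in>L. g l) l"
        by (rule extensionalityI[OF Fl(1)[OF l]]) (use l act in \<open>auto simp: fourier_def\<close>)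
    qed
    then show ?thesis by blast
  qed
  ultimately have "bij_betw fourier (carrier ?A) (carrier ?B)"
    using into by (auto simp: bij_betw_def convolution_algebra_def)
  moreover have "fourier (x + y) = add ?B (fourier x) (fourier y)" for x y
    by (auto simp: fourier_def direct_sum_algebra_def End_algebra_def fun_eq_iff restrict_def act_add)
  moreover have "fourier (hscale H c x) = smult ?B c (fourier x)" for c x
    by (auto simp: fourier_def direct_sum_algebra_def End_algebra_def fun_eq_iff restrict_def act_scale)
  \<comment> \<open>\<open>compose\<close> applies its right factor first, just as the action of
    \<open>cv (b x) (b y)\<close> lets \<open>b y\<close> act first, so the order of the product is
    preserved.\<close>
  moreover have "fourier (convolution H I x y) = mult ?B (fourier x) (fourier y)" for x y
    using cact_in[OF comod] cact_cact[OF comod form_b(1) form_b(1)]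
    by (auto simp: fourier_def direct_sum_algebra_def End_algebra_def fun_eq_iff restrict_def
        compose_def b_convolution)
  ultimately show ?thesis
    unfolding algebra_isomorphic_def
    by (intro exI[of _ fourier]) (simp add: convolution_algebra_def)
qed

end

theorem theorem2p6:
  fixes H :: "('k::{alg_closed_field, field_char_0}, 'h::ring_1) hopf"
    and I :: "'h \<Rightarrow> 'k"
    and \<Lambda> :: "'l set"
    and V :: "'l \<Rightarrow> ('k, 'h, 'v::ab_group_add) comodule"
  assumes "hopf_algebra H"
    and "cosemisimple H"
    and "left_integral H I"
    and "simple_comodule_representatives H \<Lambda> V"
  shows "algebra_isomorphic (convolution_algebra H I)
           (direct_sum_algebra \<Lambda> (\<lambda>l. End_algebra (V l)))"
proof -
  interpret hopf_algebra H by fact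
  interpret cosemisimple_hopf_algebra H I \<Lambda> V by unfold_locales fact+
  show ?thesis by (rule fourier_iso)
qed

end
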